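(* Let $(V,c,b)$ be a braided Lie algebra over a field $K$. Let $p_0^\infty:T(V,c)\to\mathcal B(V,c)$ and $\pi_0^\infty:T(V,c)\to U(V,c,b)$ be the canonical projections. Suppose the two-sided ideal $\mathrm{Ker}(p_0^\infty)$ is generated by a set $W$. The following are equivalent. (i) $\pi_0^\infty$ vanishes on $W$. (ii) $b$ is the trivial bracket of $(V,c)$.
   Context: Fix a field $K$; all vector spaces, tensor products and maps are over $K$ ($K$-linear). An object also denotes its identity map. Braided vector space $(V,c)$: $c:V\otimes V\to V\otimes V$ linear with $(c\otimes V)(V\otimes c)(c\otimes V)=(V\otimes c)(c\otimes V)(V\otimes c)$; a morphism $f:(V,c_V)\to(W,c_W)$ is linear with $c_W(f\otimes f)=(f\otimes f)c_V$. Braided algebra $(A,m,u,c)$: an associative unital algebra and braided vector space with $c(m\otimes A)=(A\otimes m)(c\otimes A)(A\otimes c)$, $c(A\otimes m)=(m\otimes A)(A\otimes c)(c\otimes A)$, $c(u\otimes A)=A\otimes u$, $c(A\otimes u)=u\otimes A$. Braided coalgebra $(C,\Delta,\varepsilon,c)$: a coassociative counital coalgebra and braided vector space with $(\Delta\otimes C)c=(C\otimes c)(c\otimes C)(C\otimes\Delta)$, $(C\otimes\Delta)c=(c\otimes C)(C\otimes c)(\Delta\otimes C)$, $(\varepsilon\otimes C)c=C\otimes\varepsilon$, $(C\otimes\varepsilon)c=\varepsilon\otimes C$. Braided bialgebra $(B,m,u,\Delta,\varepsilon,c)$: a braided algebra and braided coalgebra with $\Delta m=(m\otimes m)(B\otimes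 c\otimes B)(\Delta\otimes\Delta)$, $\Delta(1)=1\otimes 1$, and $\varepsilon$ an algebra map. Morphisms of braided (bi)algebras are (bi)algebra maps that are morphisms of braided vector spaces. $P(B)=\{x\in B\mid \Delta(x)=x\otimes1+1\otimes x\}$. The braiding $c$ of $B$ satisfies $c(P(B)\otimes B)\subseteq B\otimes P(B)$ and $c(B\otimes P(B))\subseteq P(B)\otimes B$. A braided bialgebra map $f:B\to B'$ induces $P(f):P(B)\to P(B')$. Braided tensor algebra $T(V,c)$: the tensor algebra $T(V)$ with the unique braiding $c_T$ extending $c$ and making it a braided algebra, and with $\Delta_T$, $\varepsilon_T$ the algebra maps $\Delta_T:T(V)\to T(V)\otimes_c T(V)$, $\varepsilon_T:T(V)\to K$ such that $\Delta_T(v)=v\otimes1+1\otimes v$, $\varepsilon_T(v)=0$ for $v\in V$, where $T\otimes_cT$ has multiplication $(m_T\otimes m_T)(T\otimes c_T\otimes T)$. A bracket on a braided vector space $(V,c)$ is a family $b=(b^{[n]})_{n\in\mathbb N}$ of linear maps defined together with braided bialgebras $U^{[n]}$ and braided vector space morphisms $i^{[n]}:V\to P^{[n]}:=P(U^{[n]})$ as follows. $U^{[0]}=T(V,c)$ and $i^{[0]}$ is the inclusion. For each $n$, $b^{[n]}:P^{[n]}\to V$ is linear and, with $V^{[n]}:=i^{[n]}(V)$ and $c$ the braiding of $U^{[n]}$, one has on $P^{[n]}\otimes V^{[n]}$ and $V^{[n]}\otimes P^{[n]}$ respectively $c(i^{[n]}b^{[n]}\otimes V^{[n]})=(V^{[n]}\otimes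 i^{[n]}b^{[n]})c$ and $c(V^{[n]}\otimes i^{[n]}b^{[n]})=(i^{[n]}b^{[n]}\otimes V^{[n]})c$ (these make sense as $c$ maps $P^{[n]}\otimes V^{[n]}$ into $V^{[n]}\otimes P^{[n]}$ and conversely). Then $U^{[n+1]}=U^{[n]}/\big((\mathrm{Id}-i^{[n]}b^{[n]})[P^{[n]}]\big)$ (quotient by the two-sided ideal generated) with the unique braided bialgebra structure making the projection $\pi_n^{n+1}:U^{[n]}\to U^{[n+1]}$ a braided bialgebra map, and $i^{[n+1]}=P(\pi_n^{n+1})i^{[n]}$. The universal enveloping algebra is the direct limit $U(V,c,b)=\varinjlim U^{[n]}$ (a braided bialgebra), with canonical maps $\pi_n^\infty:U^{[n]}\to U(V,c,b)$ and $i_U:V\to U(V,c,b)$. $(V,c,b)$ is a braided Lie algebra if $i_U$ is injective. The trivial bracket $b_{tr}=(b_{tr}^{[n]})$ of $(V,c)$ is the bracket constructed recursively as follows: $b_{tr}^{[0]}:P(T(V,c))\to V$ is the restriction of the canonical projection of $T(V,c)$ onto its degree one component $V$; at each stage $U^{[n]}$ is a graded braided bialgebra (quotient of $T(V,c)$ by a homogeneous ideal) whose degree one component is $i^{[n]}(V)\cong V$, and $b_{tr}^{[n]}:P(U^{[n]})\to V$ is the restriction of the canonical projection $U^{[n]}\to V$ onto the degree one component. The Nichols algebra $\mathcal B(V,c)$ is the unique graded braided bialgebra quotient of $T(V,c)$, by a homogeneous ideal concentrated in degrees $\ge2$, whose space of primitive elements is exactly its degree one component $V$. *)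

theory Defs
  imports Complex_Main "HOL-Library.Function_Algebras"
begin

section \<open>Vector spaces and linear maps\<close>

text \<open>
  A vector space over the field \<open>'k\<close> is a subspace \<open>carr\<close> of an ambient type that carries a
  vector space structure over \<open>'k\<close> with scalar multiplication \<open>smul\<close>. Only the values of maps on carriers are relevant. Tensors are
  functionals on functions of lists, see \<open>pure\<close> below.
\<close>

type_synonym ('k, 'a) tens = "('a list \<Rightarrow> 'k) \<Rightarrow> 'k"

record ('k, 'a) braided_space =
  carr :: "'a set"
  smul :: "'k \<Rightarrow> 'a \<Rightarrow> 'a"
  braid :: "('k, 'a) tens \<Rightarrow> ('k, 'a) tens"

record ('k, 'a) braided_bialg = "('k, 'a) braided_space" +
  mul :: "'a \<Rightarrow> 'a \<Rightarrow> 'a"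
  unit_el :: "'a"
  comul :: "'a \<Rightarrow> ('k, 'a) tens"
  counit :: "'a \<Rightarrow> 'k"

definition vspace :: "('k::field, 'a::ab_group_add, 'm) braided_space_scheme \<Rightarrow> bool" where
  "vspace V \<longleftrightarrow> vector_space (smul V) \<and> module.subspace (smul V) (carr V)"

definition lin_map ::
  "('k \<Rightarrow> 'a::ab_group_add \<Rightarrow> 'a) \<Rightarrow> 'a set \<Rightarrow> ('k \<Rightarrow> 'b::ab_group_add \<Rightarrow> 'b) \<Rightarrow> 'b set \<Rightarrow> ('a \<Rightarrow> 'b) \<Rightarrow> bool"
  where
  "lin_map sA A sB B f \<longleftrightarrow>
     (\<forall>x\<in>A. f x \<in> B) \<and>
     (\<forall>x\<in>A. \<forall>y\<in>A. f (x + y) = f x + f y) \<and>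
     (\<forall>a. \<forall>x\<in>A. f (sA a x) = sB a (f x))"

section \<open>Tensor powers\<close>

definition tscale :: "'k::field \<Rightarrow> ('k, 'a) tens \<Rightarrow> ('k, 'a) tens" where
  "tscale a t = (\<lambda>\<beta>. a * t \<beta>)"

definition multilinear ::
  "('k, 'a::ab_group_add, 'm) braided_space_scheme \<Rightarrow> ('k \<Rightarrow> 'b \<Rightarrow> 'b) \<Rightarrow> nat \<Rightarrow> ('a list \<Rightarrow> 'b::ab_group_add) \<Rightarrow> bool"
  where
  "multilinear V sW n F \<longleftrightarrow>
     (\<forall>xs ys. set xs \<subseteq> carr V \<longrightarrow> set ys \<subseteq> carr V \<longrightarrow> length xs + Suc (length ys) = n \<longrightarrow>
        (\<forall>x\<in>carr V. \<forall>y\<in>carr V. F (xs @ (x + y) # ys) = F (xs @ x # ys) + F (xs @ y # ys)) \<and>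
        (\<forall>a. \<forall>x\<in>carr V. F (xs @ smul V a x # ys) = sW a (F (xs @ x # ys))))"

text \<open>
  \<open>pure V [x1, ..., xn]\<close> is the tensor \<open>x1 \<otimes> ... \<otimes> xn\<close>, represented as evaluation at
  \<open>(x1, ..., xn)\<close> on the \<open>n\<close>-linear forms on \<open>V\<close>. Over a field the canonical map from the \<open>n\<close>-th
  tensor power to the dual of the space of \<open>n\<close>-linear forms is injective, so the span of the
  evaluations is the tensor power; its universal property is proved below in
  \<open>tensor_power_universal\<close> (existence) and \<open>tensor_power_ext\<close> (uniqueness). Juxtaposition \<open>tmult\<close> identifies the tensor product of the powers \<open>m\<close>
  and \<open>n\<close> with the power \<open>m + n\<close>, strictly associatively; power \<open>1\<close> is \<open>V\<close> and power \<open>0\<close> is \<open>'k\<close>.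
\<close>

definition pure ::
  "('k::field, 'a::ab_group_add, 'm) braided_space_scheme \<Rightarrow> 'a list \<Rightarrow> ('k, 'a) tens" where
  "pure V xs = (\<lambda>\<beta>. if multilinear V (*) (length xs) \<beta> then \<beta> xs else 0)"

definition tensor_power ::
  "('k::field, 'a::ab_group_add, 'm) braided_space_scheme \<Rightarrow> nat \<Rightarrow> ('k, 'a) tens set" where
  "tensor_power V n = module.span tscale {pure V xs | xs. set xs \<subseteq> carr V \<and> length xs = n}"

definition tensor_space ::
  "('k::field, 'a::ab_group_add, 'm) braided_space_scheme \<Rightarrow> ('k, 'a) tens set" where
  "tensor_space V = module.span tscale {pure V xs | xs. set xs \<subseteq> carr V}"

text \<open>Linear extension of a tensor-valued multilinear map \<open>F\<close>, see \<open>lin_ext_pure\<close>.\<close>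

definition lin_ext :: "('a list \<Rightarrow> ('k, 'b) tens) \<Rightarrow> ('k, 'a) tens \<Rightarrow> ('k, 'b) tens" where
  "lin_ext F t = (\<lambda>\<beta>. t (\<lambda>xs. F xs \<beta>))"

definition tmult ::
  "('k::field, 'a::ab_group_add, 'm) braided_space_scheme \<Rightarrow> ('k, 'a) tens \<Rightarrow> ('k, 'a) tens \<Rightarrow> ('k, 'a) tens"
  where
  "tmult V s t = lin_ext (\<lambda>xs. lin_ext (\<lambda>ys. pure V (xs @ ys)) t) s"

text \<open>
  \<open>tensor_map V p f g\<close> is \<open>f \<otimes> g\<close>, where \<open>f\<close> is defined on the \<open>p\<close>-th tensor power of \<open>V\<close>
  and \<open>g\<close> on a further tensor power of \<open>V\<close>.
\<close>

definition tensor_map ::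
  "('k::field, 'a::ab_group_add, 'm) braided_space_scheme \<Rightarrow> nat \<Rightarrow>
     (('k, 'a) tens \<Rightarrow> ('k, 'a) tens) \<Rightarrow> (('k, 'a) tens \<Rightarrow> ('k, 'a) tens) \<Rightarrow> ('k, 'a) tens \<Rightarrow> ('k, 'a) tens"
  where
  "tensor_map V p f g =
     lin_ext (\<lambda>zs. tmult V (f (pure V (take p zs))) (g (pure V (drop p zs))))"

definition tensor_map_all ::
  "('k::field, 'b::ab_group_add, 'm) braided_space_scheme \<Rightarrow> ('a \<Rightarrow> 'b) \<Rightarrow> ('k, 'a) tens \<Rightarrow> ('k, 'b) tens"
  where
  "tensor_map_all W f = lin_ext (\<lambda>xs. pure W (map f xs))"

text \<open>
  For subspaces \<open>S\<close>, \<open>R\<close> of \<open>V\<close>: the subspace \<open>S \<otimes> R\<close> of the second tensor power, and the map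
  \<open>f \<otimes> g\<close> on it, where \<open>f\<close> is linear on \<open>S\<close> and \<open>g\<close> on \<open>R\<close> only. The conditions
  determine it uniquely on \<open>S \<otimes> R\<close>; for its existence see the lemma \<open>sub_tensor_map\<close>.
\<close>

definition sub_tensor ::
  "('k::field, 'a::ab_group_add, 'm) braided_space_scheme \<Rightarrow> 'a set \<Rightarrow> 'a set \<Rightarrow> ('k, 'a) tens set" where
  "sub_tensor V S R = module.span tscale {pure V [x, y] | x y. x \<in> S \<and> y \<in> R}"

definition sub_tensor_map ::
  "('k::field, 'a::ab_group_add, 'm) braided_space_scheme \<Rightarrow> 'a set \<Rightarrow> 'a set \<Rightarrow>
     ('a \<Rightarrow> 'a) \<Rightarrow> ('a \<Rightarrow> 'a) \<Rightarrow> ('k, 'a) tens \<Rightarrow> ('k, 'a) tens" where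
  "sub_tensor_map V S R f g =
     (SOME h. lin_map tscale (sub_tensor V S R) tscale (tensor_power V 2) h \<and>
              (\<forall>x\<in>S. \<forall>y\<in>R. h (pure V [x, y]) = pure V [f x, g y]))"

lemma vector_space_tscale: "vector_space (tscale :: 'k::field \<Rightarrow> ('k, 'a) tens \<Rightarrow> _)"
  by unfold_locales (auto simp: tscale_def fun_eq_iff algebra_simps)

lemma vector_space_times: "vector_space ((*) :: 'k::field \<Rightarrow> 'k \<Rightarrow> 'k)"
  by unfold_locales (auto simp: algebra_simps)

lemma lin_ext_pure:
  assumes "multilinear V tscale (length xs) F"
  shows "lin_ext F (pure V xs) = F xs"
proof
  fix \<beta>
  have "multilinear V (*) (length xs) (\<lambda>xs. F xs \<beta>)"
    using assms by (simp add: multilinear_def tscale_def)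
  then show "lin_ext F (pure V xs) \<beta> = F xs \<beta>"
    by (simp add: lin_ext_def pure_def)
qed

lemma tensor_power_universal:
  fixes V :: "('k::field, 'a::ab_group_add, 'm) braided_space_scheme"
    and sW :: "'k \<Rightarrow> 'w::ab_group_add \<Rightarrow> 'w"
  assumes W: "vector_space sW" and F: "multilinear V sW n F"
  shows "\<exists>h. lin_map tscale (tensor_power V n) sW UNIV h \<and>
             (\<forall>xs. set xs \<subseteq> carr V \<and> length xs = n \<longrightarrow> h (pure V xs) = F xs)"
proof -
  interpret T: vector_space "tscale :: 'k \<Rightarrow> ('k, 'a) tens \<Rightarrow> _" by (rule vector_space_tscale)
  interpret W: vector_space sW by (rule W)
  note TW = vector_space_pair.intro[OF T.vector_space_axioms W]
  note WK = vector_space_pair.intro[OF W vector_space_times]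
  note TK = vector_space_pair.intro[OF T.vector_space_axioms vector_space_times]
  let ?S = "{pure V xs | xs. set xs \<subseteq> carr V \<and> length xs = n}"
  obtain X where X: "X \<subseteq> ?S" "T.independent X" "?S \<subseteq> T.span X"
    using T.maximal_independent_subset by blast
  have "\<forall>b\<in>X. \<exists>xs. b = pure V xs \<and> set xs \<subseteq> carr V \<and> length xs = n" using X(1) by blast
  then obtain r where r: "\<And>b. b \<in> X \<Longrightarrow> b = pure V (r b) \<and> set (r b) \<subseteq> carr V \<and> length (r b) = n"
    by metis
  obtain h where h: "Vector_Spaces.linear tscale sW h" "\<forall>b\<in>X. h b = F (r b)"
    using vector_space_pair.linear_independent_extend[OF TW X(2), of "\<lambda>b. F (r b)"] by blast
  have pure: "h (pure V xs) = F xs" if xs: "set xs \<subseteq> carr V" "length xs = n" for xs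
  proof (rule ccontr)
    assume neq: "h (pure V xs) \<noteq> F xs"
    let ?w = "h (pure V xs) - F xs"
    have "W.independent {?w}" using neq by (simp add: W.dependent_single)
    then obtain \<phi> where \<phi>: "Vector_Spaces.linear sW (*) \<phi>" "\<forall>x\<in>{?w}. \<phi> x = 1"
      using vector_space_pair.linear_independent_extend[OF WK, of "{?w}" "\<lambda>_. 1"] by blast
    let ?\<beta> = "\<lambda>xs. \<phi> (F xs)"
    have \<phi>': "\<phi> (x + y) = \<phi> x + \<phi> y" "\<phi> (sW a x) = a * \<phi> x" for a x y
      using \<phi>(1) by (simp_all add: Vector_Spaces.linear_iff)
    have ml: "multilinear V (*) n ?\<beta>"
      using F by (simp add: multilinear_def \<phi>')
    have lin1: "Vector_Spaces.linear tscale (*) (\<lambda>t::('k,'a) tens. t ?\<beta>)"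
      by (simp add: Vector_Spaces.linear_iff tscale_def T.vector_space_axioms vector_space_times)
    have lin2: "Vector_Spaces.linear tscale (*) (\<lambda>t. \<phi> (h t))"
      using Vector_Spaces.linear_compose[OF h(1) \<phi>(1)] by (simp add: o_def)
    have "pure V xs \<in> T.span X" using X(3) xs by blast
    then have "pure V xs ?\<beta> = \<phi> (h (pure V xs))"
    proof (rule vector_space_pair.linear_eq_on_span[OF TK lin1 lin2, rotated])
      fix b assume b: "b \<in> X"
      then have "b ?\<beta> = pure V (r b) ?\<beta>" using r by simp
      also have "\<dots> = \<phi> (F (r b))" using r[OF b] ml by (simp add: pure_def)
      also have "\<dots> = \<phi> (h b)" using h(2) b by simp
      finally show "b ?\<beta> = \<phi> (h b)" .
    qed
    moreover have "pure V xs ?\<beta> = \<phi> (F xs)" using ml xs by (simp add: pure_def)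
    ultimately have "\<phi> ?w = 0" using \<phi>'(1)[of ?w "F xs"] by simp
    with \<phi>(2) show False by simp
  qed
  show "\<exists>h. lin_map tscale (tensor_power V n) sW UNIV h \<and>
             (\<forall>xs. set xs \<subseteq> carr V \<and> length xs = n \<longrightarrow> h (pure V xs) = F xs)"
    using pure by (intro exI[of _ h])
      (use h(1) in \<open>auto simp: lin_map_def Vector_Spaces.linear_iff\<close>)
qed

lemma lin_map_eq_on_span:
  assumes A: "vector_space sA" and f: "lin_map sA (module.span sA X) sB B f"
    and g: "lin_map sA (module.span sA X) sB B g"
    and eq: "\<And>x. x \<in> X \<Longrightarrow> f x = g x" and t: "t \<in> module.span sA X"
  shows "f t = g t"
proof -
  interpret A: vector_space sA by (rule A)
  have z: "f 0 = 0" "g 0 = 0"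
    using f g A.span_zero[of X] unfolding lin_map_def by (metis add_cancel_right_right)+
  have "t \<in> A.span X \<and> f t = g t"
    using t
  proof (induction rule: A.span_induct_alt)
    case base
    show ?case by (simp add: z A.span_zero)
  next
    case (step c x y)
    then show ?case
      using f g eq unfolding lin_map_def
      by (simp add: A.span_add A.span_scale A.span_base)
  qed
  then show ?thesis ..
qed

lemma tensor_power_ext:
  assumes "lin_map tscale (tensor_power V n) sW B h" "lin_map tscale (tensor_power V n) sW B h'"
    and "\<And>xs. set xs \<subseteq> carr V \<Longrightarrow> length xs = n \<Longrightarrow> h (pure V xs) = h' (pure V xs)"
    and "t \<in> tensor_power V n"
  shows "h t = h' t"
proof (rule lin_map_eq_on_span[OF vector_space_tscale assms(1,2)[unfolded tensor_power_def]])
  show "h x = h' x" if "x \<in> {pure V xs |xs. set xs \<subseteq> carr V \<and> length xs = n}" for x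
    using that assms(3) by blast
  show "t \<in> module.span tscale {pure V xs |xs. set xs \<subseteq> carr V \<and> length xs = n}"
    using assms(4) by (simp only: tensor_power_def)
qed

lemma lin_map_extend:
  assumes A: "vector_space sA" and B: "vector_space sB"
    and S: "module.subspace sA S" and Q: "module.subspace sB Q" and f: "lin_map sA S sB Q f"
  shows "\<exists>f'. Vector_Spaces.linear sA sB f' \<and> (\<forall>x\<in>S. f' x = f x) \<and> range f' \<subseteq> Q"
proof -
  interpret A: vector_space sA by (rule A)
  interpret B: vector_space sB by (rule B)
  obtain X where X: "X \<subseteq> S" "A.independent X" "S \<subseteq> A.span X"
    using A.maximal_independent_subset by blast
  then have span: "A.span X = S" using S A.span_minimal by blast
  obtain f' where f': "Vector_Spaces.linear sA sB f'" "\<forall>x\<in>X. f' x = f x" "range f' = B.span (f ` X)"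
    using vector_space_pair.linear_independent_extend_subspace[OF vector_space_pair.intro[OF A B] X(2), of f] by blast
  have "f ` X \<subseteq> Q" using f X(1) by (auto simp: lin_map_def)
  then have ran: "range f' \<subseteq> Q" using f'(3) Q B.span_minimal by blast
  have "f' x = f x" if "x \<in> S" for x
  proof (rule lin_map_eq_on_span[OF A, of X sB Q])
    show "lin_map sA (A.span X) sB Q f'"
      using ran f'(1) by (auto simp: lin_map_def Vector_Spaces.linear_iff)
  qed (use f f'(2) that span in auto)
  with f'(1) ran show ?thesis by blast
qed

lemma sub_tensor_map:
  fixes V :: "('k::field, 'a::ab_group_add, 'm) braided_space_scheme"
  assumes V: "vspace V" and SR: "module.subspace (smul V) S" "module.subspace (smul V) R"
    "S \<subseteq> carr V" "R \<subseteq> carr V"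
    and f: "lin_map (smul V) S (smul V) (carr V) f" and g: "lin_map (smul V) R (smul V) (carr V) g"
  shows "lin_map tscale (sub_tensor V S R) tscale (tensor_power V 2) (sub_tensor_map V S R f g)"
    and "x \<in> S \<Longrightarrow> y \<in> R \<Longrightarrow> sub_tensor_map V S R f g (pure V [x, y]) = pure V [f x, g y]"
proof -
  interpret V: vector_space "smul V" using V by (simp add: vspace_def)
  interpret T: vector_space "tscale :: 'k \<Rightarrow> ('k, 'a) tens \<Rightarrow> _" by (rule vector_space_tscale)
  have cV: "V.subspace (carr V)" using V by (simp add: vspace_def)
  obtain f' where f': "Vector_Spaces.linear (smul V) (smul V) f'" "\<forall>x\<in>S. f' x = f x" "range f' \<subseteq> carr V"
    using lin_map_extend[OF V.vector_space_axioms V.vector_space_axioms SR(1) cV f] by blast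
  obtain g' where g': "Vector_Spaces.linear (smul V) (smul V) g'" "\<forall>x\<in>R. g' x = g x" "range g' \<subseteq> carr V"
    using lin_map_extend[OF V.vector_space_axioms V.vector_space_axioms SR(2) cV g] by blast
  have f'_lin: "f' (x + y) = f' x + f' y" "f' (smul V a x) = smul V a (f' x)"
    and g'_lin: "g' (x + y) = g' x + g' y" "g' (smul V a x) = smul V a (g' x)" for a x y
    using f'(1) g'(1) by (simp_all add: Vector_Spaces.linear_iff)
  define F where "F = (\<lambda>zs. pure V [f' (zs ! 0), g' (zs ! 1)])"
  have in_carr: "f' x \<in> carr V" "g' x \<in> carr V" for x using f'(3) g'(3) by auto
  have Fm: "multilinear V tscale 2 F"
    unfolding multilinear_def
  proof (intro allI impI conjI ballI, goal_cases)
    case (1 xs ys x y)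
    then consider "xs = []" "length ys = 1" | "length xs = 1" "ys = []" by (cases xs; cases ys) auto
    then show ?case
    proof cases
      case 1
      then obtain z where z: "ys = [z]" by (auto simp: length_Suc_conv)
      have "\<beta> [f' x + f' y, g' z] = \<beta> [f' x, g' z] + \<beta> [f' y, g' z]" if "multilinear V (*) 2 \<beta>" for \<beta>
        using that[unfolded multilinear_def, rule_format, of "[]" "[g' z]"] in_carr by auto
      then show ?thesis using 1 z
        by (auto simp: F_def pure_def fun_eq_iff f'_lin numeral_2_eq_2)
    next
      case 2
      then obtain z where z: "xs = [z]" by (auto simp: length_Suc_conv)
      have "\<beta> [f' z, g' x + g' y] = \<beta> [f' z, g' x] + \<beta> [f' z, g' y]" if "multilinear V (*) 2 \<beta>" for \<beta>
        using that[unfolded multilinear_def, rule_format, of "[f' z]" "[]"] in_carr by auto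
      then show ?thesis using 2 z
        by (auto simp: F_def pure_def fun_eq_iff g'_lin numeral_2_eq_2)
    qed
  next
    case (2 xs ys a x)
    then consider "xs = []" "length ys = 1" | "length xs = 1" "ys = []" by (cases xs; cases ys) auto
    then show ?case
    proof cases
      case 1
      then obtain z where z: "ys = [z]" by (auto simp: length_Suc_conv)
      have "\<beta> [smul V a (f' x), g' z] = a * \<beta> [f' x, g' z]" if "multilinear V (*) 2 \<beta>" for \<beta>
        using that[unfolded multilinear_def, rule_format, of "[]" "[g' z]"] in_carr by auto
      then show ?thesis using 1 z
        by (auto simp: F_def pure_def tscale_def fun_eq_iff f'_lin numeral_2_eq_2)
    next
      case 2
      then obtain z where z: "xs = [z]" by (auto simp: length_Suc_conv)
      have "\<beta> [f' z, smul V a (g' x)] = a * \<beta> [f' z, g' x]" if "multilinear V (*) 2 \<beta>" for \<beta>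
        using that[unfolded multilinear_def, rule_format, of "[f' z]" "[]"] in_carr by auto
      then show ?thesis using 2 z
        by (auto simp: F_def pure_def tscale_def fun_eq_iff g'_lin numeral_2_eq_2)
    qed
  qed
  obtain h where h: "lin_map tscale (tensor_power V 2) tscale UNIV h"
    "\<And>xs. set xs \<subseteq> carr V \<Longrightarrow> length xs = 2 \<Longrightarrow> h (pure V xs) = F xs"
    using tensor_power_universal[OF T.vector_space_axioms Fm] by blast
  have FT: "F xs \<in> tensor_power V 2" for xs
    unfolding F_def tensor_power_def using in_carr
    by (intro T.span_base CollectI exI[of _ "[f' (xs ! 0), g' (xs ! 1)]"]) simp
  have h0: "h 0 = 0"
  proof -
    have "0 \<in> tensor_power V 2" by (simp add: tensor_power_def T.span_zero)
    then have "h (0 + 0) = h 0 + h 0" using h(1) unfolding lin_map_def by blast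
    then show ?thesis by (simp only: add_0_left) simp
  qed
  have T2: "T.subspace (tensor_power V 2)"
    unfolding tensor_power_def by (rule T.subspace_span)
  have hT: "h t \<in> tensor_power V 2" if t: "t \<in> tensor_power V 2" for t
  proof -
    have "T.subspace {t \<in> tensor_power V 2. h t \<in> tensor_power V 2}"
    proof (rule T.subspaceI)
      show "0 \<in> {t \<in> tensor_power V 2. h t \<in> tensor_power V 2}"
        using T.subspace_0[OF T2] by (simp only: mem_Collect_eq h0)
    next
      fix x y assume "x \<in> {t \<in> tensor_power V 2. h t \<in> tensor_power V 2}"
        "y \<in> {t \<in> tensor_power V 2. h t \<in> tensor_power V 2}"
      moreover from this have "h (x + y) = h x + h y" using h(1) unfolding lin_map_def by blast
      ultimately show "x + y \<in> {t \<in> tensor_power V 2. h t \<in> tensor_power V 2}"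
        using T.subspace_add[OF T2] by (simp only: mem_Collect_eq)
    next
      fix c x assume "x \<in> {t \<in> tensor_power V 2. h t \<in> tensor_power V 2}"
      moreover from this have "h (tscale c x) = tscale c (h x)" using h(1) unfolding lin_map_def by blast
      ultimately show "tscale c x \<in> {t \<in> tensor_power V 2. h t \<in> tensor_power V 2}"
        using T.subspace_scale[OF T2] by (simp only: mem_Collect_eq)
    qed
    moreover have "{pure V xs |xs. set xs \<subseteq> carr V \<and> length xs = 2} \<subseteq> {t \<in> tensor_power V 2. h t \<in> tensor_power V 2}"
    proof clarify
      fix xs assume xs: "set xs \<subseteq> carr V" "length xs = 2"
      then have "pure V xs \<in> tensor_power V 2" unfolding tensor_power_def by (intro T.span_base) blast
      with h(2)[OF xs] FT show "pure V xs \<in> tensor_power V 2 \<and> h (pure V xs) \<in> tensor_power V 2" by simp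
    qed
    ultimately show ?thesis using t T.span_minimal unfolding tensor_power_def by blast
  qed
  have sub: "sub_tensor V S R \<subseteq> tensor_power V 2"
    unfolding sub_tensor_def tensor_power_def
  proof (rule T.span_mono, clarify)
    fix x y assume "x \<in> S" "y \<in> R"
    then show "\<exists>xs. pure V [x, y] = pure V xs \<and> set xs \<subseteq> carr V \<and> length xs = 2"
      using SR(3,4) by (intro exI[of _ "[x, y]"]) auto
  qed
  have hS: "lin_map tscale (sub_tensor V S R) tscale (tensor_power V 2) h"
    using h(1) hT sub unfolding lin_map_def by blast
  have hp: "h (pure V [x, y]) = pure V [f x, g y]" if "x \<in> S" "y \<in> R" for x y
    using that SR(3,4) h(2)[of "[x, y]"] f'(2) g'(2) by (auto simp: F_def)
  have "lin_map tscale (sub_tensor V S R) tscale (tensor_power V 2) (sub_tensor_map V S R f g) \<and>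
        (\<forall>x\<in>S. \<forall>y\<in>R. sub_tensor_map V S R f g (pure V [x, y]) = pure V [f x, g y])"
    unfolding sub_tensor_map_def by (rule someI[of _ h]) (use hS hp in blast)
  then show "lin_map tscale (sub_tensor V S R) tscale (tensor_power V 2) (sub_tensor_map V S R f g)"
    and "x \<in> S \<Longrightarrow> y \<in> R \<Longrightarrow> sub_tensor_map V S R f g (pure V [x, y]) = pure V [f x, g y]"
    by blast+
qed

lemma tmult_pure:
  fixes V :: "('k::field, 'a::ab_group_add, 'm) braided_space_scheme"
  assumes V: "vspace V" and "set xs \<subseteq> carr V" "set ys \<subseteq> carr V"
  shows "tmult V (pure V xs) (pure V ys) = pure V (xs @ ys)"
proof -
  have 1: "multilinear V tscale (length vs) (\<lambda>vs. pure V (us @ vs))" if us: "set us \<subseteq> carr V" for us and vs :: "'a list"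
    unfolding multilinear_def
  proof (intro allI impI)
    fix as bs :: "'a list"
    assume *: "set as \<subseteq> carr V" "set bs \<subseteq> carr V" "length as + Suc (length bs) = length vs"
    have "multilinear V (*) (length us + Suc (length as + length bs)) \<beta> \<Longrightarrow>
        (\<forall>x\<in>carr V. \<forall>y\<in>carr V. \<beta> (us @ as @ (x + y) # bs) = \<beta> (us @ as @ x # bs) + \<beta> (us @ as @ y # bs)) \<and>
        (\<forall>a. \<forall>x\<in>carr V. \<beta> (us @ as @ smul V a x # bs) = a * \<beta> (us @ as @ x # bs))" for \<beta>
      unfolding multilinear_def
      by (drule spec[of _ "us @ as"], drule spec[of _ bs]) (use us * in simp)
    then show "(\<forall>x\<in>carr V. \<forall>y\<in>carr V. pure V (us @ as @ (x + y) # bs) = pure V (us @ as @ x # bs) + pure V (us @ as @ y # bs)) \<and>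
        (\<forall>a. \<forall>x\<in>carr V. pure V (us @ as @ smul V a x # bs) = tscale a (pure V (us @ as @ x # bs)))"
      by (auto simp: pure_def tscale_def fun_eq_iff)
  qed
  have 2: "lin_ext (\<lambda>vs. pure V (us @ vs)) (pure V ys) = pure V (us @ ys)" if "set us \<subseteq> carr V" for us
    by (rule lin_ext_pure[OF 1[OF that]])
  interpret V: vector_space "smul V" using V by (simp add: vspace_def)
  have cV: "V.subspace (carr V)" using V by (simp add: vspace_def)
  have clos: "x + y \<in> carr V" "smul V a x \<in> carr V" if "x \<in> carr V" "y \<in> carr V" for a x y
    using that cV by (auto simp: V.subspace_add V.subspace_scale)
  have 3: "multilinear V tscale (length xs) (\<lambda>us. lin_ext (\<lambda>vs. pure V (us @ vs)) (pure V ys))"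
    unfolding multilinear_def
  proof (intro allI impI)
    fix as bs :: "'a list"
    assume *: "set as \<subseteq> carr V" "set bs \<subseteq> carr V" "length as + Suc (length bs) = length xs"
    have cl: "lin_ext (\<lambda>vs. pure V ((as @ x # bs) @ vs)) (pure V ys) = pure V (as @ x # bs @ ys)"
      if "x \<in> carr V" for x using 2[of "as @ x # bs"] * that by simp
    show "(\<forall>x\<in>carr V. \<forall>y\<in>carr V. lin_ext (\<lambda>vs. pure V ((as @ (x + y) # bs) @ vs)) (pure V ys) = lin_ext (\<lambda>vs. pure V ((as @ x # bs) @ vs)) (pure V ys) + lin_ext (\<lambda>vs. pure V ((as @ y # bs) @ vs)) (pure V ys)) \<and>
        (\<forall>a. \<forall>x\<in>carr V. lin_ext (\<lambda>vs. pure V ((as @ smul V a x # bs) @ vs)) (pure V ys) = tscale a (lin_ext (\<lambda>vs. pure V ((as @ x # bs) @ vs)) (pure V ys)))"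
    proof (intro conjI ballI allI)
      fix x y assume xy: "x \<in> carr V" "y \<in> carr V"
      have "set (as @ bs @ ys) \<subseteq> carr V" using * assms by simp
      then have "pure V (as @ (x + y) # (bs @ ys)) = pure V (as @ x # (bs @ ys)) + pure V (as @ y # (bs @ ys))"
        using 1[of "[]" "as @ x # (bs @ ys)", unfolded multilinear_def, rule_format, of as "bs @ ys"] xy by simp
      then show "lin_ext (\<lambda>vs. pure V ((as @ (x + y) # bs) @ vs)) (pure V ys) = lin_ext (\<lambda>vs. pure V ((as @ x # bs) @ vs)) (pure V ys) + lin_ext (\<lambda>vs. pure V ((as @ y # bs) @ vs)) (pure V ys)"
        by (simp only: cl xy clos)
    next
      fix a x assume x: "x \<in> carr V"
      have "set (as @ bs @ ys) \<subseteq> carr V" using * assms by simp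
      then have "pure V (as @ smul V a x # (bs @ ys)) = tscale a (pure V (as @ x # (bs @ ys)))"
        using 1[of "[]" "as @ x # (bs @ ys)", unfolded multilinear_def, rule_format, of as "bs @ ys"] x by simp
      then show "lin_ext (\<lambda>vs. pure V ((as @ smul V a x # bs) @ vs)) (pure V ys) = tscale a (lin_ext (\<lambda>vs. pure V ((as @ x # bs) @ vs)) (pure V ys))"
        by (simp only: cl[OF x] cl[OF clos(2)[OF x x]])
    qed
  qed
  show ?thesis
    unfolding tmult_def by (simp only: lin_ext_pure[OF 3] 2[OF assms(2)])
qed

section \<open>Braided vector spaces, algebras, coalgebras and bialgebras\<close>

definition braided_vector_space ::
  "('k::field, 'a::ab_group_add, 'm) braided_space_scheme \<Rightarrow> bool" where
  "braided_vector_space V \<longleftrightarrow>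
     vspace V \<and>
     lin_map tscale (tensor_power V 2) tscale (tensor_power V 2) (braid V) \<and>
     (let c = braid V; cV = tensor_map V 2 c id; Vc = tensor_map V 1 id c
      in \<forall>t\<in>tensor_power V 3. cV (Vc (cV t)) = Vc (cV (Vc t)))"

definition braided_space_hom ::
  "('k::field, 'a::ab_group_add, 'm) braided_space_scheme \<Rightarrow>
   ('k, 'b::ab_group_add, 'n) braided_space_scheme \<Rightarrow> ('a \<Rightarrow> 'b) \<Rightarrow> bool" where
  "braided_space_hom V W f \<longleftrightarrow>
     lin_map (smul V) (carr V) (smul W) (carr W) f \<and>
     (\<forall>t\<in>tensor_power V 2. braid W (tensor_map_all W f t) = tensor_map_all W f (braid V t))"

text \<open>
  The structure maps as maps between tensor powers: \<open>m\<close> from power 2 to 1, \<open>u\<close> from 0 to 1,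
  \<open>\<Delta>\<close> from 1 to 2 and \<open>\<epsilon>\<close> from 1 to 0.
\<close>

definition mulT :: "('k::field, 'a::ab_group_add, 'm) braided_bialg_scheme \<Rightarrow> ('k, 'a) tens \<Rightarrow> ('k, 'a) tens" where
  "mulT A = lin_ext (\<lambda>zs. pure A [mul A (zs ! 0) (zs ! 1)])"

definition unitT :: "('k::field, 'a::ab_group_add, 'm) braided_bialg_scheme \<Rightarrow> ('k, 'a) tens \<Rightarrow> ('k, 'a) tens" where
  "unitT A = lin_ext (\<lambda>zs. pure A [unit_el A])"

definition comulT :: "('k::field, 'a::ab_group_add, 'm) braided_bialg_scheme \<Rightarrow> ('k, 'a) tens \<Rightarrow> ('k, 'a) tens" where
  "comulT A = lin_ext (\<lambda>zs. comul A (zs ! 0))"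

definition counitT :: "('k::field, 'a::ab_group_add, 'm) braided_bialg_scheme \<Rightarrow> ('k, 'a) tens \<Rightarrow> ('k, 'a) tens" where
  "counitT A = lin_ext (\<lambda>zs. tscale (counit A (zs ! 0)) (pure A []))"

definition unital_algebra :: "('k::field, 'a::ab_group_add, 'm) braided_bialg_scheme \<Rightarrow> bool" where
  "unital_algebra A \<longleftrightarrow>
     vspace A \<and>
     (\<forall>x\<in>carr A. lin_map (smul A) (carr A) (smul A) (carr A) (\<lambda>y. mul A x y)) \<and>
     (\<forall>y\<in>carr A. lin_map (smul A) (carr A) (smul A) (carr A) (\<lambda>x. mul A x y)) \<and>
     (\<forall>x\<in>carr A. \<forall>y\<in>carr A. \<forall>z\<in>carr A. mul A (mul A x y) z = mul A x (mul A y z)) \<and>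
     unit_el A \<in> carr A \<and>
     (\<forall>x\<in>carr A. mul A (unit_el A) x = x \<and> mul A x (unit_el A) = x)"

definition counital_coalgebra :: "('k::field, 'a::ab_group_add, 'm) braided_bialg_scheme \<Rightarrow> bool" where
  "counital_coalgebra C \<longleftrightarrow>
     vspace C \<and>
     lin_map (smul C) (carr C) tscale (tensor_power C 2) (comul C) \<and>
     lin_map (smul C) (carr C) (*) UNIV (counit C) \<and>
     (\<forall>x\<in>carr C.
        tensor_map C 1 (comulT C) id (comul C x) = tensor_map C 1 id (comulT C) (comul C x) \<and>
        tensor_map C 1 (counitT C) id (comul C x) = pure C [x] \<and>
        tensor_map C 1 id (counitT C) (comul C x) = pure C [x])"

definition braided_algebra :: "('k::field, 'a::ab_group_add, 'm) braided_bialg_scheme \<Rightarrow> bool" where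
  "braided_algebra A \<longleftrightarrow>
     unital_algebra A \<and> braided_vector_space A \<and>
     (let c = braid A; m = mulT A; u = unitT A;
          cA = tensor_map A 2 c id; Ac = tensor_map A 1 id c
      in (\<forall>t\<in>tensor_power A 3.
            c (tensor_map A 2 m id t) = tensor_map A 1 id m (cA (Ac t)) \<and>
            c (tensor_map A 1 id m t) = tensor_map A 2 m id (Ac (cA t))) \<and>
         (\<forall>t\<in>tensor_power A 1.
            c (tensor_map A 0 u id t) = tensor_map A 1 id u t \<and>
            c (tensor_map A 1 id u t) = tensor_map A 0 u id t))"

definition braided_coalgebra :: "('k::field, 'a::ab_group_add, 'm) braided_bialg_scheme \<Rightarrow> bool" where
  "braided_coalgebra C \<longleftrightarrow>
     counital_coalgebra C \<and> braided_vector_space C \<and>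
     (let c = braid C; \<Delta> = comulT C; \<epsilon> = counitT C;
          cC = tensor_map C 2 c id; Cc = tensor_map C 1 id c
      in \<forall>t\<in>tensor_power C 2.
           tensor_map C 1 \<Delta> id (c t) = Cc (cC (tensor_map C 1 id \<Delta> t)) \<and>
           tensor_map C 1 id \<Delta> (c t) = cC (Cc (tensor_map C 1 \<Delta> id t)) \<and>
           tensor_map C 1 \<epsilon> id (c t) = tensor_map C 1 id \<epsilon> t \<and>
           tensor_map C 1 id \<epsilon> (c t) = tensor_map C 1 \<epsilon> id t)"

definition braided_bialgebra :: "('k::field, 'a::ab_group_add, 'm) braided_bialg_scheme \<Rightarrow> bool" where
  "braided_bialgebra B \<longleftrightarrow>
     braided_algebra B \<and> braided_coalgebra B \<and>
     (\<forall>t\<in>tensor_power B 2.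
        comulT B (mulT B t) =
          tensor_map B 2 (mulT B) (mulT B)
            (tensor_map B 1 id (tensor_map B 2 (braid B) id)
              (tensor_map B 1 (comulT B) (comulT B) t))) \<and>
     comul B (unit_el B) = pure B [unit_el B, unit_el B] \<and>
     (\<forall>x\<in>carr B. \<forall>y\<in>carr B. counit B (mul B x y) = counit B x * counit B y) \<and>
     counit B (unit_el B) = 1"

definition braided_bialgebra_hom ::
  "('k::field, 'a::ab_group_add, 'm) braided_bialg_scheme \<Rightarrow>
   ('k, 'b::ab_group_add, 'n) braided_bialg_scheme \<Rightarrow> ('a \<Rightarrow> 'b) \<Rightarrow> bool" where
  "braided_bialgebra_hom A B f \<longleftrightarrow>
     braided_space_hom A B f \<and>
     (\<forall>x\<in>carr A. \<forall>y\<in>carr A. f (mul A x y) = mul B (f x) (f y)) \<and>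
     f (unit_el A) = unit_el B \<and>
     (\<forall>x\<in>carr A. comul B (f x) = tensor_map_all B f (comul A x)) \<and>
     (\<forall>x\<in>carr A. counit B (f x) = counit A x)"

definition prim :: "('k::field, 'a::ab_group_add, 'm) braided_bialg_scheme \<Rightarrow> 'a set" where
  "prim B = {x \<in> carr B. comul B x = pure B [x, unit_el B] + pure B [unit_el B, x]}"

definition two_sided_ideal :: "('k::field, 'a::ab_group_add, 'm) braided_bialg_scheme \<Rightarrow> 'a set \<Rightarrow> bool" where
  "two_sided_ideal A I \<longleftrightarrow>
     module.subspace (smul A) I \<and> I \<subseteq> carr A \<and>
     (\<forall>x\<in>carr A. \<forall>y\<in>I. mul A x y \<in> I \<and> mul A y x \<in> I)"

definition ker_on :: "('k::field, 'a::ab_group_add, 'm) braided_bialg_scheme \<Rightarrow> ('a \<Rightarrow> 'b::zero) \<Rightarrow> 'a set" where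
  "ker_on A f = {x \<in> carr A. f x = 0}"

section \<open>Gradings and the tensor algebra\<close>

definition homog_decomp :: "(nat \<Rightarrow> 'a set) \<Rightarrow> 'a::ab_group_add \<Rightarrow> (nat \<Rightarrow> 'a) \<Rightarrow> bool" where
  "homog_decomp G x d \<longleftrightarrow>
     (\<forall>k. d k \<in> G k) \<and> finite {k. d k \<noteq> 0} \<and> x = (\<Sum>k | d k \<noteq> 0. d k)"

definition graded_braided_bialgebra ::
  "('k::field, 'a::ab_group_add, 'm) braided_bialg_scheme \<Rightarrow> (nat \<Rightarrow> 'a set) \<Rightarrow> bool" where
  "graded_braided_bialgebra A G \<longleftrightarrow>
     braided_bialgebra A \<and>
     (\<forall>k. module.subspace (smul A) (G k) \<and> G k \<subseteq> carr A) \<and>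
     (\<forall>x\<in>carr A. \<exists>!d. homog_decomp G x d) \<and>
     (\<forall>m n. \<forall>x\<in>G m. \<forall>y\<in>G n. mul A x y \<in> G (m + n)) \<and>
     unit_el A \<in> G 0 \<and>
     (\<forall>n. \<forall>x\<in>G n. comul A x \<in>
        module.span tscale {pure A [y, z] | y z j. j \<le> n \<and> y \<in> G j \<and> z \<in> G (n - j)}) \<and>
     (\<forall>n>0. \<forall>x\<in>G n. counit A x = 0) \<and>
     (\<forall>m n. \<forall>t\<in>sub_tensor A (G m) (G n). braid A t \<in> sub_tensor A (G n) (G m))"

text \<open>
  For an algebra \<open>A\<close> and a linear map \<open>i\<close> from \<open>V\<close> to \<open>A\<close>: the span of the products
  \<open>i v1 \<cdots> i vk\<close>. For the tensor algebra this is the degree \<open>k\<close> component, for a quotient of the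
  tensor algebra it is the image of that component.
\<close>

definition degree_part ::
  "('k::field, 'v::ab_group_add, 'm) braided_space_scheme \<Rightarrow>
   ('k, 'a::ab_group_add, 'n) braided_bialg_scheme \<Rightarrow> ('v \<Rightarrow> 'a) \<Rightarrow> nat \<Rightarrow> 'a set" where
  "degree_part V A i k =
     module.span (smul A) {foldr (mul A) (map i vs) (unit_el A) | vs. set vs \<subseteq> carr V \<and> length vs = k}"

definition is_tensor_algebra ::
  "('k::field, 'v::ab_group_add, 'm) braided_space_scheme \<Rightarrow>
   ('k, 'a::ab_group_add, 'n) braided_bialg_scheme \<Rightarrow> ('v \<Rightarrow> 'a) \<Rightarrow> bool" where
  "is_tensor_algebra V A i \<longleftrightarrow>
     unital_algebra A \<and>
     (\<exists>\<phi>. lin_map tscale (tensor_space V) (smul A) (carr A) \<phi> \<and>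
          bij_betw \<phi> (tensor_space V) (carr A) \<and>
          (\<forall>s\<in>tensor_space V. \<forall>t\<in>tensor_space V. \<phi> (tmult V s t) = mul A (\<phi> s) (\<phi> t)) \<and>
          \<phi> (pure V []) = unit_el A \<and>
          (\<forall>v\<in>carr V. \<phi> (pure V [v]) = i v))"

text \<open>
  \<open>T\<close> with inclusion \<open>i\<close> is the braided tensor algebra of \<open>V\<close>. That \<open>\<Delta>\<close> and \<open>\<epsilon>\<close> are algebra
  maps (to the braided tensor square and to \<open>'k\<close>) is part of \<open>braided_bialgebra\<close>.
\<close>

definition braided_tensor_algebra ::
  "('k::field, 'v::ab_group_add, 'm) braided_space_scheme \<Rightarrow>
   ('k, 'a::ab_group_add, 'n) braided_bialg_scheme \<Rightarrow> ('v \<Rightarrow> 'a) \<Rightarrow> bool" where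
  "braided_tensor_algebra V T i \<longleftrightarrow>
     is_tensor_algebra V T i \<and> braided_bialgebra T \<and> braided_space_hom V T i \<and>
     (\<forall>v\<in>carr V. comul T (i v) = pure T [i v, unit_el T] + pure T [unit_el T, i v] \<and>
                 counit T (i v) = 0)"

section \<open>Brackets and braided Lie algebras\<close>

definition bracket_stage ::
  "('k::field, 'v::ab_group_add, 'm) braided_space_scheme \<Rightarrow>
   ('k, 'u::ab_group_add, 'n) braided_bialg_scheme \<Rightarrow> ('v \<Rightarrow> 'u) \<Rightarrow> ('u \<Rightarrow> 'v) \<Rightarrow> bool" where
  "bracket_stage V U i b \<longleftrightarrow>
     braided_bialgebra U \<and>
     braided_space_hom V U i \<and> i ` carr V \<subseteq> prim U \<and>
     lin_map (smul U) (prim U) (smul V) (carr V) b \<and>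
     (let P = prim U; VU = i ` carr V; c = braid U in
        (\<forall>t\<in>sub_tensor U P VU.
           c (sub_tensor_map U P VU (i \<circ> b) id t) = sub_tensor_map U VU P id (i \<circ> b) (c t)) \<and>
        (\<forall>t\<in>sub_tensor U VU P.
           c (sub_tensor_map U VU P id (i \<circ> b) t) = sub_tensor_map U P VU (i \<circ> b) id (c t)))"

text \<open>
  The bracket \<open>b\<close> comes with the braided bialgebras \<open>U n\<close>, the projections \<open>\<pi> n\<close> from \<open>U n\<close> to
  \<open>U (n + 1)\<close> and the maps \<open>i n\<close> it is defined with. Quotients are given up to isomorphism: \<open>\<pi> n\<close>
  is a surjective braided bialgebra map whose kernel is the ideal divided out.
\<close>

definition bracket ::
  "('k::field, 'v::ab_group_add, 'm) braided_space_scheme \<Rightarrow>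
   (nat \<Rightarrow> ('k, 'u::ab_group_add, 'n) braided_bialg_scheme) \<Rightarrow>
   (nat \<Rightarrow> 'u \<Rightarrow> 'u) \<Rightarrow> (nat \<Rightarrow> 'v \<Rightarrow> 'u) \<Rightarrow> (nat \<Rightarrow> 'u \<Rightarrow> 'v) \<Rightarrow> bool" where
  "bracket V U \<pi> i b \<longleftrightarrow>
     braided_vector_space V \<and>
     braided_tensor_algebra V (U 0) (i 0) \<and>
     (\<forall>n. bracket_stage V (U n) (i n) (b n) \<and>
          braided_bialgebra_hom (U n) (U (Suc n)) (\<pi> n) \<and>
          \<pi> n ` carr (U n) = carr (U (Suc n)) \<and>
          ker_on (U n) (\<pi> n) =
            two_sided_ideal (U n) hull ((\<lambda>x. x - i n (b n x)) ` prim (U n)) \<and>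
          (\<forall>v\<in>carr V. i (Suc n) v = \<pi> n (i n v)))"

text \<open>
  The direct limit: \<open>transition \<pi> m l\<close> is the map from \<open>U m\<close> to \<open>U l\<close> (\<open>m \<le> l\<close>). The
  conditions say that \<open>L\<close> is the disjoint union of the \<open>U n\<close> modulo eventual agreement, with
  structure such that the canonical maps \<open>\<pi>inf n\<close> are braided bialgebra maps; with \<open>l = n + 1\<close>
  they contain compatibility of the \<open>\<pi>inf n\<close> with the \<open>\<pi> n\<close>.
\<close>

definition transition :: "(nat \<Rightarrow> 'u \<Rightarrow> 'u) \<Rightarrow> nat \<Rightarrow> nat \<Rightarrow> 'u \<Rightarrow> 'u" where
  "transition \<pi> m l = fold \<pi> [m..<l]"

definition is_direct_limit ::
  "(nat \<Rightarrow> ('k::field, 'u::ab_group_add, 'n) braided_bialg_scheme) \<Rightarrow> (nat \<Rightarrow> 'u \<Rightarrow> 'u) \<Rightarrow>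
   ('k, 'l::ab_group_add, 'o) braided_bialg_scheme \<Rightarrow> (nat \<Rightarrow> 'u \<Rightarrow> 'l) \<Rightarrow> bool" where
  "is_direct_limit U \<pi> L \<pi>inf \<longleftrightarrow>
     braided_bialgebra L \<and>
     (\<forall>n. braided_bialgebra_hom (U n) L (\<pi>inf n)) \<and>
     carr L = (\<Union>n. \<pi>inf n ` carr (U n)) \<and>
     (\<forall>m n. \<forall>x\<in>carr (U m). \<forall>y\<in>carr (U n).
        \<pi>inf m x = \<pi>inf n y \<longleftrightarrow>
        (\<exists>l. m \<le> l \<and> n \<le> l \<and> transition \<pi> m l x = transition \<pi> n l y))"

text \<open>\<open>L\<close> is the universal enveloping algebra and \<open>\<pi>inf 0 \<circ> i 0\<close> its canonical map \<open>i\<^sub>U\<close>.\<close>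

definition braided_lie_algebra ::
  "('k::field, 'v::ab_group_add, 'm) braided_space_scheme \<Rightarrow>
   (nat \<Rightarrow> ('k, 'u::ab_group_add, 'n) braided_bialg_scheme) \<Rightarrow>
   (nat \<Rightarrow> 'u \<Rightarrow> 'u) \<Rightarrow> (nat \<Rightarrow> 'v \<Rightarrow> 'u) \<Rightarrow> (nat \<Rightarrow> 'u \<Rightarrow> 'v) \<Rightarrow>
   ('k, 'l::ab_group_add, 'o) braided_bialg_scheme \<Rightarrow> (nat \<Rightarrow> 'u \<Rightarrow> 'l) \<Rightarrow> bool" where
  "braided_lie_algebra V U \<pi> i b L \<pi>inf \<longleftrightarrow>
     bracket V U \<pi> i b \<and> is_direct_limit U \<pi> L \<pi>inf \<and> inj_on (\<pi>inf 0 \<circ> i 0) (carr V)"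

text \<open>
  \<open>b\<close> is the trivial bracket. As \<open>U (n + 1)\<close> is determined by \<open>U n\<close> and \<open>b n\<close>, the recursive
  construction amounts to a condition at each stage: \<open>U n\<close> is graded by the images of the
  components of the tensor algebra, its degree one component \<open>i n ` carr V\<close> is a copy of \<open>V\<close>, and
  \<open>b n\<close> takes a primitive element to its component \<open>d 1\<close> of degree one, read in \<open>V\<close>.
\<close>

definition trivial_bracket ::
  "('k::field, 'v::ab_group_add, 'm) braided_space_scheme \<Rightarrow>
   (nat \<Rightarrow> ('k, 'u::ab_group_add, 'n) braided_bialg_scheme) \<Rightarrow>
   (nat \<Rightarrow> 'v \<Rightarrow> 'u) \<Rightarrow> (nat \<Rightarrow> 'u \<Rightarrow> 'v) \<Rightarrow> bool" where
  "trivial_bracket V U i b \<longleftrightarrow>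
     (\<forall>n. graded_braided_bialgebra (U n) (degree_part V (U n) (i n)) \<and>
          inj_on (i n) (carr V) \<and>
          (\<forall>x\<in>prim (U n). \<forall>d. homog_decomp (degree_part V (U n) (i n)) x d \<longrightarrow> i n (b n x) = d 1))"

section \<open>Nichols algebras\<close>

definition homogeneous_in_degrees_ge_2 :: "(nat \<Rightarrow> 'a::ab_group_add set) \<Rightarrow> 'a set \<Rightarrow> bool" where
  "homogeneous_in_degrees_ge_2 G I \<longleftrightarrow>
     (\<forall>x\<in>I. \<forall>d. homog_decomp G x d \<longrightarrow> (\<forall>k. d k \<in> I) \<and> d 0 = 0 \<and> d 1 = 0)"

text \<open>\<open>B\<close> is the Nichols algebra of \<open>V\<close>, and \<open>p\<close> the projection from the tensor algebra \<open>T\<close>.\<close>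

definition nichols_algebra ::
  "('k::field, 'v::ab_group_add, 'm) braided_space_scheme \<Rightarrow>
   ('k, 'u::ab_group_add, 'n) braided_bialg_scheme \<Rightarrow> ('v \<Rightarrow> 'u) \<Rightarrow>
   ('k, 'b::ab_group_add, 'o) braided_bialg_scheme \<Rightarrow> ('u \<Rightarrow> 'b) \<Rightarrow> bool" where
  "nichols_algebra V T i B p \<longleftrightarrow>
     braided_bialgebra_hom T B p \<and> p ` carr T = carr B \<and>
     homogeneous_in_degrees_ge_2 (degree_part V T i) (ker_on T p) \<and>
     graded_braided_bialgebra B (\<lambda>k. p ` degree_part V T i k) \<and>
     prim B = p ` degree_part V T i 1"

end

theory Submission
  imports Defs
begin

text \<open>
  Let \<open>K\<close> be the kernel of the projection onto the Nichols algebra. If \<open>K\<close> dies in the limit, then by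
  induction every \<open>U n\<close> is graded and lies between the tensor algebra and the Nichols algebra: a
  primitive \<open>x\<close> of \<open>U n\<close> is primitive in the Nichols algebra, so modulo the image of \<open>K\<close> it equals some
  \<open>i n v\<close>, its degree one component, and comparing images in the limit, where \<open>V\<close> embeds, gives
  \<open>b n x = v\<close>. As the components of a primitive element are primitive, the next ideal is homogeneous
  and contained in the image of \<open>K\<close>.

  Conversely, let \<open>b\<close> be trivial and \<open>x\<close> in \<open>K\<close> be homogeneous of degree \<open>n\<close>, where necessarily \<open>n \<ge> 2\<close>.
  By induction the elements of \<open>K\<close> of lower degree die in the limit; only a finite-dimensional space of
  them matters for the coproduct of \<open>x\<close>, so at some finite stage \<open>x\<close> becomes primitive. Its degree one
  component vanishes, so the next quotient kills it.
\<close>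

section \<open>Linear maps on subspaces\<close>

text \<open>Both directions carry primitivity from one quotient of the tensor algebra to another,
  and primitivity lives in the tensor square, where the kernel of h \<otimes> h is awkward. It is
  never computed. If a projection f vanishes on the kernel of h inside a subspace S, then f factors
  through h on S by a linear map, so whatever h \<otimes> h kills inside S \<otimes> S is killed by
  f \<otimes> f. For (i) to (ii) the Nichols projection is factored through a stage
  \<open>U n\<close>. For (ii) to (i) a stage is factored through the Nichols projection; no single
  stage need kill all elements of \<open>K\<close> of low degree, so S has to be the span of the
  finitely many tensor factors of one reduced coproduct.

  A second obstacle: the tensor algebra is given only as a braided bialgebra with prescribed values
  on \<open>V\<close>, so that its braiding, coproduct and counit respect degrees has to be
  derived.\<close>

lemma lin_mapD:
  assumes "lin_map sA A sB B f"
  shows "x \<in> A \<Longrightarrow> f x \<in> B" "x \<in> A \<Longrightarrow> y \<in> A \<Longrightarrow> f (x + y) = f x + f y"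
    "x \<in> A \<Longrightarrow> f (sA a x) = sB a (f x)"
  using assms unfolding lin_map_def by blast+

lemma lin_map_mono:
  "lin_map sA A sB B f \<Longrightarrow> A' \<subseteq> A \<Longrightarrow> B \<subseteq> B' \<Longrightarrow> lin_map sA A' sB B' f"
  unfolding lin_map_def by blast

lemma lin_map_comp:
  "lin_map sA A sB B f \<Longrightarrow> lin_map sB B sC C g \<Longrightarrow> lin_map sA A sC C (g \<circ> f)"
  unfolding lin_map_def by auto

lemma lin_map_id: "lin_map sA A sA A id"
  unfolding lin_map_def by auto

context
  fixes sA :: "'k::field \<Rightarrow> 'a::ab_group_add \<Rightarrow> 'a" and sB :: "'k \<Rightarrow> 'b::ab_group_add \<Rightarrow> 'b"
    and A B f
  assumes sA: "vector_space sA" and A: "module.subspace sA A" and f: "lin_map sA A sB B f"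
begin

interpretation vector_space sA by (rule sA)

lemma lin_map_0: "f 0 = 0"
proof -
  have "f (0 + 0) = f 0 + f 0" using lin_mapD(2)[OF f] subspace_0[OF A] by blast
  then show ?thesis by simp
qed

lemma lin_map_diff:
  assumes "x \<in> A" "y \<in> A" shows "f (x - y) = f x - f y"
proof -
  have "f (x - y + y) = f (x - y) + f y"
    using lin_mapD(2)[OF f] subspace_diff[OF A] assms by blast
  then show ?thesis by simp
qed

lemma lin_map_sum:
  assumes "\<And>k. k \<in> S \<Longrightarrow> d k \<in> A" shows "f (sum d S) = (\<Sum>k\<in>S. f (d k))"
  using assms
proof (induction S rule: infinite_finite_induct)
  case (insert x F)
  then show ?case using lin_mapD(2)[OF f] subspace_sum[OF A, of F d] by simp
qed (simp_all add: lin_map_0)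

lemma lin_map_kernel_subspace: "subspace {x \<in> A. f x \<in> S}"
  if "vector_space sB" "module.subspace sB S" for S
proof -
  interpret B: vector_space sB by (rule that)
  show ?thesis
    using A that(2) lin_mapD[OF f] lin_map_0
    by (auto simp: subspace_def B.subspace_def)
qed

text \<open>The standard way below to pass a property of values from generators to their span when
  \<open>f\<close> is linear on \<open>A\<close> only: the elements of \<open>A\<close> with value
  in \<open>S\<close> form a subspace.\<close>

lemma lin_map_span_image:
  assumes "vector_space sB" "module.subspace sB S" "X \<subseteq> A"
    and "\<And>x. x \<in> X \<Longrightarrow> f x \<in> S" and "t \<in> module.span sA X"
  shows "f t \<in> S"
  using span_minimal[OF _ lin_map_kernel_subspace[OF assms(1,2)], of X] assms(3-5) by blast

lemma lin_map_image_span: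
  assumes "vector_space sB" "X \<subseteq> A"
  shows "f ` span X = module.span sB (f ` X)"
proof -
  interpret B: vector_space sB by (rule assms)
  have XA: "span X \<subseteq> A" using span_minimal[OF assms(2) A] .
  have "f x \<in> B.span (f ` X)" if "x \<in> span X" for x
    using lin_map_span_image[OF assms(1) B.subspace_span assms(2) _ that] B.span_base by blast
  moreover have "B.subspace (f ` span X)"
  proof (rule B.subspaceI)
    show "0 \<in> f ` span X" using lin_map_0 span_zero by force
  next
    fix x y assume "x \<in> f ` span X" "y \<in> f ` span X"
    then obtain a b where "a \<in> span X" "b \<in> span X" "x = f a" "y = f b" by blast
    moreover from this have "f (a + b) = f a + f b" using lin_mapD(2)[OF f] XA by blast
    ultimately show "x + y \<in> f ` span X" using span_add by (intro image_eqI[of _ _ "a + b"]) auto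
  next
    fix c x assume "x \<in> f ` span X"
    then obtain a where "a \<in> span X" "x = f a" by blast
    moreover from this have "f (sA c a) = sB c (f a)" using lin_mapD(3)[OF f] XA by blast
    ultimately show "sB c x \<in> f ` span X" using span_scale by (intro image_eqI[of _ _ "sA c a"]) auto
  qed
  then have "B.span (f ` X) \<subseteq> f ` span X"
    by (intro B.span_minimal image_mono) (auto intro: span_base)
  ultimately show ?thesis by blast
qed

lemma lin_map_image_subspace:
  assumes "vector_space sB" "subspace S" "S \<subseteq> A"
  shows "module.subspace sB (f ` S)"
proof -
  interpret B: vector_space sB by (rule assms)
  show ?thesis using lin_map_image_span[OF assms(1,3)] assms(2) by (metis B.subspace_span span_eq_iff)
qed

end

text \<open>Kernel containment makes the value of \<open>f\<close> independent of the chosen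
  preimage under \<open>h\<close>, which defines \<open>g\<close> on the image of \<open>S\<close>.
  Extending \<open>g\<close> to the whole ambient type spares later uses any condition on the other
  elements of the target.\<close>

lemma lin_map_factor:
  fixes sA :: "'k::field \<Rightarrow> 'a::ab_group_add \<Rightarrow> 'a" and sB :: "'k \<Rightarrow> 'b::ab_group_add \<Rightarrow> 'b"
    and sC :: "'k \<Rightarrow> 'c::ab_group_add \<Rightarrow> 'c"
  assumes sA: "vector_space sA" and sB: "vector_space sB" and sC: "vector_space sC"
    and S: "module.subspace sA S" and C: "module.subspace sC C"
    and h: "lin_map sA S sB B h" and f: "lin_map sA S sC C f"
    and ker: "\<And>x. x \<in> S \<Longrightarrow> h x = 0 \<Longrightarrow> f x = 0"
  obtains g where "lin_map sB UNIV sC C g" "\<And>x. x \<in> S \<Longrightarrow> g (h x) = f x"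
proof -
  interpret A: vector_space sA by (rule sA)
  interpret B: vector_space sB by (rule sB)
  have hS: "B.subspace (h ` S)" using lin_map_image_subspace[OF sA S h sB S] by simp
  define g where "g y = f (SOME x. x \<in> S \<and> h x = y)" for y
  have g: "g (h x) = f x" if x: "x \<in> S" for x
  proof -
    let ?x = "SOME z. z \<in> S \<and> h z = h x"
    have *: "?x \<in> S \<and> h ?x = h x" by (rule someI[of _ x]) (use x in simp)
    then have "f (?x - x) = 0"
      using x lin_map_diff[OF sA S h] A.subspace_diff[OF S] by (intro ker) auto
    then show ?thesis using * x lin_map_diff[OF sA S f] by (simp add: g_def)
  qed
  have "lin_map sB (h ` S) sC C g"
    unfolding lin_map_def
  proof (intro conjI ballI allI)
    fix x assume "x \<in> h ` S"
    then show "g x \<in> C" using g lin_mapD(1)[OF f] by auto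
    fix y assume "y \<in> h ` S"
    with \<open>x \<in> h ` S\<close> obtain a b where "a \<in> S" "b \<in> S" "x = h a" "y = h b" by blast
    then show "g (x + y) = g x + g y"
      using g[of "a + b"] lin_mapD(2)[OF f] lin_mapD(2)[OF h] g A.subspace_add[OF S] by auto
  next
    fix c x assume "x \<in> h ` S"
    then obtain a where "a \<in> S" "x = h a" by blast
    then show "g (sB c x) = sC c (g x)"
      using g[of "sA c a"] lin_mapD(3)[OF f] lin_mapD(3)[OF h] g A.subspace_scale[OF S] by auto
  qed
  then obtain g' where "Vector_Spaces.linear sB sC g'" "\<forall>x\<in>h ` S. g' x = g x" "range g' \<subseteq> C"
    using lin_map_extend[OF sB sC hS C] by blast
  then show ?thesis using g by (intro that[of g']) (auto simp: lin_map_def Vector_Spaces.linear_iff)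
qed

section \<open>Tensors\<close>

global_interpretation tens: vector_space "tscale :: 'k::field \<Rightarrow> ('k, 'a) tens \<Rightarrow> _"
  by (rule vector_space_tscale)

text \<open>Tensors are functions; simp should not evaluate sums of tensors pointwise.\<close>

declare plus_fun_apply [simp del] zero_fun_apply [simp del] minus_apply [simp del]

lemma vspaceD:
  assumes "vspace V"
  shows "vector_space (smul V)" "module.subspace (smul V) (carr V)"
    "0 \<in> carr V" "x \<in> carr V \<Longrightarrow> y \<in> carr V \<Longrightarrow> x + y \<in> carr V"
    "x \<in> carr V \<Longrightarrow> smul V a x \<in> carr V"
    "x \<in> carr V \<Longrightarrow> y \<in> carr V \<Longrightarrow> x - y \<in> carr V"
proof -
  show *: "vector_space (smul V)" "module.subspace (smul V) (carr V)" using assms by (auto simp: vspace_def)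
  interpret vector_space "smul V" by (rule *)
  show "0 \<in> carr V" "x \<in> carr V \<Longrightarrow> y \<in> carr V \<Longrightarrow> x + y \<in> carr V"
    "x \<in> carr V \<Longrightarrow> smul V a x \<in> carr V"
    "x \<in> carr V \<Longrightarrow> y \<in> carr V \<Longrightarrow> x - y \<in> carr V"
    using *(2) subspace_0 subspace_add subspace_scale subspace_diff by blast+
qed

lemma lin_ext_add: "lin_ext F (s + t) = lin_ext F s + lin_ext F t"
  and lin_ext_scale: "lin_ext F (tscale a t) = tscale a (lin_ext F t)"
  by (auto simp: lin_ext_def tscale_def plus_fun_def)

lemma lin_map_lin_ext: "lin_map tscale UNIV tscale UNIV (lin_ext F)"
  by (simp add: lin_map_def lin_ext_add lin_ext_scale)

lemma lin_ext_0:
  fixes F :: "'a list \<Rightarrow> ('k::field, 'b) tens"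
  shows "lin_ext F 0 = 0"
  using lin_map_0[OF vector_space_tscale tens.subspace_UNIV lin_map_lin_ext] .

lemma pure_in_tensor_power: "set xs \<subseteq> carr V \<Longrightarrow> length xs = n \<Longrightarrow> pure V xs \<in> tensor_power V n"
  unfolding tensor_power_def by (rule tens.span_base) blast

lemma subspace_tensor_power: "tens.subspace (tensor_power V n)"
  unfolding tensor_power_def by (rule tens.subspace_span)

lemma subspace_tensor_space: "tens.subspace (tensor_space V)"
  unfolding tensor_space_def by (rule tens.subspace_span)

lemma tensor_power_subset_space: "tensor_power V n \<subseteq> tensor_space V"
  unfolding tensor_power_def tensor_space_def by (rule tens.span_mono) blast

lemma pure_in_tensor_space: "set xs \<subseteq> carr V \<Longrightarrow> pure V xs \<in> tensor_space V"
  unfolding tensor_space_def by (rule tens.span_base) blast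

lemma pure_add:
  assumes "set xs \<subseteq> carr V" "set ys \<subseteq> carr V" "x \<in> carr V" "y \<in> carr V"
  shows "pure V (xs @ (x + y) # ys) = pure V (xs @ x # ys) + pure V (xs @ y # ys)"
  using assms by (auto simp: pure_def fun_eq_iff multilinear_def plus_fun_def)

lemma pure_scale:
  assumes "set xs \<subseteq> carr V" "set ys \<subseteq> carr V" "x \<in> carr V"
  shows "pure V (xs @ smul V a x # ys) = tscale a (pure V (xs @ x # ys))"
  using assms by (auto simp: pure_def fun_eq_iff multilinear_def tscale_def)

lemma multilinear_lin_comp:
  assumes V: "vspace V" and h: "lin_map tscale (tensor_power V n) sW W h"
  shows "multilinear V sW n (\<lambda>xs. h (pure V xs))"
  unfolding multilinear_def
proof (intro allI impI conjI ballI, goal_cases)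
  case (1 xs ys x y)
  then show ?case using lin_mapD(2)[OF h, of "pure V (xs @ x # ys)" "pure V (xs @ y # ys)"]
    by (simp add: pure_add pure_in_tensor_power)
next
  case (2 xs ys a x)
  then show ?case using lin_mapD(3)[OF h, of "pure V (xs @ x # ys)" a]
    by (simp add: pure_scale pure_in_tensor_power)
qed

lemma multilinear_pure_append:
  assumes "set xs \<subseteq> carr V" "set ys \<subseteq> carr V"
  shows "multilinear V tscale n (\<lambda>zs. pure V (xs @ zs @ ys))"
  unfolding multilinear_def
proof (intro allI impI conjI ballI, goal_cases)
  case (1 us vs x y)
  then show ?case using pure_add[of "xs @ us" V "vs @ ys" x y] assms by simp
next
  case (2 us vs a x)
  then show ?case using pure_scale[of "xs @ us" V "vs @ ys" x a] assms by simp
qed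

section \<open>Bilinearity of juxtaposition\<close>

lemma tmult_left_linear: "lin_map tscale UNIV tscale UNIV (\<lambda>s. tmult V s t)"
  unfolding tmult_def by (rule lin_map_lin_ext)

lemma multilinear_cong:
  assumes V: "vspace V" and F: "multilinear V sW n F"
    and eq: "\<And>xs. set xs \<subseteq> carr V \<Longrightarrow> F xs = G xs"
  shows "multilinear V sW n G"
  unfolding multilinear_def
proof (intro allI impI conjI ballI, goal_cases)
  case (1 xs ys x y)
  then show ?case using F[unfolded multilinear_def, rule_format, OF 1(1-3)] vspaceD(4)[OF V]
    by (simp add: eq[symmetric])
next
  case (2 xs ys a x)
  then show ?case using F[unfolded multilinear_def, rule_format, OF 2(1-3)] vspaceD(5)[OF V]
    by (simp add: eq[symmetric])
qed

lemma multilinear_combination: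
  assumes F: "multilinear V tscale n F" and G: "multilinear V tscale n G"
  shows "multilinear V tscale n (\<lambda>xs. tscale c (F xs) + G xs)"
  unfolding multilinear_def
proof (intro allI impI, goal_cases)
  case (1 xs ys)
  show ?case using F[unfolded multilinear_def, rule_format, OF 1] G[unfolded multilinear_def, rule_format, OF 1]
    by (simp add: tens.scale_right_distrib tens.scale_left_commute)
qed

text \<open>\<open>lin_ext_pure\<close> asks for multilinearity in the left block with the tensor
  \<open>t\<close> fixed. For pure \<open>t\<close> the map appends a fixed list; the general case
  follows by writing \<open>t\<close> as a combination of pure tensors.\<close>

lemma tmult_pure_left:
  assumes V: "vspace V" and xs: "set xs \<subseteq> carr V" and t: "t \<in> tensor_space V"
  shows "tmult V (pure V xs) t = lin_ext (\<lambda>ys. pure V (xs @ ys)) t"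
  unfolding tmult_def
proof (rule lin_ext_pure)
  show "multilinear V tscale (length xs) (\<lambda>us. lin_ext (\<lambda>ys. pure V (us @ ys)) t)"
    using t unfolding tensor_space_def
  proof (induction rule: tens.span_induct_alt)
    case base
    show ?case by (auto simp only: lin_ext_0 multilinear_def tens.scale_zero_right add_0_left)
  next
    case (step c x y)
    then obtain zs where zs: "x = pure V zs" "set zs \<subseteq> carr V" by blast
    have "multilinear V tscale (length xs) (\<lambda>us. lin_ext (\<lambda>ys. pure V (us @ ys)) x)"
    proof (rule multilinear_cong[OF V multilinear_pure_append[of "[]" V zs]])
      fix us assume "set us \<subseteq> carr V"
      then show "pure V ([] @ us @ zs) = lin_ext (\<lambda>ys. pure V (us @ ys)) x"
        using lin_ext_pure[of V zs "\<lambda>ys. pure V (us @ ys)"] multilinear_pure_append[of us V "[]"]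
        by (simp add: zs)
    qed (use zs in auto)
    from multilinear_combination[OF this step(2)] show ?case by (simp only: lin_ext_add lin_ext_scale)
  qed
qed

text \<open>The right factor sits inside the function to which the functional \<open>s\<close> is
  applied, and functionals are not additive in general; even \<open>pure\<close> is so only on
  multilinear forms. Hence both factors are restricted to \<open>tensor_space V\<close>, whereas
  linearity in the left factor is unconditional.\<close>

lemma tmult_right_linear:
  assumes V: "vspace V" and s: "s \<in> tensor_space V"
  shows "lin_map tscale (tensor_space V) tscale UNIV (tmult V s)"
  using s unfolding tensor_space_def
proof (induction rule: tens.span_induct_alt)
  case base
  show ?case by (auto simp only: lin_map_def tmult_def lin_ext_0 tens.scale_zero_right add_0_left UNIV_I)
next
  case (step c x y)
  then obtain zs where zs: "x = pure V zs" "set zs \<subseteq> carr V" by blast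
  have *: "lin_map tscale (tensor_space V) tscale UNIV (tmult V x)"
    using tmult_pure_left[OF V zs(2)] subspace_tensor_space[of V]
    by (simp add: lin_map_def zs(1) lin_ext_add lin_ext_scale tens.subspace_add tens.subspace_scale)
  have "tmult V (tscale c x + y) = (\<lambda>t. tscale c (tmult V x t) + tmult V y t)"
    by (rule ext) (simp only: tmult_def lin_ext_add lin_ext_scale)
  with * step(2) show ?case unfolding tensor_space_def
    by (simp add: lin_map_def tens.scale_right_distrib tens.scale_left_commute)
qed

lemma tmult_span:
  assumes V: "vspace V" and X: "X \<subseteq> tensor_space V" and Y: "Y \<subseteq> tensor_space V"
    and Z: "tens.subspace Z" and XY: "\<And>x y. x \<in> X \<Longrightarrow> y \<in> Y \<Longrightarrow> tmult V x y \<in> Z"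
    and s: "s \<in> tens.span X" and t: "t \<in> tens.span Y"
  shows "tmult V s t \<in> Z"
proof (rule lin_map_span_image[OF vector_space_tscale tens.subspace_UNIV tmult_left_linear
      vector_space_tscale Z _ _ s])
  show "tmult V x t \<in> Z" if "x \<in> X" for x
    by (rule lin_map_span_image[OF vector_space_tscale subspace_tensor_space
        tmult_right_linear[OF V] vector_space_tscale Z Y _ t]) (use X XY that in auto)
qed simp

lemma tmult_in_tensor_space:
  assumes V: "vspace V" and s: "s \<in> tensor_space V" and t: "t \<in> tensor_space V"
  shows "tmult V s t \<in> tensor_space V"
proof (rule tmult_span[OF V _ _ subspace_tensor_space _ s[unfolded tensor_space_def] t[unfolded tensor_space_def]])
qed (auto intro!: pure_in_tensor_space simp: tmult_pure[OF V] subset_iff)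

text \<open>Values of all degrees are allowed because the structure maps change the degree, and
  juxtaposing values only asks for membership in \<open>tensor_space V\<close>.\<close>

abbreviation tlin :: "('k::field, 'a::ab_group_add, 'm) braided_space_scheme \<Rightarrow> nat \<Rightarrow> (('k, 'a) tens \<Rightarrow> ('k, 'a) tens) \<Rightarrow> bool" where
  "tlin V n f \<equiv> lin_map tscale (tensor_power V n) tscale (tensor_space V) f"

lemma multilinear_tensor_map:
  assumes V: "vspace V" and f: "tlin V m f" and g: "tlin V n g"
  shows "multilinear V tscale (m + n) (\<lambda>zs. tmult V (f (pure V (take m zs))) (g (pure V (drop m zs))))"
  unfolding multilinear_def
proof (intro allI impI, goal_cases)
  case (1 us vs)
  have tl: "tmult V (s + s') t = tmult V s t + tmult V s' t" "tmult V (tscale a s) t = tscale a (tmult V s t)" for s s' t a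
    using tmult_left_linear[of V t] by (auto simp: lin_map_def)
  have tr: "tmult V s (t + t') = tmult V s t + tmult V s t'" "tmult V s (tscale a t) = tscale a (tmult V s t)"
    if "s \<in> tensor_space V" "t \<in> tensor_space V" "t' \<in> tensor_space V" for s t t' a
    using tmult_right_linear[OF V that(1)] that by (auto simp: lin_map_def)
  show ?case
  \<comment> \<open>The slot being varied has index \<open>length us\<close>, so it belongs to the
    left factor exactly in the first case; the other factor then stays fixed.\<close>
  proof (cases "length us < m")
    case True
    then obtain k where k: "m - length us = Suc k" by (metis Suc_diff_Suc)
    have m: "set (take k vs) \<subseteq> carr V" "length us + Suc (length (take k vs)) = m"
      using 1 k True by (auto dest: in_set_takeD)
    have "take m (us @ z # vs) = us @ z # take k vs" "drop m (us @ z # vs) = drop k vs" for z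
      using True k by auto
    then show ?thesis
      using multilinear_lin_comp[OF V f, unfolded multilinear_def, rule_format, OF 1(1) m]
      by (simp add: tl)
  next
    case False
    then have m: "set (drop m us) \<subseteq> carr V" "length (drop m us) + Suc (length vs) = n"
      "set (take m us) \<subseteq> carr V" "length (take m us) = m"
      using 1 by (auto dest: in_set_takeD in_set_dropD)
    have "take m (us @ z # vs) = take m us" "drop m (us @ z # vs) = drop m us @ z # vs" for z
      using False by auto
    moreover have "f (pure V (take m us)) \<in> tensor_space V"
      using m(3,4) lin_mapD(1)[OF f] pure_in_tensor_power by blast
    moreover have "g (pure V (drop m us @ z # vs)) \<in> tensor_space V" if "z \<in> carr V" for z
      using m 1 that by (intro lin_mapD(1)[OF g] pure_in_tensor_power) auto
    ultimately show ?thesis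
      using multilinear_lin_comp[OF V g, unfolded multilinear_def, rule_format, OF m(1) 1(2) m(2)]
      by (simp add: tr)
  qed
qed

lemma tensor_map_pure:
  assumes V: "vspace V" and f: "tlin V m f" and g: "tlin V n g"
    and "set xs \<subseteq> carr V" "set ys \<subseteq> carr V" "length xs = m" "length ys = n"
  shows "tensor_map V m f g (pure V (xs @ ys)) = tmult V (f (pure V xs)) (g (pure V ys))"
  unfolding tensor_map_def
  by (subst lin_ext_pure) (use multilinear_tensor_map[OF V f g] assms in auto)

lemma tlin_lin_ext:
  assumes "\<And>xs. set xs \<subseteq> carr V \<Longrightarrow> length xs = n \<Longrightarrow> lin_ext F (pure V xs) \<in> tensor_space V"
  shows "tlin V n (lin_ext F)"
proof -
  have "lin_ext F t \<in> tensor_space V" if "t \<in> tensor_power V n" for t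
    by (rule lin_map_span_image[OF vector_space_tscale tens.subspace_UNIV lin_map_lin_ext
          vector_space_tscale subspace_tensor_space _ _ that[unfolded tensor_power_def]])
      (use assms in auto)
  then show ?thesis by (simp add: lin_map_def lin_ext_add lin_ext_scale)
qed

lemma tlin_tensor_map:
  assumes V: "vspace V" and f: "tlin V m f" and g: "tlin V n g"
  shows "tlin V (m + n) (tensor_map V m f g)"
  unfolding tensor_map_def
proof (rule tlin_lin_ext)
  fix zs assume zs: "set zs \<subseteq> carr V" "length zs = m + n"
  then have "set (take m zs) \<subseteq> carr V" "set (drop m zs) \<subseteq> carr V" by (auto dest: in_set_takeD in_set_dropD)
  with zs have "tmult V (f (pure V (take m zs))) (g (pure V (drop m zs))) \<in> tensor_space V"
    by (intro tmult_in_tensor_space[OF V] lin_mapD(1)[OF f] lin_mapD(1)[OF g] pure_in_tensor_power) auto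
  then show "lin_ext (\<lambda>zs. tmult V (f (pure V (take m zs))) (g (pure V (drop m zs)))) (pure V zs) \<in> tensor_space V"
    by (subst lin_ext_pure) (use multilinear_tensor_map[OF V f g] zs in auto)
qed

lemma tlin_id: "tlin V n id"
  using tensor_power_subset_space[of V n] by (auto simp: lin_map_def)

section \<open>Tensor powers of a linear map\<close>

lemma tensor_map_all_pure:
  assumes f: "lin_map (smul V) (carr V) (smul W) (carr W) f" and xs: "set xs \<subseteq> carr V"
  shows "tensor_map_all W f (pure V xs) = pure W (map f xs)"
  unfolding tensor_map_all_def
proof (rule lin_ext_pure)
  show "multilinear V tscale (length xs) (\<lambda>xs. pure W (map f xs))"
    unfolding multilinear_def
  proof (intro allI impI conjI ballI, goal_cases)
    case (1 xs ys x y)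
    then show ?case using pure_add[of "map f xs" W "map f ys" "f x" "f y"] lin_mapD[OF f] by auto
  next
    case (2 xs ys a x)
    then show ?case using pure_scale[of "map f xs" W "map f ys" "f x" a] lin_mapD[OF f] by auto
  qed
qed

lemma lin_map_tensor_map_all: "lin_map tscale UNIV tscale UNIV (tensor_map_all W f)"
  unfolding tensor_map_all_def by (rule lin_map_lin_ext)

lemma tensor_map_all_comp:
  assumes f: "lin_map (smul U) (carr U) (smul V) (carr V) f"
    and g: "lin_map (smul V) (carr V) (smul W) (carr W) g" and t: "t \<in> tensor_power U n"
  shows "tensor_map_all W g (tensor_map_all V f t) = tensor_map_all W (g \<circ> f) t"
proof (rule tensor_power_ext[OF _ _ _ t, of tscale UNIV "tensor_map_all W g \<circ> tensor_map_all V f", unfolded o_apply])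
  show "lin_map tscale (tensor_power U n) tscale UNIV (\<lambda>x. tensor_map_all W g (tensor_map_all V f x))"
    using lin_map_comp[OF lin_map_tensor_map_all lin_map_tensor_map_all, of W g V f]
    by (auto simp: lin_map_def)
  show "lin_map tscale (tensor_power U n) tscale UNIV (tensor_map_all W (g \<circ> f))"
    using lin_map_mono[OF lin_map_tensor_map_all] by blast
  fix xs assume xs: "set xs \<subseteq> carr U" "length xs = n"
  then have "set (map f xs) \<subseteq> carr V" using lin_mapD(1)[OF f] by auto
  then show "tensor_map_all W g (tensor_map_all V f (pure U xs)) = tensor_map_all W (g \<circ> f) (pure U xs)"
    using tensor_map_all_pure[OF f xs(1)] tensor_map_all_pure[OF g, of "map f xs"]
      tensor_map_all_pure[OF lin_map_comp[OF f g] xs(1)] by simp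
qed

section \<open>Graded vector spaces\<close>

definition component :: "(nat \<Rightarrow> 'a::ab_group_add set) \<Rightarrow> 'a \<Rightarrow> nat \<Rightarrow> 'a" where
  "component G x = (THE d. homog_decomp G x d)"

text \<open>\<open>S\<close> may exceed the support, so that two decompositions can be added or
  compared over one common index set.\<close>

lemma homog_decompI:
  assumes "finite S" "\<And>k. d k \<in> G k" "\<And>k. k \<notin> S \<Longrightarrow> d k = 0" "x = sum d S"
  shows "homog_decomp G x d"
proof -
  have S: "{k. d k \<noteq> 0} \<subseteq> S" using assms(3) by blast
  then have "sum d S = sum d {k. d k \<noteq> 0}" by (intro sum.mono_neutral_right assms(1)) auto
  then show ?thesis using assms finite_subset[OF S] by (simp add: homog_decomp_def)
qed

lemma homog_decomp_sum:
  assumes "homog_decomp G x d" "finite S" "\<And>k. k \<notin> S \<Longrightarrow> d k = 0"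
  shows "x = sum d S"
proof -
  have "sum d {k. d k \<noteq> 0} = sum d S" by (intro sum.mono_neutral_left) (use assms in auto)
  then show ?thesis using assms(1) by (simp add: homog_decomp_def)
qed

lemma homog_decompD:
  assumes "homog_decomp G x d"
  shows "d k \<in> G k" "finite {k. d k \<noteq> 0}" "x = (\<Sum>k | d k \<noteq> 0. d k)"
  using assms unfolding homog_decomp_def by blast+

text \<open>The linear part of a grading, separated from the bialgebra structure so that it also
  applies to \<open>tensor_space\<close>, from which the tensor algebra inherits its
  grading.\<close>

locale graded_space = vector_space s for s :: "'k::field \<Rightarrow> 'a::ab_group_add \<Rightarrow> 'a" +
  fixes A :: "'a set" and G :: "nat \<Rightarrow> 'a set"
  assumes subspace_carrier: "subspace A"
    and subspace_part: "subspace (G k)"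
    and part_subset: "G k \<subseteq> A"
    and decomp_unique: "x \<in> A \<Longrightarrow> \<exists>!d. homog_decomp G x d"

text \<open>Two decompositions of one element differ by a decomposition of 0, so uniqueness reduces
  to \<open>indep\<close>.\<close>

lemma graded_spaceI:
  fixes s :: "'k::field \<Rightarrow> 'a::ab_group_add \<Rightarrow> 'a"
  assumes s: "vector_space s" and A: "module.subspace s A" and G: "\<And>k. module.subspace s (G k)"
    and sub: "\<And>k. G k \<subseteq> A"
    and ex: "\<And>x. x \<in> A \<Longrightarrow> \<exists>d. homog_decomp G x d"
    and indep: "\<And>d k. homog_decomp G 0 d \<Longrightarrow> d k = 0"
  shows "graded_space s A G"
proof -
  interpret vector_space s by (rule s)
  show ?thesis
  proof
    fix x assume "x \<in> A"
    show "\<exists>!d. homog_decomp G x d"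
    proof (rule ex_ex1I[OF ex[OF \<open>x \<in> A\<close>]])
      fix d e assume d: "homog_decomp G x d" and e: "homog_decomp G x e"
      let ?S = "{k. d k \<noteq> 0} \<union> {k. e k \<noteq> 0}"
      have S: "finite ?S" using homog_decompD(2)[OF d] homog_decompD(2)[OF e] by simp
      have "x = sum d ?S" "x = sum e ?S"
        using homog_decomp_sum[OF d S] homog_decomp_sum[OF e S] by auto
      then have "0 = (\<Sum>k\<in>?S. d k - e k)" by (simp add: sum_subtractf)
      then have "homog_decomp G 0 (\<lambda>k. d k - e k)"
        using homog_decompD(1)[OF d] homog_decompD(1)[OF e] subspace_diff[OF G]
        by (intro homog_decompI[OF S]) auto
      then have "d k - e k = 0" for k by (rule indep)
      then show "d = e" by (intro ext) (metis eq_iff_diff_eq_0)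
    qed
  qed (use assms in auto)
qed

context graded_space
begin

lemma component_decomp: "x \<in> A \<Longrightarrow> homog_decomp G x (component G x)"
  unfolding component_def by (rule theI'[OF decomp_unique])

lemma component_unique:
  assumes "homog_decomp G x d" shows "component G x = d"
proof -
  have "(\<Sum>k | d k \<noteq> 0. d k) \<in> A"
    using homog_decompD(1)[OF assms] part_subset by (intro subspace_sum[OF subspace_carrier]) auto
  then have "x \<in> A" using homog_decompD(3)[OF assms] by simp
  then show ?thesis using component_decomp decomp_unique assms by blast
qed

lemma component_in: "x \<in> A \<Longrightarrow> component G x k \<in> G k"
  using homog_decompD(1)[OF component_decomp] .

lemma component_in_carrier: "x \<in> A \<Longrightarrow> component G x k \<in> A"
  using component_in part_subset by blast

lemma component_lin: "lin_map s A s (G k) (\<lambda>x. component G x k)"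
  unfolding lin_map_def
proof (intro conjI ballI allI)
  fix x y assume x: "x \<in> A" and y: "y \<in> A"
  let ?S = "{k. component G x k \<noteq> 0} \<union> {k. component G y k \<noteq> 0}"
  note d = component_decomp[OF x] and e = component_decomp[OF y]
  have S: "finite ?S" using homog_decompD(2)[OF d] homog_decompD(2)[OF e] by simp
  have "x = sum (component G x) ?S" "y = sum (component G y) ?S"
    using homog_decomp_sum[OF d S] homog_decomp_sum[OF e S] by auto
  then have "x + y = (\<Sum>k\<in>?S. component G x k + component G y k)" by (simp add: sum.distrib)
  then have "homog_decomp G (x + y) (\<lambda>k. component G x k + component G y k)"
    using homog_decompD(1)[OF d] homog_decompD(1)[OF e] subspace_add[OF subspace_part]
    by (intro homog_decompI[OF S]) auto
  from component_unique[OF this]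
  show "component G (x + y) k = component G x k + component G y k" by simp
next
  fix a x assume x: "x \<in> A"
  note d = component_decomp[OF x]
  have "s a x = (\<Sum>k | component G x k \<noteq> 0. s a (component G x k))"
    by (subst homog_decompD(3)[OF d]) (simp add: scale_sum_right)
  then have "homog_decomp G (s a x) (\<lambda>k. s a (component G x k))"
    using homog_decompD(1,2)[OF d] subspace_scale[OF subspace_part]
    by (intro homog_decompI[OF homog_decompD(2)[OF d]]) auto
  from component_unique[OF this]
  show "component G (s a x) k = s a (component G x k)" by simp
qed (rule component_in)

lemma component_diff: "x \<in> A \<Longrightarrow> y \<in> A \<Longrightarrow> component G (x - y) k = component G x k - component G y k"
  by (rule lin_map_diff[OF vector_space_axioms subspace_carrier component_lin])

lemma component_0: "component G 0 k = 0"
  by (rule lin_map_0[OF vector_space_axioms subspace_carrier component_lin])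

lemma component_homogeneous:
  assumes "x \<in> G n" shows "component G x k = (if k = n then x else 0)"
proof -
  have "homog_decomp G x (\<lambda>k. if k = n then x else 0)"
    using assms subspace_0[OF subspace_part] by (intro homog_decompI[of "{n}"]) auto
  then show ?thesis by (simp add: component_unique)
qed

lemma component_supportE:
  assumes "x \<in> A"
  obtains S where "finite S" "\<And>k. k \<notin> S \<Longrightarrow> component G x k = 0" "x = sum (component G x) S"
  using homog_decompD(2,3)[OF component_decomp[OF assms]] by (intro that[of "{k. component G x k \<noteq> 0}"]) auto

lemma component_induct:
  assumes "x \<in> A" "subspace P" "\<And>k. component G x k \<in> P" shows "x \<in> P"
  using assms(1) by (rule component_supportE) (metis subspace_sum[OF assms(2)] assms(3))

text \<open>Independence is the only issue: a decomposition of 0 in the image lifts, degree by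
  degree, to an element of the kernel, whose components lie in the kernel again by
  \<open>homog\<close>.\<close>

lemma graded_space_image:
  fixes sB :: "'k \<Rightarrow> 'b::ab_group_add \<Rightarrow> 'b"
  assumes sB: "vector_space sB" and f: "lin_map s A sB B f" and surj: "f ` A = B"
    and homog: "\<And>x k. x \<in> A \<Longrightarrow> f x = 0 \<Longrightarrow> f (component G x k) = 0"
  shows "graded_space sB B (\<lambda>k. f ` G k)"
    and "x \<in> A \<Longrightarrow> component (\<lambda>k. f ` G k) (f x) k = f (component G x k)"
proof -
  note vs = vector_space_axioms
  have f0: "f 0 = 0" by (rule lin_map_0[OF vs subspace_carrier f])
  have dec: "homog_decomp (\<lambda>k. f ` G k) (f x) (\<lambda>k. f (component G x k))" if x: "x \<in> A" for x
  proof -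
    from x obtain S where S: "finite S" "\<And>k. k \<notin> S \<Longrightarrow> component G x k = 0" "x = sum (component G x) S"
      by (rule component_supportE) blast
    have "f x = (\<Sum>k\<in>S. f (component G x k))"
      by (subst S(3), rule lin_map_sum[OF vs subspace_carrier f]) (use x component_in_carrier in auto)
    then show ?thesis using S x f0 component_in by (intro homog_decompI[OF S(1)]) auto
  qed
  show gr: "graded_space sB B (\<lambda>k. f ` G k)"
  proof (rule graded_spaceI[OF sB])
    show "module.subspace sB B" using lin_map_image_subspace[OF vs subspace_carrier f sB subspace_carrier] surj by simp
    show "module.subspace sB (f ` G k)" for k
      by (rule lin_map_image_subspace[OF vs subspace_carrier f sB subspace_part part_subset])
    show "f ` G k \<subseteq> B" for k using part_subset surj by blast
    show "\<exists>d. homog_decomp (\<lambda>k. f ` G k) y d" if "y \<in> B" for y using that dec surj by blast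
    fix e k assume e: "homog_decomp (\<lambda>k. f ` G k) 0 e"
    \<comment> \<open>Lifting 0 to 0 keeps the family of lifts finitely supported.\<close>
    have "\<exists>a. a \<in> G k \<and> f a = e k \<and> (e k = 0 \<longrightarrow> a = 0)" for k
    proof (cases "e k = 0")
      case True
      then show ?thesis using subspace_0[OF subspace_part] f0 by auto
    next
      case False
      then show ?thesis using homog_decompD(1)[OF e, of k] by auto
    qed
    then obtain a where a: "\<And>k. a k \<in> G k" "\<And>k. f (a k) = e k" "\<And>k. e k = 0 \<Longrightarrow> a k = 0" by metis
    let ?S = "{k. e k \<noteq> 0}"
    have aA: "a k \<in> A" for k using a(1) part_subset by blast
    have "homog_decomp G (sum a ?S) a"
      by (rule homog_decompI[OF homog_decompD(2)[OF e]]) (use a in auto)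
    then have "component G (sum a ?S) = a" by (rule component_unique)
    moreover have "f (sum a ?S) = (\<Sum>k\<in>?S. e k)"
      using lin_map_sum[OF vs subspace_carrier f, of ?S a] aA a(2) by simp
    then have "f (sum a ?S) = 0" using homog_decompD(3)[OF e] by simp
    moreover have "sum a ?S \<in> A" using aA by (intro subspace_sum[OF subspace_carrier]) auto
    ultimately show "e k = 0" using homog a(2) by metis
  qed
  show "component (\<lambda>k. f ` G k) (f x) k = f (component G x k)" if "x \<in> A"
    using graded_space.component_unique[OF gr dec[OF that]] by simp
qed

end

text \<open>
  Independence of the tensor powers: restricting a multilinear form to lists of length \<open>n\<close> gives
  a form that is multilinear in every degree and on which only the component of degree \<open>n\<close> survives.
\<close>

lemma graded_tensor_space: "graded_space tscale (tensor_space V) (tensor_power V)"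
  for V :: "('k::field, 'a::ab_group_add, 'm) braided_space_scheme"
proof (rule graded_spaceI[OF vector_space_tscale subspace_tensor_space subspace_tensor_power tensor_power_subset_space])
  fix t :: "('k, 'a) tens" assume "t \<in> tensor_space V"
  then show "\<exists>d. homog_decomp (tensor_power V) t d"
    unfolding tensor_space_def
  proof (induction rule: tens.span_induct_alt)
    case base
    show ?case
      by (intro exI[of _ "\<lambda>_. 0"] homog_decompI[of "{}"]) (auto intro: tens.subspace_0[OF subspace_tensor_power])
  next
    case (step c x y)
    then obtain xs d where xs: "x = pure V xs" "set xs \<subseteq> carr V" and d: "homog_decomp (tensor_power V) y d" by blast
    let ?S = "insert (length xs) {k. d k \<noteq> 0}" and ?e = "\<lambda>k. if k = length xs then tscale c x else 0"
    have S: "finite ?S" using homog_decompD(2)[OF d] by simp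
    have "y = sum d ?S" using homog_decomp_sum[OF d S] by auto
    then have "tscale c x + y = (\<Sum>k\<in>?S. ?e k + d k)" using S by (simp add: sum.distrib)
    moreover have "?e k + d k \<in> tensor_power V k" for k
      using homog_decompD(1)[OF d, of k] subspace_tensor_power[of V k] pure_in_tensor_power[OF xs(2)] xs(1)
      by (auto intro!: tens.subspace_add tens.subspace_scale)
    ultimately have "homog_decomp (tensor_power V) (tscale c x + y) (\<lambda>k. ?e k + d k)"
      by (intro homog_decompI[OF S]) auto
    then show ?case by blast
  qed
next
  fix d :: "nat \<Rightarrow> ('k, 'a) tens" and n assume d: "homog_decomp (tensor_power V) 0 d"
  let ?r = "\<lambda>\<beta> xs. if length xs = n then \<beta> xs else 0 :: 'k"
  \<comment> \<open>For m = n this is \<open>\<beta>\<close> on all lists that matter; otherwise it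
    vanishes on every list of length m.\<close>
  have ml: "multilinear V (*) m (?r \<beta>)" if "multilinear V (*) n \<beta>" for \<beta> m
    using that by (simp add: multilinear_def)
  \<comment> \<open>The second clause records the default value in \<open>pure\<close>: tensors of
    degree n are 0 on every form that is not n-linear.\<close>
  have ev: "(multilinear V (*) n \<beta> \<longrightarrow> t (?r \<beta>) = (if k = n then t \<beta> else 0)) \<and>
      (\<not> multilinear V (*) n \<beta> \<longrightarrow> k = n \<longrightarrow> t \<beta> = 0)" if "t \<in> tensor_power V k" for t k \<beta>
    using that unfolding tensor_power_def
  proof (induction rule: tens.span_induct_alt)
    case base
    show ?case by (simp add: zero_fun_apply)
  next
    case (step c x y)
    then obtain xs where xs: "x = pure V xs" "length xs = k" by blast
    then have "(multilinear V (*) n \<beta> \<longrightarrow> x (?r \<beta>) = (if k = n then x \<beta> else 0)) \<and>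
      (\<not> multilinear V (*) n \<beta> \<longrightarrow> k = n \<longrightarrow> x \<beta> = 0)"
      using ml by (auto simp: pure_def)
    with step(2) show ?case by (auto simp: tscale_def plus_fun_apply)
  qed
  show "d n = 0"
  proof
    fix \<beta>
    have ev': "(multilinear V (*) n \<beta> \<longrightarrow> d k (?r \<beta>) = (if k = n then d k \<beta> else 0)) \<and>
      (\<not> multilinear V (*) n \<beta> \<longrightarrow> k = n \<longrightarrow> d k \<beta> = 0)" for k
      by (rule ev) (rule homog_decompD(1)[OF d])
    show "d n \<beta> = 0 \<beta>"
    proof (cases "multilinear V (*) n \<beta>")
      case True
      have "(\<Sum>k | d k \<noteq> 0. d k) (?r \<beta>) = 0"
        using homog_decompD(3)[OF d] by (metis zero_fun_apply)
      moreover have "sum d S \<gamma> = (\<Sum>k\<in>S. d k \<gamma>)" for S \<gamma>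
        by (induction S rule: infinite_finite_induct) (auto simp: plus_fun_apply zero_fun_apply)
      ultimately have "(\<Sum>k | d k \<noteq> 0. d k (?r \<beta>)) = 0" by simp
      moreover have "(\<Sum>k | d k \<noteq> 0. d k (?r \<beta>)) = (\<Sum>k | d k \<noteq> 0. if k = n then d n \<beta> else 0)"
        using ev' True by (intro sum.cong) auto
      ultimately have "n \<in> {k. d k \<noteq> 0} \<longrightarrow> d n \<beta> = 0"
        using homog_decompD(2)[OF d] by (simp add: sum.delta split: if_splits)
      then show ?thesis by (auto simp: zero_fun_apply)
    next
      case False
      then show ?thesis using ev' by (simp add: zero_fun_apply)
    qed
  qed
qed

section \<open>Homogeneous tensors\<close>

text \<open>The multihomogeneous part G k1 \<otimes> ... \<otimes> G kr of a tensor power. Degrees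
  are kept as a list so that juxtaposition becomes \<open>@\<close> and each structure map acts on a
  block of the list.\<close>

definition hom_tens ::
  "('k::field, 'a::ab_group_add, 'm) braided_space_scheme \<Rightarrow> (nat \<Rightarrow> 'a set) \<Rightarrow> nat list \<Rightarrow> ('k, 'a) tens set" where
  "hom_tens V G ks = tens.span {pure V xs | xs. list_all2 (\<lambda>k x. x \<in> G k) ks xs}"

lemma subspace_hom_tens: "tens.subspace (hom_tens V G ks)"
  unfolding hom_tens_def by (rule tens.subspace_span)

lemma pure_in_hom_tens: "list_all2 (\<lambda>k x. x \<in> G k) ks xs \<Longrightarrow> pure V xs \<in> hom_tens V G ks"
  unfolding hom_tens_def by (rule tens.span_base) blast

lemma hom_tens_pair: "hom_tens V G [m, n] = sub_tensor V (G m) (G n)"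
  unfolding hom_tens_def sub_tensor_def
  by (rule arg_cong[where f = tens.span]) (fastforce simp: list_all2_Cons1)

lemma list_all2_part_subset:
  assumes "\<And>k. G k \<subseteq> C" "list_all2 (\<lambda>k x. x \<in> G k) ks xs" shows "set xs \<subseteq> C"
  using assms(2,1) by (induction rule: list_all2_induct) auto

lemma hom_tens_subset:
  assumes "\<And>k. G k \<subseteq> carr V" shows "hom_tens V G ks \<subseteq> tensor_power V (length ks)"
  unfolding hom_tens_def
proof (rule tens.span_minimal[OF _ subspace_tensor_power], clarify)
  fix xs assume "list_all2 (\<lambda>k x. x \<in> G k) ks xs"
  then show "pure V xs \<in> tensor_power V (length ks)"
    using list_all2_part_subset[of G, OF assms] list_all2_lengthD
    by (intro pure_in_tensor_power) fastforce+
qed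

lemma tmult_hom_tens:
  assumes V: "vspace V" and G: "\<And>k. G k \<subseteq> carr V"
    and s: "s \<in> hom_tens V G ks" and t: "t \<in> hom_tens V G ls"
  shows "tmult V s t \<in> hom_tens V G (ks @ ls)"
proof (rule tmult_span[OF V _ _ subspace_hom_tens _ s[unfolded hom_tens_def] t[unfolded hom_tens_def]])
  fix x y
  assume "x \<in> {pure V xs |xs. list_all2 (\<lambda>k x. x \<in> G k) ks xs}"
    "y \<in> {pure V xs |xs. list_all2 (\<lambda>k x. x \<in> G k) ls xs}"
  then obtain xs ys where "x = pure V xs" "y = pure V ys"
    "list_all2 (\<lambda>k x. x \<in> G k) ks xs" "list_all2 (\<lambda>k x. x \<in> G k) ls ys" by blast
  then show "tmult V x y \<in> hom_tens V G (ks @ ls)"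
    using list_all2_part_subset[of G, OF G]
    by (auto simp: tmult_pure[OF V] intro!: pure_in_hom_tens list_all2_appendI)
qed (auto intro!: pure_in_tensor_space list_all2_part_subset[of G, OF G, THEN subsetD])

text \<open>Allows degrees to be followed through composites such as (m \<otimes> m)(B \<otimes> c
  \<otimes> B) one map at a time: each factor changes only its own block of the degree list.\<close>

lemma tensor_map_hom_tens:
  assumes V: "vspace V" and G: "\<And>k. G k \<subseteq> carr V"
    and f: "tlin V m f" and g: "tlin V n g" and "length ks = m" "length ls = n"
    and fk: "\<And>t. t \<in> hom_tens V G ks \<Longrightarrow> f t \<in> hom_tens V G ks'"
    and gl: "\<And>t. t \<in> hom_tens V G ls \<Longrightarrow> g t \<in> hom_tens V G ls'"
    and t: "t \<in> hom_tens V G (ks @ ls)"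
  shows "tensor_map V m f g t \<in> hom_tens V G (ks' @ ls')"
proof (rule lin_map_span_image[OF vector_space_tscale subspace_tensor_power tlin_tensor_map[OF V f g]
      vector_space_tscale subspace_hom_tens _ _ t[unfolded hom_tens_def]])
  show "{pure V xs |xs. list_all2 (\<lambda>k x. x \<in> G k) (ks @ ls) xs} \<subseteq> tensor_power V (m + n)"
    using hom_tens_subset[of G, OF G, of "ks @ ls"] pure_in_hom_tens[of G "ks @ ls"] assms(5,6) by auto
  fix x assume "x \<in> {pure V xs |xs. list_all2 (\<lambda>k x. x \<in> G k) (ks @ ls) xs}"
  then obtain xs ys where x: "x = pure V (xs @ ys)"
    and xs: "list_all2 (\<lambda>k x. x \<in> G k) ks xs" and ys: "list_all2 (\<lambda>k x. x \<in> G k) ls ys"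
    by (auto simp: list_all2_append1)
  have "tensor_map V m f g x = tmult V (f (pure V xs)) (g (pure V ys))"
    unfolding x using xs ys assms(5,6) list_all2_part_subset[of G, OF G]
    by (intro tensor_map_pure[OF V f g]) (auto dest: list_all2_lengthD)
  then show "tensor_map V m f g x \<in> hom_tens V G (ks' @ ls')"
    using tmult_hom_tens[of V G, OF V G fk gl] pure_in_hom_tens xs ys by metis
qed

section \<open>Structure maps\<close>

lemma unital_algebraD:
  assumes "unital_algebra A"
  shows "vspace A"
    "x \<in> carr A \<Longrightarrow> lin_map (smul A) (carr A) (smul A) (carr A) (\<lambda>y. mul A x y)"
    "y \<in> carr A \<Longrightarrow> lin_map (smul A) (carr A) (smul A) (carr A) (\<lambda>x. mul A x y)"
    "x \<in> carr A \<Longrightarrow> y \<in> carr A \<Longrightarrow> mul A x y \<in> carr A"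
    "x \<in> carr A \<Longrightarrow> y \<in> carr A \<Longrightarrow> z \<in> carr A \<Longrightarrow> mul A (mul A x y) z = mul A x (mul A y z)"
    "unit_el A \<in> carr A"
    "x \<in> carr A \<Longrightarrow> mul A (unit_el A) x = x" "x \<in> carr A \<Longrightarrow> mul A x (unit_el A) = x"
  using assms unfolding unital_algebra_def by (blast dest: lin_mapD(1))+

lemma mulT_pure:
  assumes A: "unital_algebra A" and "x \<in> carr A" "y \<in> carr A"
  shows "mulT A (pure A [x, y]) = pure A [mul A x y]"
proof -
  note V = unital_algebraD(1)[OF A]
  have "multilinear A tscale 2 (\<lambda>zs. pure A [mul A (zs ! 0) (zs ! 1)])"
    unfolding multilinear_def
  proof (intro allI impI, goal_cases)
    case (1 us vs)
    then consider z where "us = []" "vs = [z]" "z \<in> carr A" | z where "us = [z]" "vs = []" "z \<in> carr A"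
      by (cases us; cases vs) auto
    then show ?case
    proof cases
      case 1
      then show ?thesis
        using lin_mapD(2,3)[OF unital_algebraD(3)[OF A]] unital_algebraD(4)[OF A]
          pure_add[of "[]" A "[]"] pure_scale[of "[]" A "[]"] by simp
    next
      case 2
      then show ?thesis
        using lin_mapD(2,3)[OF unital_algebraD(2)[OF A]] unital_algebraD(4)[OF A]
          pure_add[of "[]" A "[]"] pure_scale[of "[]" A "[]"] by simp
    qed
  qed
  then show ?thesis unfolding mulT_def by (subst lin_ext_pure) (auto simp: numeral_2_eq_2)
qed

lemma tlin_lin_ext':
  assumes "f = lin_ext F"
    and "\<And>xs. set xs \<subseteq> carr V \<Longrightarrow> length xs = n \<Longrightarrow> f (pure V xs) \<in> tensor_space V"
  shows "tlin V n f"
  using assms tlin_lin_ext by blast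

lemma length_2E:
  assumes "length xs = 2" obtains x y where "xs = [x, y]"
  using assms by (auto simp: numeral_2_eq_2 length_Suc_conv)

lemma length_1E:
  assumes "length xs = 1" obtains x where "xs = [x]"
  using assms by (auto simp: length_Suc_conv)

lemma tlin_mulT: "unital_algebra A \<Longrightarrow> tlin A 2 (mulT A)"
proof (rule tlin_lin_ext'[OF mulT_def], goal_cases)
  case (1 xs)
  then show ?case using mulT_pure[of A] unital_algebraD(4)
    by (elim length_2E) (auto intro!: pure_in_tensor_space)
qed

lemma unitT_pure: "unitT A (pure A []) = pure A [unit_el A]"
  unfolding unitT_def by (subst lin_ext_pure) (auto simp: multilinear_def)

lemma tlin_unitT: "unital_algebra A \<Longrightarrow> tlin A 0 (unitT A)"
proof (rule tlin_lin_ext'[OF unitT_def], goal_cases)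
  case (1 xs)
  then show ?case using unitT_pure[of A] unital_algebraD(6)
    by (auto intro!: pure_in_tensor_space)
qed

lemma counital_coalgebraD:
  assumes "counital_coalgebra C"
  shows "vspace C" "lin_map (smul C) (carr C) tscale (tensor_power C 2) (comul C)"
    "lin_map (smul C) (carr C) (*) UNIV (counit C)"
    "x \<in> carr C \<Longrightarrow> tensor_map C 1 (counitT C) id (comul C x) = pure C [x]"
    "x \<in> carr C \<Longrightarrow> tensor_map C 1 id (counitT C) (comul C x) = pure C [x]"
  using assms unfolding counital_coalgebra_def by blast+

lemma lin_ext_linear_pure:
  assumes f: "lin_map (smul C) (carr C) tscale W f" and x: "x \<in> carr C"
  shows "lin_ext (\<lambda>zs. f (zs ! 0)) (pure C [x]) = f x"
proof (subst lin_ext_pure)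
  show "multilinear C tscale (length [x]) (\<lambda>zs. f (zs ! 0))"
    using lin_mapD[OF f] by (auto simp: multilinear_def)
qed simp

lemma comulT_pure: "counital_coalgebra C \<Longrightarrow> x \<in> carr C \<Longrightarrow> comulT C (pure C [x]) = comul C x"
  unfolding comulT_def by (rule lin_ext_linear_pure[OF counital_coalgebraD(2)])

lemma counitT_pure:
  assumes C: "counital_coalgebra C" and x: "x \<in> carr C"
  shows "counitT C (pure C [x]) = tscale (counit C x) (pure C [])"
  unfolding counitT_def
proof (rule lin_ext_linear_pure[OF _ x])
  show "lin_map (smul C) (carr C) tscale UNIV (\<lambda>x. tscale (counit C x) (pure C []))"
    using lin_mapD[OF counital_coalgebraD(3)[OF C]] by (simp add: lin_map_def tens.scale_left_distrib)
qed

lemma tlin_comulT: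
  assumes C: "counital_coalgebra C" shows "tlin C 1 (comulT C)"
proof (rule tlin_lin_ext'[OF comulT_def], goal_cases)
  case (1 xs)
  then show ?case
    using comulT_pure[OF C] lin_mapD(1)[OF counital_coalgebraD(2)[OF C]] tensor_power_subset_space[of C 2]
    by (elim length_1E) auto
qed

lemma tlin_counitT:
  assumes C: "counital_coalgebra C" shows "tlin C 1 (counitT C)"
proof (rule tlin_lin_ext'[OF counitT_def], goal_cases)
  case (1 xs)
  then show ?case using counitT_pure[OF C]
    by (elim length_1E) (auto intro!: tens.subspace_scale[OF subspace_tensor_space] pure_in_tensor_space)
qed

lemma lin_map_pure_left:
  assumes y: "y \<in> carr V"
  shows "lin_map (smul V) (carr V) tscale (tensor_power V 2) (\<lambda>x. pure V [x, y])"
  unfolding lin_map_def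
proof (intro conjI ballI allI)
  show "pure V [u + v, y] = pure V [u, y] + pure V [v, y]" if "u \<in> carr V" "v \<in> carr V" for u v
    using pure_add[of "[]" V "[y]" u v] that y by simp
  show "pure V [smul V a x, y] = tscale a (pure V [x, y])" if "x \<in> carr V" for a x
    using pure_scale[of "[]" V "[y]" x a] that y by simp
qed (simp add: pure_in_tensor_power y)

lemma lin_map_pure_right:
  assumes y: "y \<in> carr V"
  shows "lin_map (smul V) (carr V) tscale (tensor_power V 2) (\<lambda>x. pure V [y, x])"
  unfolding lin_map_def
proof (intro conjI ballI allI)
  show "pure V [y, u + v] = pure V [y, u] + pure V [y, v]" if "u \<in> carr V" "v \<in> carr V" for u v
    using pure_add[of "[y]" V "[]" u v] that y by simp
  show "pure V [y, smul V a x] = tscale a (pure V [y, x])" if "x \<in> carr V" for a x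
    using pure_scale[of "[y]" V "[]" x a] that y by simp
qed (simp add: pure_in_tensor_power y)

text \<open>Tensors are functionals on scalar forms, so this is not immediate. The universal
  property, applied to the \<open>V\<close>-valued 1-linear map \<open>hd\<close>, gives a left
  inverse of \<open>pure\<close> on singletons.\<close>

lemma pure_1_inject:
  assumes V: "vspace V" and x: "x \<in> carr V" and y: "y \<in> carr V" and eq: "pure V [x] = pure V [y]"
  shows "x = y"
proof -
  have id: "multilinear V (smul V) 1 hd"
    unfolding multilinear_def
  proof (intro allI impI)
    fix xs ys :: "'b list" assume "length xs + Suc (length ys) = 1"
    then have "xs = []" by simp
    then show "(\<forall>x\<in>carr V. \<forall>y\<in>carr V. hd (xs @ (x + y) # ys) = hd (xs @ x # ys) + hd (xs @ y # ys)) \<and>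
      (\<forall>a. \<forall>x\<in>carr V. hd (xs @ smul V a x # ys) = smul V a (hd (xs @ x # ys)))" by simp
  qed
  obtain h where h: "\<forall>xs. set xs \<subseteq> carr V \<and> length xs = 1 \<longrightarrow> h (pure V xs) = hd xs"
    using tensor_power_universal[OF vspaceD(1)[OF V] id] by metis
  have "x = h (pure V [x])" using h[rule_format, of "[x]"] x by simp
  also have "\<dots> = y" unfolding eq using h[rule_format, of "[y]"] y by simp
  finally show ?thesis .
qed

lemma mul_hom_tens:
  assumes A: "unital_algebra A" and G: "\<And>k. G k \<subseteq> carr A"
    and Gm: "\<And>x y k l. x \<in> G k \<Longrightarrow> y \<in> G l \<Longrightarrow> mul A x y \<in> G (k + l)"
    and t: "t \<in> hom_tens A G [k, l]"
  shows "mulT A t \<in> hom_tens A G [k + l]"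
proof (rule lin_map_span_image[OF vector_space_tscale subspace_tensor_power tlin_mulT[OF A]
      vector_space_tscale subspace_hom_tens _ _ t[unfolded hom_tens_def]])
  show "{pure A xs |xs. list_all2 (\<lambda>k x. x \<in> G k) [k, l] xs} \<subseteq> tensor_power A 2"
    using hom_tens_subset[of G, OF G, of "[k, l]"] pure_in_hom_tens[of G "[k, l]"]
    by (auto simp: numeral_2_eq_2)
  fix s assume "s \<in> {pure A xs |xs. list_all2 (\<lambda>k x. x \<in> G k) [k, l] xs}"
  then obtain x y where xy: "s = pure A [x, y]" "x \<in> G k" "y \<in> G l" by (auto simp: list_all2_Cons1)
  then have "mulT A s = pure A [mul A x y]" using G by (auto intro!: mulT_pure[OF A])
  then show "mulT A s \<in> hom_tens A G [k + l]" using Gm xy by (auto intro!: pure_in_hom_tens)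
qed

section \<open>The braided bialgebra axioms evaluated on elements\<close>

lemma braided_bialgebraD:
  assumes "braided_bialgebra B"
  shows "unital_algebra B" "counital_coalgebra B" "braided_vector_space B" "vspace B"
    "comul B (unit_el B) = pure B [unit_el B, unit_el B]"
    "x \<in> carr B \<Longrightarrow> y \<in> carr B \<Longrightarrow> counit B (mul B x y) = counit B x * counit B y"
    "counit B (unit_el B) = 1"
  using assms
  by (auto simp: braided_bialgebra_def braided_algebra_def braided_coalgebra_def unital_algebra_def)

lemma braid_lin: "braided_vector_space V \<Longrightarrow> lin_map tscale (tensor_power V 2) tscale (tensor_power V 2) (braid V)"
  by (simp add: braided_vector_space_def)

lemma tlin_braid: "braided_vector_space V \<Longrightarrow> tlin V 2 (braid V)"
  using lin_map_mono[OF braid_lin] tensor_power_subset_space by blast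

lemma braid_unit:
  assumes B: "braided_bialgebra B" and x: "x \<in> carr B"
  shows "braid B (pure B [unit_el B, x]) = pure B [x, unit_el B]"
    and "braid B (pure B [x, unit_el B]) = pure B [unit_el B, x]"
proof -
  note A = braided_bialgebraD(1)[OF B] and V = braided_bialgebraD(4)[OF B]
  have t: "pure B [x] \<in> tensor_power B 1" using x by (intro pure_in_tensor_power) auto
  have 1: "tensor_map B 0 (unitT B) id (pure B [x]) = pure B [unit_el B, x]"
    using tensor_map_pure[OF V tlin_unitT[OF A] tlin_id, of "[]" "[x]" 1] x unital_algebraD(6)[OF A]
    by (simp add: unitT_pure tmult_pure[OF V])
  have 2: "tensor_map B 1 id (unitT B) (pure B [x]) = pure B [x, unit_el B]"
    using tensor_map_pure[OF V tlin_id tlin_unitT[OF A], of "[x]" "[]" 1] x unital_algebraD(6)[OF A]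
    by (simp add: unitT_pure tmult_pure[OF V])
  show "braid B (pure B [unit_el B, x]) = pure B [x, unit_el B]"
    and "braid B (pure B [x, unit_el B]) = pure B [unit_el B, x]"
    using B t unfolding braided_bialgebra_def braided_algebra_def Let_def
    by (metis 1 2)+
qed

lemma braid_mul:
  assumes B: "braided_bialgebra B" and x: "x \<in> carr B" and y: "y \<in> carr B" and z: "z \<in> carr B"
  shows "braid B (pure B [mul B x y, z]) = tensor_map B 1 id (mulT B)
      (tensor_map B 2 (braid B) id (tensor_map B 1 id (braid B) (pure B [x, y, z])))"
    and "braid B (pure B [x, mul B y z]) = tensor_map B 2 (mulT B) id
      (tensor_map B 1 id (braid B) (tensor_map B 2 (braid B) id (pure B [x, y, z])))"
proof -
  note A = braided_bialgebraD(1)[OF B] and V = braided_bialgebraD(4)[OF B]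
  have t: "pure B [x, y, z] \<in> tensor_power B 3" using x y z by (intro pure_in_tensor_power) auto
  have 1: "tensor_map B 2 (mulT B) id (pure B [x, y, z]) = pure B [mul B x y, z]"
    using tensor_map_pure[OF V tlin_mulT[OF A] tlin_id, of "[x, y]" "[z]" 1] x y z unital_algebraD(4)[OF A]
    by (simp add: mulT_pure[OF A] tmult_pure[OF V])
  have 2: "tensor_map B 1 id (mulT B) (pure B [x, y, z]) = pure B [x, mul B y z]"
    using tensor_map_pure[OF V tlin_id tlin_mulT[OF A], of "[x]" "[y, z]" 1] x y z unital_algebraD(4)[OF A]
    by (simp add: mulT_pure[OF A] tmult_pure[OF V])
  show "braid B (pure B [mul B x y, z]) = tensor_map B 1 id (mulT B)
      (tensor_map B 2 (braid B) id (tensor_map B 1 id (braid B) (pure B [x, y, z])))"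
    and "braid B (pure B [x, mul B y z]) = tensor_map B 2 (mulT B) id
      (tensor_map B 1 id (braid B) (tensor_map B 2 (braid B) id (pure B [x, y, z])))"
    using B t unfolding braided_bialgebra_def braided_algebra_def Let_def
    by (metis 1 2)+
qed

lemma comul_mul:
  assumes B: "braided_bialgebra B" and x: "x \<in> carr B" and y: "y \<in> carr B"
  shows "comul B (mul B x y) = tensor_map B 2 (mulT B) (mulT B)
      (tensor_map B 1 id (tensor_map B 2 (braid B) id) (tmult B (comul B x) (comul B y)))"
proof -
  note A = braided_bialgebraD(1)[OF B] and C = braided_bialgebraD(2)[OF B] and V = braided_bialgebraD(4)[OF B]
  have t: "pure B [x, y] \<in> tensor_power B 2" using x y by (intro pure_in_tensor_power) auto
  have 1: "tensor_map B 1 (comulT B) (comulT B) (pure B [x, y]) = tmult B (comul B x) (comul B y)"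
    using tensor_map_pure[OF V tlin_comulT[OF C] tlin_comulT[OF C], of "[x]" "[y]"] x y
    by (simp add: comulT_pure[OF C])
  have 2: "comulT B (mulT B (pure B [x, y])) = comul B (mul B x y)"
    using x y unital_algebraD(4)[OF A] by (simp add: mulT_pure[OF A] comulT_pure[OF C])
  show ?thesis
    using B t unfolding braided_bialgebra_def by (metis 1 2)
qed

section \<open>The grading of the braided tensor algebra\<close>

context
  fixes V :: "('k::field, 'v::ab_group_add, 'm) braided_space_scheme"
    and A :: "('k, 'a::ab_group_add, 'n) braided_bialg_scheme" and i :: "'v \<Rightarrow> 'a"
  assumes A: "unital_algebra A" and V: "vspace V" and i: "lin_map (smul V) (carr V) (smul A) (carr A) i"
begin

interpretation vector_space "smul A" using unital_algebraD(1)[OF A] by (rule vspaceD)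

abbreviation (input) "words k \<equiv> {foldr (mul A) (map i vs) (unit_el A) | vs. set vs \<subseteq> carr V \<and> length vs = k}"

lemma word_in_carrier: "set vs \<subseteq> carr V \<Longrightarrow> foldr (mul A) (map i vs) (unit_el A) \<in> carr A"
  using unital_algebraD(4,6)[OF A] lin_mapD(1)[OF i] by (induction vs) auto

lemma word_append:
  "set us \<subseteq> carr V \<Longrightarrow> set vs \<subseteq> carr V \<Longrightarrow> foldr (mul A) (map i (us @ vs)) (unit_el A) =
     mul A (foldr (mul A) (map i us) (unit_el A)) (foldr (mul A) (map i vs) (unit_el A))"
proof (induction us)
  case Nil
  then show ?case using unital_algebraD(7)[OF A] word_in_carrier by simp
next
  case (Cons u us)
  then show ?case using unital_algebraD(5)[OF A] word_in_carrier lin_mapD(1)[OF i] by simp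
qed

lemma subspace_degree_part: "subspace (degree_part V A i k)"
  unfolding degree_part_def by (rule subspace_span)

lemma degree_part_subset: "degree_part V A i k \<subseteq> carr A"
  unfolding degree_part_def
  by (rule span_minimal) (use word_in_carrier vspaceD(2)[OF unital_algebraD(1)[OF A]] in auto)

lemma word_in_degree_part:
  "set vs \<subseteq> carr V \<Longrightarrow> length vs = k \<Longrightarrow> foldr (mul A) (map i vs) (unit_el A) \<in> degree_part V A i k"
  unfolding degree_part_def by (rule span_base) blast

lemma degree_part_1: "degree_part V A i 1 = i ` carr V"
proof -
  have "words 1 = i ` carr V"
    using unital_algebraD(8)[OF A] lin_mapD(1)[OF i]
    by (force simp: length_Suc_conv intro: exI[of _ "[_]"])
  moreover have "subspace (i ` carr V)"
    using lin_map_image_subspace[OF vspaceD(1)[OF V] vspaceD(2)[OF V] i vector_space_axioms vspaceD(2)[OF V]] by simp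
  ultimately show ?thesis unfolding degree_part_def by (metis span_eq_iff)
qed

lemma degree_part_0: "degree_part V A i 0 = range (\<lambda>a. smul A a (unit_el A))"
  unfolding degree_part_def using span_singleton[of "unit_el A"] by simp

lemma degree_part_mul:
  assumes x: "x \<in> degree_part V A i m" and y: "y \<in> degree_part V A i n"
  shows "mul A x y \<in> degree_part V A i (m + n)"
proof (rule lin_map_span_image[OF vector_space_axioms vspaceD(2)[OF unital_algebraD(1)[OF A]]
      unital_algebraD(3)[OF A] vector_space_axioms subspace_degree_part _ _ x[unfolded degree_part_def]])
  show yA: "y \<in> carr A" using y degree_part_subset by blast
  show "words m \<subseteq> carr A" using word_in_carrier by blast
  fix u assume "u \<in> words m"
  then obtain us where us: "u = foldr (mul A) (map i us) (unit_el A)" "set us \<subseteq> carr V" "length us = m" by blast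
  show "mul A u y \<in> degree_part V A i (m + n)"
  proof (rule lin_map_span_image[OF vector_space_axioms vspaceD(2)[OF unital_algebraD(1)[OF A]]
      unital_algebraD(2)[OF A] vector_space_axioms subspace_degree_part _ _ y[unfolded degree_part_def]])
    show "words n \<subseteq> carr A" using word_in_carrier by blast
    show "u \<in> carr A" using us word_in_carrier by blast
    fix v assume "v \<in> words n"
    then obtain vs where vs: "v = foldr (mul A) (map i vs) (unit_el A)" "set vs \<subseteq> carr V" "length vs = n" by blast
    show "mul A u v \<in> degree_part V A i (m + n)"
      using word_append[OF us(2) vs(2)] us vs word_in_degree_part[of "us @ vs"] by simp
  qed
qed

text \<open>Words are built by \<open>foldr\<close>, so they grow by one letter on the left.
  \<open>P\<close> depends on the degree because the properties proved this way are themselves about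
  degrees.\<close>

lemma degree_part_induct [consumes 1, case_names subspace unit mul]:
  assumes x: "x \<in> degree_part V A i k" and P: "\<And>k. subspace (P k)" and "unit_el A \<in> P 0"
    and mul: "\<And>v y k. v \<in> carr V \<Longrightarrow> y \<in> degree_part V A i k \<Longrightarrow> y \<in> P k \<Longrightarrow> mul A (i v) y \<in> P (Suc k)"
  shows "x \<in> P k"
proof -
  have "foldr (mul A) (map i vs) (unit_el A) \<in> P (length vs)" if "set vs \<subseteq> carr V" for vs
    using that
  proof (induction vs)
    case Nil
    then show ?case using assms(3) by simp
  next
    case (Cons v vs)
    then show ?case using mul[of v "foldr (mul A) (map i vs) (unit_el A)"] word_in_degree_part by simp
  qed
  then have "words k \<subseteq> P k" by blast
  then show ?thesis using x span_minimal[OF _ P] unfolding degree_part_def by blast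
qed

text \<open>The grading is transported from the tensor space along the isomorphism
  \<open>\<phi>\<close>: it maps pure tensors to words, hence tensor powers onto degree parts, and
  its zero kernel is trivially homogeneous.\<close>

lemma graded_tensor_algebra:
  assumes T: "is_tensor_algebra V A i"
  shows "graded_space (smul A) (carr A) (degree_part V A i)"
proof -
  obtain \<phi> where \<phi>: "lin_map tscale (tensor_space V) (smul A) (carr A) \<phi>"
      "bij_betw \<phi> (tensor_space V) (carr A)"
      "\<forall>s\<in>tensor_space V. \<forall>t\<in>tensor_space V. \<phi> (tmult V s t) = mul A (\<phi> s) (\<phi> t)"
      "\<phi> (pure V []) = unit_el A" "\<forall>v\<in>carr V. \<phi> (pure V [v]) = i v"
    using T unfolding is_tensor_algebra_def by (elim conjE exE)
  interpret TS: graded_space tscale "tensor_space V" "tensor_power V" by (rule graded_tensor_space)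
  have pure: "\<phi> (pure V vs) = foldr (mul A) (map i vs) (unit_el A)" if "set vs \<subseteq> carr V" for vs
    using that
  proof (induction vs)
    case Nil
    then show ?case using \<phi>(4) by simp
  next
    case (Cons v vs)
    then have "pure V (v # vs) = tmult V (pure V [v]) (pure V vs)" by (simp add: tmult_pure[OF V])
    moreover have "\<phi> (tmult V (pure V [v]) (pure V vs)) = mul A (\<phi> (pure V [v])) (\<phi> (pure V vs))"
      using Cons by (intro \<phi>(3)[rule_format] pure_in_tensor_space) auto
    ultimately show ?case using Cons \<phi>(5) by simp
  qed
  have img: "\<phi> ` tensor_power V k = degree_part V A i k" for k
  proof -
    have "{pure V vs |vs. set vs \<subseteq> carr V \<and> length vs = k} \<subseteq> tensor_space V"
      using pure_in_tensor_space by blast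
    moreover have "\<phi> ` {pure V vs |vs. set vs \<subseteq> carr V \<and> length vs = k} = words k"
    proof (intro equalityI subsetI)
      fix x assume "x \<in> \<phi> ` {pure V vs |vs. set vs \<subseteq> carr V \<and> length vs = k}"
      then obtain vs where "x = \<phi> (pure V vs)" "set vs \<subseteq> carr V" "length vs = k" by blast
      with pure[of vs] show "x \<in> words k" by auto
    next
      fix x assume "x \<in> words k"
      then obtain vs where "x = foldr (mul A) (map i vs) (unit_el A)" "set vs \<subseteq> carr V" "length vs = k" by blast
      with pure[of vs] show "x \<in> \<phi> ` {pure V vs |vs. set vs \<subseteq> carr V \<and> length vs = k}"
        by (intro image_eqI[of _ _ "pure V vs"]) auto
    qed
    ultimately show ?thesis
      using lin_map_image_span[OF vector_space_tscale subspace_tensor_space \<phi>(1) vector_space_axioms,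
          of "{pure V vs |vs. set vs \<subseteq> carr V \<and> length vs = k}"]
      by (simp only: tensor_power_def degree_part_def)
  qed
  have f0: "\<phi> 0 = 0" by (rule lin_map_0[OF vector_space_tscale subspace_tensor_space \<phi>(1)])
  have inj: "x = 0" if "x \<in> tensor_space V" "\<phi> x = 0" for x
    using inj_onD[OF bij_betw_imp_inj_on[OF \<phi>(2)], of x 0] that f0 tens.subspace_0[OF TS.subspace_carrier]
    by simp
  have "graded_space (smul A) (carr A) (\<lambda>k. \<phi> ` tensor_power V k)"
  proof (rule TS.graded_space_image(1)[OF vector_space_axioms \<phi>(1) bij_betw_imp_surj_on[OF \<phi>(2)]])
    fix x k assume "x \<in> tensor_space V" "\<phi> x = 0"
    then have "x = 0" by (rule inj)
    then show "\<phi> (component (tensor_power V) x k) = 0"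
      by (simp add: TS.component_0 f0)
  qed
  then show ?thesis by (simp add: img)
qed

end

text \<open>Braiding a product with a third element means braiding its factors with that element one
  after the other and then multiplying, so the degrees on products follow from those on the factors.
  This is the inductive step for the braiding of the tensor algebra.\<close>

lemma braid_hom_tens_mul:
  assumes B: "braided_bialgebra B" and G: "\<And>k. G k \<subseteq> carr B"
    and Gm: "\<And>x y k l. x \<in> G k \<Longrightarrow> y \<in> G l \<Longrightarrow> mul B x y \<in> G (k + l)"
    and x: "x \<in> G a" and y: "y \<in> G b" and z: "z \<in> G d"
  shows "\<forall>t\<in>hom_tens B G [b, d]. braid B t \<in> hom_tens B G [d, b] \<Longrightarrow>
      \<forall>t\<in>hom_tens B G [a, d]. braid B t \<in> hom_tens B G [d, a] \<Longrightarrow>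
      braid B (pure B [mul B x y, z]) \<in> hom_tens B G [d, a + b]"
    and "\<forall>t\<in>hom_tens B G [a, b]. braid B t \<in> hom_tens B G [b, a] \<Longrightarrow>
      \<forall>t\<in>hom_tens B G [a, d]. braid B t \<in> hom_tens B G [d, a] \<Longrightarrow>
      braid B (pure B [x, mul B y z]) \<in> hom_tens B G [b + d, a]"
proof -
  note A = braided_bialgebraD(1)[OF B] and V = braided_bialgebraD(4)[OF B] and c = tlin_braid[OF braided_bialgebraD(3)[OF B]]
  note tm = tensor_map_hom_tens[of B G, OF V G]
  have xyz: "pure B [x, y, z] \<in> hom_tens B G [a, b, d]" using x y z by (intro pure_in_hom_tens) auto
  have m: "mulT B t \<in> hom_tens B G [k + l]" if "t \<in> hom_tens B G [k, l]" for t k l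
    using mul_hom_tens[of B G, OF A G Gm that] .
  have car: "x \<in> carr B" "y \<in> carr B" "z \<in> carr B" using x y z G by blast+
  {
    assume bd: "\<forall>t\<in>hom_tens B G [b, d]. braid B t \<in> hom_tens B G [d, b]"
      and ad: "\<forall>t\<in>hom_tens B G [a, d]. braid B t \<in> hom_tens B G [d, a]"
    have "tensor_map B 1 id (braid B) (pure B [x, y, z]) \<in> hom_tens B G ([a] @ [d, b])"
      by (rule tm[OF tlin_id c, where ks = "[a]" and ls = "[b, d]"]) (use bd xyz in auto)
    then have "tensor_map B 2 (braid B) id (tensor_map B 1 id (braid B) (pure B [x, y, z])) \<in> hom_tens B G ([d, a] @ [b])"
      by (intro tm[OF c tlin_id, where ks = "[a, d]" and ls = "[b]"]) (use ad in auto)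
    then have "tensor_map B 1 id (mulT B) (tensor_map B 2 (braid B) id (tensor_map B 1 id (braid B) (pure B [x, y, z])))
        \<in> hom_tens B G ([d] @ [a + b])"
      by (intro tm[OF tlin_id tlin_mulT[OF A], where ks = "[d]" and ls = "[a, b]"]) (use m in auto)
    then show "braid B (pure B [mul B x y, z]) \<in> hom_tens B G [d, a + b]"
      by (simp add: braid_mul(1)[OF B car])
  next
    assume ab: "\<forall>t\<in>hom_tens B G [a, b]. braid B t \<in> hom_tens B G [b, a]"
      and ad: "\<forall>t\<in>hom_tens B G [a, d]. braid B t \<in> hom_tens B G [d, a]"
    have "tensor_map B 2 (braid B) id (pure B [x, y, z]) \<in> hom_tens B G ([b, a] @ [d])"
      by (rule tm[OF c tlin_id, where ks = "[a, b]" and ls = "[d]"]) (use ab xyz in auto)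
    then have "tensor_map B 1 id (braid B) (tensor_map B 2 (braid B) id (pure B [x, y, z])) \<in> hom_tens B G ([b] @ [d, a])"
      by (intro tm[OF tlin_id c, where ks = "[b]" and ls = "[a, d]"]) (use ad in auto)
    then have "tensor_map B 2 (mulT B) id (tensor_map B 1 id (braid B) (tensor_map B 2 (braid B) id (pure B [x, y, z])))
        \<in> hom_tens B G ([b + d] @ [a])"
      by (intro tm[OF tlin_mulT[OF A] tlin_id, where ks = "[b, d]" and ls = "[a]"]) (use m in auto)
    then show "braid B (pure B [x, mul B y z]) \<in> hom_tens B G [b + d, a]"
      by (simp add: braid_mul(2)[OF B car])
  }
qed

text \<open>The part of total degree n in A \<otimes> A.\<close>

abbreviation graded_comul_range ::
  "('k::field, 'a::ab_group_add, 'm) braided_space_scheme \<Rightarrow> (nat \<Rightarrow> 'a set) \<Rightarrow> nat \<Rightarrow> ('k, 'a) tens set" where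
  "graded_comul_range A G n \<equiv> tens.span {pure A [y, z] | y z j. j \<le> n \<and> y \<in> G j \<and> z \<in> G (n - j)}"

lemma hom_tens_comul_range: "hom_tens A G [j, k] \<subseteq> graded_comul_range A G (j + k)"
  unfolding hom_tens_def
proof (rule tens.span_mono, clarify)
  fix xs assume "list_all2 (\<lambda>k x. x \<in> G k) [j, k] xs"
  then obtain y z where "xs = [y, z]" "y \<in> G j" "z \<in> G k" by (auto simp: list_all2_Cons1)
  then show "\<exists>y z j'. pure A xs = pure A [y, z] \<and> j' \<le> j + k \<and> y \<in> G j' \<and> z \<in> G (j + k - j')"
    by (intro exI[of _ y] exI[of _ z] exI[of _ j]) auto
qed

text \<open>In \<Delta>(xy) = (m \<otimes> m)(B \<otimes> c \<otimes> B)(\<Delta>x \<otimes>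
  \<Delta>y) a term of degrees (j, a - j, k, b - k) is braided to degrees (j, k, a - j, b - k) and
  multiplied to degrees (j + k, (a - j) + (b - k)), of total degree a + b.\<close>

lemma comul_mul_homogeneous:
  assumes B: "braided_bialgebra B" and G: "\<And>k. G k \<subseteq> carr B"
    and Gm: "\<And>x y k l. x \<in> G k \<Longrightarrow> y \<in> G l \<Longrightarrow> mul B x y \<in> G (k + l)"
    and c: "\<And>k l t. t \<in> hom_tens B G [k, l] \<Longrightarrow> braid B t \<in> hom_tens B G [l, k]"
    and x: "x \<in> carr B" "comul B x \<in> graded_comul_range B G a"
    and y: "y \<in> carr B" "comul B y \<in> graded_comul_range B G b"
  shows "comul B (mul B x y) \<in> graded_comul_range B G (a + b)"
proof -
  note A = braided_bialgebraD(1)[OF B] and V = braided_bialgebraD(4)[OF B] and cl = tlin_braid[OF braided_bialgebraD(3)[OF B]]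
  note tm = tensor_map_hom_tens[of B G, OF V G]
  have m: "mulT B t \<in> hom_tens B G [k + l]" if "t \<in> hom_tens B G [k, l]" for t k l
    using mul_hom_tens[of B G, OF A G Gm that] .
  have c3: "tlin B 3 (tensor_map B 2 (braid B) id)"
    using tlin_tensor_map[OF V cl tlin_id[of B 1]] by simp
  have sub: "{pure B [y, z] |y z j. j \<le> n \<and> y \<in> G j \<and> z \<in> G (n - j)} \<subseteq> tensor_space B" for n
  proof clarify
    fix y z j assume "y \<in> G j" "z \<in> G (n - j)"
    then show "pure B [y, z] \<in> tensor_space B" using G by (intro pure_in_tensor_space) auto
  qed
  have S: "tmult B (comul B x) (comul B y) \<in> tens.span (\<Union>j\<le>a. \<Union>k\<le>b. hom_tens B G [j, a - j, k, b - k])"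
  proof (rule tmult_span[OF V sub sub tens.subspace_span _ x(2) y(2)])
    fix s t assume "s \<in> {pure B [y, z] |y z j. j \<le> a \<and> y \<in> G j \<and> z \<in> G (a - j)}"
    then obtain p q j where j: "j \<le> a" "p \<in> G j" "q \<in> G (a - j)" "s = pure B [p, q]" by blast
    assume "t \<in> {pure B [y, z] |y z j. j \<le> b \<and> y \<in> G j \<and> z \<in> G (b - j)}"
    then obtain r u k where k: "k \<le> b" "r \<in> G k" "u \<in> G (b - k)" "t = pure B [r, u]" by blast
    have "set [p, q] \<subseteq> carr B" "set [r, u] \<subseteq> carr B"
      using j k by (simp_all add: subsetD[OF G])
    then have "tmult B s t = pure B [p, q, r, u]" unfolding j k by (simp add: tmult_pure[OF V])
    then have "tmult B s t \<in> hom_tens B G [j, a - j, k, b - k]" using j k by (simp add: pure_in_hom_tens)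
    with j(1) k(1) show "tmult B s t \<in> tens.span (\<Union>j\<le>a. \<Union>k\<le>b. hom_tens B G [j, a - j, k, b - k])"
      by (intro tens.span_base UN_I[of j] UN_I[of k]) simp_all
  qed
  have F: "tensor_map B 2 (mulT B) (mulT B) (tensor_map B 1 id (tensor_map B 2 (braid B) id) t)
      \<in> graded_comul_range B G (a + b)" if "t \<in> hom_tens B G [j, a - j, k, b - k]" "j \<le> a" "k \<le> b" for t j k
  proof -
    have "tensor_map B 2 (braid B) id s \<in> hom_tens B G [k, a - j, b - k]" if "s \<in> hom_tens B G [a - j, k, b - k]" for s
      using tm[OF cl tlin_id, where ks = "[a - j, k]" and ls = "[b - k]" and ks' = "[k, a - j]" and ls' = "[b - k]", of 1 s]
        c[of _ "a - j" k] that by simp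
    then have "tensor_map B 1 id (tensor_map B 2 (braid B) id) t \<in> hom_tens B G ([j] @ [k, a - j, b - k])"
      by (intro tm[OF tlin_id c3, where ks = "[j]" and ls = "[a - j, k, b - k]"]) (use that in auto)
    then have "tensor_map B 2 (mulT B) (mulT B) (tensor_map B 1 id (tensor_map B 2 (braid B) id) t)
        \<in> hom_tens B G ([j + k] @ [a - j + (b - k)])"
      by (intro tm[OF tlin_mulT[OF A] tlin_mulT[OF A], where ks = "[j, k]" and ls = "[a - j, b - k]"]) (use m in auto)
    moreover have "j + k + (a - j + (b - k)) = a + b" using that by simp
    ultimately show ?thesis
      using subsetD[OF hom_tens_comul_range[of B G "j + k" "a - j + (b - k)"]] by simp
  qed
  have L: "lin_map tscale UNIV tscale UNIV
      (\<lambda>t. tensor_map B 2 (mulT B) (mulT B) (tensor_map B 1 id (tensor_map B 2 (braid B) id) t))"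
    unfolding tensor_map_def using lin_map_comp[OF lin_map_lin_ext lin_map_lin_ext] by (simp only: o_def)
  show ?thesis unfolding comul_mul[OF B x(1) y(1)]
  proof (rule lin_map_span_image[OF vector_space_tscale tens.subspace_UNIV L vector_space_tscale
        tens.subspace_span subset_UNIV _ S])
    fix t assume "t \<in> (\<Union>j\<le>a. \<Union>k\<le>b. hom_tens B G [j, a - j, k, b - k])"
    then obtain j k where "j \<le> a" "k \<le> b" "t \<in> hom_tens B G [j, a - j, k, b - k]" by blast
    then show "tensor_map B 2 (mulT B) (mulT B) (tensor_map B 1 id (tensor_map B 2 (braid B) id) t)
      \<in> graded_comul_range B G (a + b)" by (intro F)
  qed
qed

lemma braided_space_homD:
  assumes "braided_space_hom V W f"
  shows "lin_map (smul V) (carr V) (smul W) (carr W) f"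
    "t \<in> tensor_power V 2 \<Longrightarrow> braid W (tensor_map_all W f t) = tensor_map_all W f (braid V t)"
  using assms by (auto simp: braided_space_hom_def)

lemma (in vector_space) subspace_zero: "subspace {0}"
  by (rule subspaceI) auto

lemma degree_part_0I:
  assumes "unital_algebra A" "vspace V" "lin_map (smul V) (carr V) (smul A) (carr A) i"
    and S: "module.subspace (smul A) S" "unit_el A \<in> S" and x: "x \<in> degree_part V A i 0"
  shows "x \<in> S"
proof -
  interpret vector_space "smul A" using assms(1) by (intro vspaceD unital_algebraD(1))
  \<comment> \<open>The family is everything in positive degrees, so the inductive step asks for
    nothing.\<close>
  have "x \<in> (if (0::nat) = 0 then S else UNIV)"
    by (rule degree_part_induct[OF assms(1-3) x, where P = "\<lambda>k. if k = 0 then S else UNIV"])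
      (use S in auto)
  then show ?thesis by simp
qed

text \<open>A word of length k + 1 is a letter times a word of length k, so no induction hypothesis
  is involved: the family is \<open>S\<close> in this one degree and everything elsewhere.\<close>

lemma degree_part_SucI:
  assumes "unital_algebra A" "vspace V" "lin_map (smul V) (carr V) (smul A) (carr A) i"
    and S: "module.subspace (smul A) S"
      "\<And>v y. v \<in> carr V \<Longrightarrow> y \<in> degree_part V A i k \<Longrightarrow> mul A (i v) y \<in> S"
    and x: "x \<in> degree_part V A i (Suc k)"
  shows "x \<in> S"
proof -
  interpret vector_space "smul A" using assms(1) by (intro vspaceD unital_algebraD(1))
  have "x \<in> (if Suc k = Suc k then S else UNIV)"
    by (rule degree_part_induct[OF assms(1-3) x, where P = "\<lambda>n. if n = Suc k then S else UNIV"])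
      (use S in auto)
  then show ?thesis by simp
qed

text \<open>The structure maps are known on \<open>V\<close> and satisfy the bialgebra axioms, so
  homogeneity is propagated along words. The braiding comes before the coproduct because the
  coproduct of a product involves it.\<close>

lemma tensor_algebra_graded:
  fixes V :: "('k::field, 'v::ab_group_add, 'm) braided_space_scheme"
    and A :: "('k, 'a::ab_group_add, 'n) braided_bialg_scheme"
  assumes bV: "braided_vector_space V" and T: "braided_tensor_algebra V A i"
  shows "graded_braided_bialgebra A (degree_part V A i)"
proof -
  have B: "braided_bialgebra A" and ta: "is_tensor_algebra V A i" and bh: "braided_space_hom V A i"
    and iv: "\<And>v. v \<in> carr V \<Longrightarrow> comul A (i v) = pure A [i v, unit_el A] + pure A [unit_el A, i v]"
      "\<And>v. v \<in> carr V \<Longrightarrow> counit A (i v) = 0"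
    using T by (auto simp: braided_tensor_algebra_def)
  note A = braided_bialgebraD(1)[OF B] and C = braided_bialgebraD(2)[OF B] and bA = braided_bialgebraD(3)[OF B]
    and vA = braided_bialgebraD(4)[OF B]
  have vV: "vspace V" using bV by (simp add: braided_vector_space_def)
  note i = braided_space_homD(1)[OF bh]
  let ?G = "degree_part V A i"
  interpret graded_space "smul A" "carr A" ?G by (rule graded_tensor_algebra[OF A vV i ta])
  note Gm = degree_part_mul[OF A vV i]
  have unit: "unit_el A \<in> ?G 0" using word_in_degree_part[OF A vV i, of "[]"] by simp
  have G1: "i v \<in> ?G 1" if "v \<in> carr V" for v using degree_part_1[OF A vV i] that by blast
  have iA: "i v \<in> carr A" if "v \<in> carr V" for v using lin_mapD(1)[OF i that] .
  let ?H = "\<lambda>m n. \<forall>t\<in>hom_tens A ?G [m, n]. braid A t \<in> hom_tens A ?G [n, m]"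
  have HI: "?H m n" if "\<And>x z. x \<in> ?G m \<Longrightarrow> z \<in> ?G n \<Longrightarrow> braid A (pure A [x, z]) \<in> hom_tens A ?G [n, m]" for m n
  proof
    fix t assume t: "t \<in> hom_tens A ?G [m, n]"
    show "braid A t \<in> hom_tens A ?G [n, m]"
    proof (rule lin_map_span_image[OF vector_space_tscale subspace_tensor_power tlin_braid[OF bA]
          vector_space_tscale subspace_hom_tens _ _ t[unfolded hom_tens_def]])
      show "{pure A xs |xs. list_all2 (\<lambda>k x. x \<in> ?G k) [m, n] xs} \<subseteq> tensor_power A 2"
        using hom_tens_subset[of ?G, OF part_subset, of "[m, n]"] pure_in_hom_tens[of ?G "[m, n]"]
        by (auto simp: numeral_2_eq_2)
    qed (auto simp: list_all2_Cons1 intro: that)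
  qed
  have subL: "subspace {x \<in> carr A. braid A (pure A [x, z]) \<in> hom_tens A ?G ks}" if "z \<in> carr A" for z ks
    using lin_map_kernel_subspace[OF vector_space_axioms subspace_carrier
        lin_map_comp[OF lin_map_pure_left[OF that] braid_lin[OF bA]] vector_space_tscale subspace_hom_tens]
    by simp
  have subR: "subspace {z \<in> carr A. braid A (pure A [x, z]) \<in> hom_tens A ?G ks}" if "x \<in> carr A" for x ks
    using lin_map_kernel_subspace[OF vector_space_axioms subspace_carrier
        lin_map_comp[OF lin_map_pure_right[OF that] braid_lin[OF bA]] vector_space_tscale subspace_hom_tens]
    by simp
  have H0: "?H 0 n" for n
  proof (rule HI)
    fix x z assume x: "x \<in> ?G 0" and z: "z \<in> ?G n"
    have zA: "z \<in> carr A" using z part_subset by blast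
    have "unit_el A \<in> {x \<in> carr A. braid A (pure A [x, z]) \<in> hom_tens A ?G [n, 0]}"
      using z zA unit unital_algebraD(6)[OF A] by (simp add: braid_unit[OF B] pure_in_hom_tens)
    from degree_part_0I[OF A vV i subL[OF zA] this x]
    show "braid A (pure A [x, z]) \<in> hom_tens A ?G [n, 0]" by simp
  qed
  \<comment> \<open>The base case comes from \<open>V\<close>: \<open>i\<close> intertwines the
    braidings, and that of \<open>V\<close> maps the second tensor power of \<open>V\<close> into
    itself.\<close>
  have H11: "?H 1 1"
  proof (rule HI)
    fix x z assume "x \<in> ?G 1" "z \<in> ?G 1"
    then obtain v w where vw: "x = i v" "z = i w" "v \<in> carr V" "w \<in> carr V"
      using degree_part_1[OF A vV i] by blast
    have p: "pure V [v, w] \<in> tensor_power V 2" using vw by (intro pure_in_tensor_power) auto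
    have "braid A (pure A [x, z]) = tensor_map_all A i (braid V (pure V [v, w]))"
      using braided_space_homD(2)[OF bh p] tensor_map_all_pure[OF i, of "[v, w]"] vw by simp
    also have "\<dots> \<in> hom_tens A ?G [1, 1]"
    proof (rule lin_map_span_image[OF vector_space_tscale tens.subspace_UNIV lin_map_tensor_map_all
          vector_space_tscale subspace_hom_tens subset_UNIV _ lin_mapD(1)[OF braid_lin[OF bV] p, unfolded tensor_power_def]])
      fix t assume "t \<in> {pure V xs |xs. set xs \<subseteq> carr V \<and> length xs = 2}"
      then obtain a b where "t = pure V [a, b]" "a \<in> carr V" "b \<in> carr V" by (auto elim!: length_2E)
      then show "tensor_map_all A i t \<in> hom_tens A ?G [1, 1]"
        using G1 tensor_map_all_pure[OF i, of "[a, b]"] by (simp add: pure_in_hom_tens)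
    qed
    finally show "braid A (pure A [x, z]) \<in> hom_tens A ?G [1, 1]" .
  qed
  \<comment> \<open>Induction on the right degree with the left one fixed at 1. The full statement
    \<open>H\<close> then goes by induction on the left degree, splitting off a letter, which uses
    all pairs (1, n).\<close>
  have H1: "?H 1 n" for n
  proof (induction n)
    case 0
    show ?case
    proof (rule HI)
      fix x z assume x: "x \<in> ?G 1" and z: "z \<in> ?G 0"
      have xA: "x \<in> carr A" using x part_subset by blast
      have "unit_el A \<in> {z \<in> carr A. braid A (pure A [x, z]) \<in> hom_tens A ?G [0, 1]}"
        using x xA unit unital_algebraD(6)[OF A] by (simp add: braid_unit[OF B] pure_in_hom_tens)
      from degree_part_0I[OF A vV i subR[OF xA] this z]
      show "braid A (pure A [x, z]) \<in> hom_tens A ?G [0, 1]" by simp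
    qed
  next
    case (Suc n)
    show ?case
    proof (rule HI)
      fix x z assume x: "x \<in> ?G 1" and z: "z \<in> ?G (Suc n)"
      have xA: "x \<in> carr A" using x part_subset by blast
      have "mul A (i v) y \<in> {z \<in> carr A. braid A (pure A [x, z]) \<in> hom_tens A ?G [Suc n, 1]}"
        if "v \<in> carr V" "y \<in> ?G n" for v y
        using braid_hom_tens_mul(2)[where G = ?G, OF B part_subset Gm x G1[OF that(1)] that(2) H11 Suc]
          unital_algebraD(4)[OF A iA[OF that(1)], of y] that(2) part_subset by auto
      from degree_part_SucI[OF A vV i subR[OF xA] this z]
      show "braid A (pure A [x, z]) \<in> hom_tens A ?G [Suc n, 1]" by simp
    qed
  qed
  have H: "?H m n" for m n
  proof (induction m)
    case 0
    show ?case by (rule H0)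
  next
    case (Suc m)
    show ?case
    proof (rule HI)
      fix x z assume x: "x \<in> ?G (Suc m)" and z: "z \<in> ?G n"
      have zA: "z \<in> carr A" using z part_subset by blast
      have "mul A (i v) y \<in> {x \<in> carr A. braid A (pure A [x, z]) \<in> hom_tens A ?G [n, Suc m]}"
        if "v \<in> carr V" "y \<in> ?G m" for v y
        using braid_hom_tens_mul(1)[where G = ?G, OF B part_subset Gm G1[OF that(1)] that(2) z Suc H1]
          unital_algebraD(4)[OF A iA[OF that(1)], of y] that(2) part_subset by auto
      from degree_part_SucI[OF A vV i subL[OF zA] this x]
      show "braid A (pure A [x, z]) \<in> hom_tens A ?G [n, Suc m]" by simp
    qed
  qed
  have comul: "comul A x \<in> graded_comul_range A ?G n" if "x \<in> ?G n" for x n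
  proof -
    have "x \<in> {x \<in> carr A. comul A x \<in> graded_comul_range A ?G n}"
    proof (rule degree_part_induct[OF A vV i that, where P = "\<lambda>n. {x \<in> carr A. comul A x \<in> graded_comul_range A ?G n}"])
      show "subspace {x \<in> carr A. comul A x \<in> graded_comul_range A ?G k}" for k
        by (rule lin_map_kernel_subspace[OF vector_space_axioms subspace_carrier counital_coalgebraD(2)[OF C]
              vector_space_tscale tens.subspace_span])
      have "pure A [unit_el A, unit_el A] \<in> hom_tens A ?G [0, 0]" using unit by (simp add: pure_in_hom_tens)
      then show "unit_el A \<in> {x \<in> carr A. comul A x \<in> graded_comul_range A ?G 0}"
        using subsetD[OF hom_tens_comul_range[of A ?G 0 0]] unital_algebraD(6)[OF A]
        by (simp add: braided_bialgebraD(5)[OF B])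
      fix v y k assume v: "v \<in> carr V" and y: "y \<in> ?G k" "y \<in> {x \<in> carr A. comul A x \<in> graded_comul_range A ?G k}"
      have "pure A [i v, unit_el A] \<in> hom_tens A ?G [1, 0]" "pure A [unit_el A, i v] \<in> hom_tens A ?G [0, 1]"
        using unit G1[OF v] by (simp_all add: pure_in_hom_tens)
      then have "pure A [i v, unit_el A] \<in> graded_comul_range A ?G 1"
        "pure A [unit_el A, i v] \<in> graded_comul_range A ?G 1"
        using subsetD[OF hom_tens_comul_range[of A ?G 1 0]] subsetD[OF hom_tens_comul_range[of A ?G 0 1]]
        unfolding add_0_left add_0_right by blast+
      then have "comul A (i v) \<in> graded_comul_range A ?G 1"
        unfolding iv(1)[OF v] by (rule tens.span_add)
      from comul_mul_homogeneous[where G = ?G, OF B part_subset Gm H[rule_format] iA[OF v] this]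
      show "mul A (i v) y \<in> {x \<in> carr A. comul A x \<in> graded_comul_range A ?G (Suc k)}"
        using y unital_algebraD(4)[OF A iA[OF v], of y] by simp
    qed
    then show ?thesis by simp
  qed
  have counit: "counit A x = 0" if x: "x \<in> ?G n" "n > 0" for x n
  proof -
    interpret K: vector_space "(*) :: 'k \<Rightarrow> _" by (rule vector_space_times)
    obtain m where "n = Suc m" using x(2) by (cases n) auto
    have "x \<in> {x \<in> carr A. counit A x \<in> {0}}"
    proof (rule degree_part_SucI[OF A vV i _ _ x(1)[unfolded \<open>n = Suc m\<close>]])
      show "subspace {x \<in> carr A. counit A x \<in> {0}}"
        by (rule lin_map_kernel_subspace[OF vector_space_axioms subspace_carrier counital_coalgebraD(3)[OF C]
              vector_space_times K.subspace_zero])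
      show "mul A (i v) y \<in> {x \<in> carr A. counit A x \<in> {0}}" if "v \<in> carr V" "y \<in> ?G m" for v y
        using iv(2)[OF that(1)] iA[OF that(1)] subsetD[OF part_subset that(2)]
        by (simp add: braided_bialgebraD(6)[OF B] unital_algebraD(4)[OF A])
    qed
    then show ?thesis by simp
  qed
  show ?thesis
    unfolding graded_braided_bialgebra_def
    using B subspace_part part_subset decomp_unique Gm unit comul counit H
    by (simp add: hom_tens_pair)
qed

section \<open>Braided bialgebra maps\<close>

lemma graded_braided_bialgebraD:
  assumes "graded_braided_bialgebra A G"
  shows "braided_bialgebra A" "graded_space (smul A) (carr A) G"
    "x \<in> G m \<Longrightarrow> y \<in> G n \<Longrightarrow> mul A x y \<in> G (m + n)" "unit_el A \<in> G 0"
    "x \<in> G n \<Longrightarrow> comul A x \<in> graded_comul_range A G n"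
    "0 < n \<Longrightarrow> x \<in> G n \<Longrightarrow> counit A x = 0"
    "t \<in> sub_tensor A (G m) (G n) \<Longrightarrow> braid A t \<in> sub_tensor A (G n) (G m)"
proof -
  show B: "braided_bialgebra A" using assms by (simp add: graded_braided_bialgebra_def)
  interpret vector_space "smul A" by (rule vspaceD(1)[OF braided_bialgebraD(4)[OF B]])
  show "graded_space (smul A) (carr A) G"
    using assms vspaceD(2)[OF braided_bialgebraD(4)[OF B]]
    by unfold_locales (auto simp: graded_braided_bialgebra_def)
  show "x \<in> G m \<Longrightarrow> y \<in> G n \<Longrightarrow> mul A x y \<in> G (m + n)" "unit_el A \<in> G 0"
    "x \<in> G n \<Longrightarrow> comul A x \<in> graded_comul_range A G n"
    "0 < n \<Longrightarrow> x \<in> G n \<Longrightarrow> counit A x = 0"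
    "t \<in> sub_tensor A (G m) (G n) \<Longrightarrow> braid A t \<in> sub_tensor A (G n) (G m)"
    using assms unfolding graded_braided_bialgebra_def by blast+
qed

lemma braided_bialgebra_homD:
  assumes "braided_bialgebra_hom A C f"
  shows "lin_map (smul A) (carr A) (smul C) (carr C) f"
    "t \<in> tensor_power A 2 \<Longrightarrow> braid C (tensor_map_all C f t) = tensor_map_all C f (braid A t)"
    "x \<in> carr A \<Longrightarrow> y \<in> carr A \<Longrightarrow> f (mul A x y) = mul C (f x) (f y)"
    "f (unit_el A) = unit_el C"
    "x \<in> carr A \<Longrightarrow> comul C (f x) = tensor_map_all C f (comul A x)"
    "x \<in> carr A \<Longrightarrow> counit C (f x) = counit A x"
    "x \<in> carr A \<Longrightarrow> f x \<in> carr C"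
  using assms unfolding braided_bialgebra_hom_def braided_space_hom_def lin_map_def by auto

lemma sub_tensor_subset:
  assumes "S \<subseteq> carr V" "R \<subseteq> carr V" shows "sub_tensor V S R \<subseteq> tensor_power V 2"
  unfolding sub_tensor_def
  by (rule tens.span_minimal[OF _ subspace_tensor_power]) (use assms in \<open>auto intro!: pure_in_tensor_power\<close>)

lemma sub_tensor_carr: "sub_tensor V (carr V) (carr V) = tensor_power V 2"
proof (rule antisym[OF sub_tensor_subset[OF order_refl order_refl]])
  show "tensor_power V 2 \<subseteq> sub_tensor V (carr V) (carr V)"
    unfolding sub_tensor_def tensor_power_def
  proof (rule tens.span_mono, clarify)
    fix xs assume "set xs \<subseteq> carr V" "length xs = 2"
    moreover from this obtain x y where "xs = [x, y]" by (elim length_2E)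
    ultimately show "\<exists>x y. pure V xs = pure V [x, y] \<and> x \<in> carr V \<and> y \<in> carr V" by auto
  qed
qed

lemma tensor_map_all_pair:
  assumes "lin_map (smul A) (carr A) (smul C) (carr C) f" "x \<in> carr A" "y \<in> carr A"
  shows "tensor_map_all C f (pure A [x, y]) = pure C [f x, f y]"
  using tensor_map_all_pure[OF assms(1), of "[x, y]"] assms(2,3) by simp

lemma tensor_map_all_span:
  assumes "t \<in> tens.span X" "tens.subspace Z" "\<And>x. x \<in> X \<Longrightarrow> tensor_map_all W f x \<in> Z"
  shows "tensor_map_all W f t \<in> Z"
  using lin_map_span_image[OF vector_space_tscale tens.subspace_UNIV lin_map_tensor_map_all
      vector_space_tscale assms(2) subset_UNIV assms(3,1)] .

lemma tensor_map_all_add: "tensor_map_all W f (s + t) = tensor_map_all W f s + tensor_map_all W f t"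
  using lin_mapD(2)[OF lin_map_tensor_map_all] by blast

lemma tensor_map_all_in_tensor_power:
  assumes f: "lin_map (smul V) (carr V) (smul W) (carr W) f" and t: "t \<in> tensor_power V n"
  shows "tensor_map_all W f t \<in> tensor_power W n"
proof (rule tensor_map_all_span[OF t[unfolded tensor_power_def] subspace_tensor_power])
  fix x assume "x \<in> {pure V xs |xs. set xs \<subseteq> carr V \<and> length xs = n}"
  then show "tensor_map_all W f x \<in> tensor_power W n"
    using lin_mapD(1)[OF f] tensor_map_all_pure[OF f] by (auto intro!: pure_in_tensor_power simp: subset_iff)
qed

lemma braided_bialgebra_hom_comp:
  assumes A: "braided_bialgebra A" and f: "braided_bialgebra_hom A B f" and g: "braided_bialgebra_hom B C g"
  shows "braided_bialgebra_hom A C (g \<circ> f)"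
proof -
  note fD = braided_bialgebra_homD[OF f] and gD = braided_bialgebra_homD[OF g]
  note comp = tensor_map_all_comp[OF fD(1) gD(1), of _ 2]
  show ?thesis
    unfolding braided_bialgebra_hom_def braided_space_hom_def
  proof (intro conjI ballI)
    show "lin_map (smul A) (carr A) (smul C) (carr C) (g \<circ> f)" by (rule lin_map_comp[OF fD(1) gD(1)])
    fix t assume t: "t \<in> tensor_power A 2"
    then have "braid A t \<in> tensor_power A 2" by (rule lin_mapD(1)[OF braid_lin[OF braided_bialgebraD(3)[OF A]]])
    then show "braid C (tensor_map_all C (g \<circ> f) t) = tensor_map_all C (g \<circ> f) (braid A t)"
      using gD(2)[OF tensor_map_all_in_tensor_power[OF fD(1) t]] by (simp only: comp[symmetric] t fD(2))
  next
    fix x assume x: "x \<in> carr A"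
    then have "comul A x \<in> tensor_power A 2" by (rule lin_mapD(1)[OF counital_coalgebraD(2)[OF braided_bialgebraD(2)[OF A]]])
    then show "comul C ((g \<circ> f) x) = tensor_map_all C (g \<circ> f) (comul A x)"
      using gD(5)[OF fD(7)[OF x]] fD(5)[OF x] by (simp only: comp[symmetric] o_apply)
    show "counit C ((g \<circ> f) x) = counit A x" using fD(6,7) gD(6) x by simp
    show "(g \<circ> f) (mul A x y) = mul C ((g \<circ> f) x) ((g \<circ> f) y)" if "y \<in> carr A" for y
      using fD(3)[OF x that] gD(3)[OF fD(7)[OF x] fD(7)[OF that]] by simp
  qed (use fD(4) gD(4) in simp)
qed

lemma braided_bialgebra_hom_id:
  assumes A: "braided_bialgebra A" shows "braided_bialgebra_hom A A id"
proof -
  have "tensor_map_all A id t = t" if "t \<in> tensor_power A 2" for t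
  proof (rule tensor_power_ext[OF _ _ _ that, where h' = "\<lambda>x. x" and sW = tscale and B = UNIV])
    show "lin_map tscale (tensor_power A 2) tscale UNIV (tensor_map_all A id)"
      by (rule lin_map_mono[OF lin_map_tensor_map_all]) auto
    show "tensor_map_all A id (pure A xs) = pure A xs" if "set xs \<subseteq> carr A" for xs
      using tensor_map_all_pure[OF lin_map_id that] by (simp only: list.map_id)
  qed (simp add: lin_map_def)
  then show ?thesis
    using lin_mapD(1)[OF counital_coalgebraD(2)[OF braided_bialgebraD(2)[OF A]]]
      lin_mapD(1)[OF braid_lin[OF braided_bialgebraD(3)[OF A]]] lin_map_id[of "smul A" "carr A"]
    by (simp add: braided_bialgebra_hom_def braided_space_hom_def)
qed

section \<open>Kernels, ideals and graded quotients\<close>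

lemma ker_two_sided_ideal:
  assumes A: "braided_bialgebra A" and C: "braided_bialgebra C" and f: "braided_bialgebra_hom A C f"
  shows "two_sided_ideal A (ker_on A f)"
proof -
  note fD = braided_bialgebra_homD[OF f] and uA = braided_bialgebraD(1)[OF A] and uC = braided_bialgebraD(1)[OF C]
  interpret C: vector_space "smul C" by (rule vspaceD(1)[OF braided_bialgebraD(4)[OF C]])
  have "ker_on A f = {x \<in> carr A. f x \<in> {0}}" by (simp add: ker_on_def)
  then have "module.subspace (smul A) (ker_on A f)"
    using lin_map_kernel_subspace[OF vspaceD(1,2)[OF braided_bialgebraD(4)[OF A]] fD(1) C.vector_space_axioms C.subspace_zero]
    by simp
  moreover have "mul C x 0 = 0" "mul C 0 x = 0" if "x \<in> carr C" for x
    using lin_map_0[OF vspaceD(1,2)[OF braided_bialgebraD(4)[OF C]] unital_algebraD(2)[OF uC that]]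
      lin_map_0[OF vspaceD(1,2)[OF braided_bialgebraD(4)[OF C]] unital_algebraD(3)[OF uC that]] by auto
  ultimately show ?thesis
    using fD(3,7) unital_algebraD(4)[OF uA] by (auto simp: two_sided_ideal_def ker_on_def)
qed

lemma ideal_hull_subset:
  "two_sided_ideal A I \<Longrightarrow> X \<subseteq> I \<Longrightarrow> two_sided_ideal A hull X \<subseteq> I"
  by (rule hull_minimal)

text \<open>Homogeneous elements of the quotient are images of homogeneous ones and \<open>f\<close>
  respects all structure maps, so each clause is checked on preimages. \<open>homog\<close> enters
  through \<open>graded_space_image\<close>, which makes the sum of the images direct.\<close>

lemma graded_quotient:
  assumes gr: "graded_braided_bialgebra A G" and C: "braided_bialgebra C" and f: "braided_bialgebra_hom A C f"
    and surj: "f ` carr A = carr C"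
    and homog: "\<And>x k. x \<in> carr A \<Longrightarrow> f x = 0 \<Longrightarrow> f (component G x k) = 0"
  shows "graded_braided_bialgebra C (\<lambda>k. f ` G k)"
    and "x \<in> carr A \<Longrightarrow> component (\<lambda>k. f ` G k) (f x) k = f (component G x k)"
proof -
  note gD = graded_braided_bialgebraD[OF gr] and fD = braided_bialgebra_homD[OF f]
  interpret A: graded_space "smul A" "carr A" G by (rule gD(2))
  note vC = vspaceD(1)[OF braided_bialgebraD(4)[OF C]]
  note im = A.graded_space_image[OF vC fD(1) surj homog]
  interpret C: graded_space "smul C" "carr C" "\<lambda>k. f ` G k" by (rule im(1))
  show "x \<in> carr A \<Longrightarrow> component (\<lambda>k. f ` G k) (f x) k = f (component G x k)" by (rule im(2))
  have GA: "x \<in> carr A" if "x \<in> G k" for x k using that A.part_subset by blast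
  have mul: "mul C x y \<in> f ` G (m + n)" if xy: "x \<in> f ` G m" "y \<in> f ` G n" for x y m n
  proof -
    obtain a b where "a \<in> G m" "b \<in> G n" "x = f a" "y = f b" using xy by blast
    then show ?thesis using gD(3) fD(3) GA by (intro image_eqI[of _ _ "mul A a b"]) simp_all
  qed
  have unit: "unit_el C \<in> f ` G 0" using gD(4) fD(4) by (intro image_eqI[of _ _ "unit_el A"]) simp_all
  have comul: "comul C x \<in> graded_comul_range C (\<lambda>k. f ` G k) n" if x: "x \<in> f ` G n" for x n
  proof -
    obtain a where a: "a \<in> G n" "x = f a" using x by blast
    have "tensor_map_all C f (comul A a) \<in> graded_comul_range C (\<lambda>k. f ` G k) n"
    proof (rule tensor_map_all_span[OF gD(5)[OF a(1)] tens.subspace_span])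
      fix t assume "t \<in> {pure A [y, z] |y z j. j \<le> n \<and> y \<in> G j \<and> z \<in> G (n - j)}"
      then obtain y z j where yz: "t = pure A [y, z]" "j \<le> n" "y \<in> G j" "z \<in> G (n - j)" by blast
      then have "tensor_map_all C f t = pure C [f y, f z]" using GA by (simp add: tensor_map_all_pair[OF fD(1)])
      then show "tensor_map_all C f t \<in> graded_comul_range C (\<lambda>k. f ` G k) n"
        using yz by (intro tens.span_base) blast
    qed
    then show ?thesis using fD(5)[OF GA[OF a(1)]] a(2) by simp
  qed
  have counit: "counit C x = 0" if x: "0 < n" "x \<in> f ` G n" for x n
  proof -
    obtain a where "a \<in> G n" "x = f a" using x by blast
    then show ?thesis using gD(6)[OF x(1)] fD(6) GA by simp
  qed
  have braid: "braid C t \<in> sub_tensor C (f ` G n) (f ` G m)" if t: "t \<in> sub_tensor C (f ` G m) (f ` G n)" for t m n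
  proof (rule lin_map_span_image[OF vector_space_tscale subspace_tensor_power
        braid_lin[OF braided_bialgebraD(3)[OF C]] vector_space_tscale _ _ _ t[unfolded sub_tensor_def]])
    show "tens.subspace (sub_tensor C (f ` G n) (f ` G m))" unfolding sub_tensor_def by (rule tens.subspace_span)
    show "{pure C [x, y] |x y. x \<in> f ` G m \<and> y \<in> f ` G n} \<subseteq> tensor_power C 2"
    proof clarify
      fix x y assume "x \<in> G m" "y \<in> G n"
      then have "set [f x, f y] \<subseteq> carr C" using fD(7)[OF GA[of x m]] fD(7)[OF GA[of y n]] by simp
      then show "pure C [f x, f y] \<in> tensor_power C 2" by (intro pure_in_tensor_power) simp_all
    qed
    fix s assume "s \<in> {pure C [x, y] |x y. x \<in> f ` G m \<and> y \<in> f ` G n}"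
    then obtain x y where xy: "x \<in> G m" "y \<in> G n" "s = pure C [f x, f y]" by blast
    then have s: "s = tensor_map_all C f (pure A [x, y])" using GA by (simp add: tensor_map_all_pair[OF fD(1)])
    have "pure A [x, y] \<in> sub_tensor A (G m) (G n)" unfolding sub_tensor_def using xy by (intro tens.span_base) blast
    then have b: "braid A (pure A [x, y]) \<in> sub_tensor A (G n) (G m)" by (rule gD(7))
    have "braid C s = tensor_map_all C f (braid A (pure A [x, y]))"
      unfolding s
    proof (intro fD(2) pure_in_tensor_power)
      show "set [x, y] \<subseteq> carr A" using GA[OF xy(1)] GA[OF xy(2)] by simp
    qed simp
    also have "\<dots> \<in> sub_tensor C (f ` G n) (f ` G m)"
      unfolding sub_tensor_def
    proof (rule tensor_map_all_span[OF b[unfolded sub_tensor_def] tens.subspace_span])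
      fix r assume "r \<in> {pure A [x, y] |x y. x \<in> G n \<and> y \<in> G m}"
      then obtain u v where "r = pure A [u, v]" "u \<in> G n" "v \<in> G m" by blast
      moreover from this have "tensor_map_all C f r = pure C [f u, f v]" using GA by (simp add: tensor_map_all_pair[OF fD(1)])
      ultimately show "tensor_map_all C f r \<in> tens.span {pure C [x, y] |x y. x \<in> f ` G n \<and> y \<in> f ` G m}"
        by (intro tens.span_base) blast
    qed
    finally show "braid C s \<in> sub_tensor C (f ` G n) (f ` G m)" .
  qed
  show "graded_braided_bialgebra C (\<lambda>k. f ` G k)"
    unfolding graded_braided_bialgebra_def
    by (intro conjI allI ballI impI C C.subspace_part C.part_subset C.decomp_unique mul unit comul counit braid)
qed

lemma degree_part_hom:
  assumes A: "unital_algebra A" and C: "unital_algebra C"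
    and i: "\<And>v. v \<in> carr V \<Longrightarrow> i v \<in> carr A" and f: "braided_bialgebra_hom A C f"
    and j: "\<And>v. v \<in> carr V \<Longrightarrow> j v = f (i v)"
  shows "degree_part V C j k = f ` degree_part V A i k"
proof -
  note fD = braided_bialgebra_homD[OF f]
  have w: "foldr (mul A) (map i vs) (unit_el A) \<in> carr A \<and>
      f (foldr (mul A) (map i vs) (unit_el A)) = foldr (mul C) (map j vs) (unit_el C)" if "set vs \<subseteq> carr V" for vs
    using that by (induction vs) (auto simp: unital_algebraD(4,6)[OF A] i j fD(3,4))
  let ?W = "{foldr (mul A) (map i vs) (unit_el A) |vs. set vs \<subseteq> carr V \<and> length vs = k}"
  have "f ` ?W = {foldr (mul C) (map j vs) (unit_el C) |vs. set vs \<subseteq> carr V \<and> length vs = k}"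
  proof (intro equalityI subsetI)
    fix x assume "x \<in> {foldr (mul C) (map j vs) (unit_el C) |vs. set vs \<subseteq> carr V \<and> length vs = k}"
    then obtain vs where "x = foldr (mul C) (map j vs) (unit_el C)" "set vs \<subseteq> carr V" "length vs = k" by blast
    then show "x \<in> f ` ?W" using w[of vs] by (intro image_eqI[of _ _ "foldr (mul A) (map i vs) (unit_el A)"]) auto
  next
    fix x assume "x \<in> f ` ?W"
    then obtain vs where "x = f (foldr (mul A) (map i vs) (unit_el A))" "set vs \<subseteq> carr V" "length vs = k" by blast
    then show "x \<in> {foldr (mul C) (map j vs) (unit_el C) |vs. set vs \<subseteq> carr V \<and> length vs = k}" using w[of vs] by auto
  qed
  moreover have "?W \<subseteq> carr A" using w by auto
  ultimately show ?thesis
    using lin_map_image_span[OF vspaceD(1,2)[OF unital_algebraD(1)[OF A]] fD(1) vspaceD(1)[OF unital_algebraD(1)[OF C]], of ?W]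
    by (simp only: degree_part_def)
qed

lemma pure_zero:
  assumes V: "vspace V" and x: "x \<in> carr V"
  shows "pure V [0, x] = 0" "pure V [x, 0] = 0"
  using lin_map_0[OF vspaceD(1,2)[OF V] lin_map_pure_left[OF x]]
    lin_map_0[OF vspaceD(1,2)[OF V] lin_map_pure_right[OF x]] by auto

text \<open>Here both gradings are already known: the images of the components of \<open>x\<close>
  decompose \<open>f x\<close>, and there is only one decomposition.\<close>

lemma component_image:
  assumes A: "graded_space sA A G" and C: "graded_space sC C H" and f: "lin_map sA A sC C f"
    and fG: "\<And>k. f ` G k \<subseteq> H k" and x: "x \<in> A"
  shows "component H (f x) k = f (component G x k)"
proof -
  interpret A: graded_space sA A G by (rule A)
  interpret C: graded_space sC C H by (rule C)
  from x obtain S where S: "finite S" "\<And>k. k \<notin> S \<Longrightarrow> component G x k = 0" "x = sum (component G x) S"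
    by (rule A.component_supportE) blast
  have "f x = (\<Sum>k\<in>S. f (component G x k))"
    by (subst S(3), rule lin_map_sum[OF A.vector_space_axioms A.subspace_carrier f])
      (rule A.component_in_carrier[OF x])
  then have "homog_decomp H (f x) (\<lambda>k. f (component G x k))"
    using fG A.component_in[OF x] lin_map_0[OF A.vector_space_axioms A.subspace_carrier f] S(2)
    by (intro homog_decompI[OF S(1)]) auto
  then show ?thesis by (simp add: C.component_unique)
qed

section \<open>Homogeneous components of primitive elements\<close>

text \<open>The right hand side applies to \<Delta>x the projection of A \<otimes> A onto total
  degree k, written as the sum over j of the projections onto degrees (j, k - j). Since \<Delta>
  preserves degree, this projection picks out \<Delta> of the component.\<close>

lemma component_comul:
  fixes A :: "('k::field, 'a::ab_group_add, 'm) braided_bialg_scheme"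
  assumes gr: "graded_braided_bialgebra A G" and x: "x \<in> carr A"
  shows "comul A (component G x k) = (\<Sum>j\<le>k. sub_tensor_map A (carr A) (carr A)
           (\<lambda>y. component G y j) (\<lambda>y. component G y (k - j)) (comul A x))"
proof -
  note gD = graded_braided_bialgebraD[OF gr]
  interpret A: graded_space "smul A" "carr A" G by (rule gD(2))
  note V = braided_bialgebraD(4)[OF gD(1)] and C = braided_bialgebraD(2)[OF gD(1)]
  note \<Delta> = counital_coalgebraD(2)[OF C]
  have P: "lin_map (smul A) (carr A) (smul A) (carr A) (\<lambda>y. component G y j)" for j
    using lin_map_mono[OF A.component_lin order_refl A.part_subset] .
  note stm = sub_tensor_map[OF V A.subspace_carrier A.subspace_carrier order_refl order_refl P P]
  define Q where "Q t = (\<Sum>j\<le>k. sub_tensor_map A (carr A) (carr A)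
           (\<lambda>y. component G y j) (\<lambda>y. component G y (k - j)) t)" for t
  have Qlin: "lin_map tscale (tensor_power A 2) tscale UNIV Q"
    unfolding lin_map_def Q_def using lin_mapD(2,3)[OF stm(1)[unfolded sub_tensor_carr]]
    by (simp add: sum.distrib tens.scale_sum_right)
  have Qhom: "Q t = (if n = k then t else 0)" if t: "t \<in> graded_comul_range A G n" for t n
  proof (rule lin_map_eq_on_span[OF vector_space_tscale _ _ _ t])
    let ?X = "{pure A [y, z] |y z j. j \<le> n \<and> y \<in> G j \<and> z \<in> G (n - j)}"
    have "?X \<subseteq> tensor_power A 2"
    proof clarify
      fix y z j assume "y \<in> G j" "z \<in> G (n - j)"
      then show "pure A [y, z] \<in> tensor_power A 2"
        using subsetD[OF A.part_subset] by (intro pure_in_tensor_power) simp_all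
    qed
    then have "tens.span ?X \<subseteq> tensor_power A 2" using tens.span_minimal subspace_tensor_power by blast
    then show "lin_map tscale (tens.span ?X) tscale UNIV Q" by (rule lin_map_mono[OF Qlin _ order_refl])
    show "lin_map tscale (tens.span ?X) tscale UNIV (\<lambda>t. if n = k then t else 0)"
      by (simp add: lin_map_def)
    fix s assume "s \<in> ?X"
    then obtain y z l where yz: "s = pure A [y, z]" "l \<le> n" "y \<in> G l" "z \<in> G (n - l)" by blast
    then have yzA: "y \<in> carr A" "z \<in> carr A" using A.part_subset by blast+
    have "Q s = (\<Sum>j\<le>k. pure A [component G y j, component G z (k - j)])"
      unfolding Q_def yz(1) using stm(2) yzA by simp
    \<comment> \<open>Only j = l survives in the first factor, and then the second one forces n =
      k.\<close>
    also have "\<dots> = (\<Sum>j\<le>k. if j = l then (if n = k then s else 0) else 0)"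
      using yz yzA vspaceD(3)[OF V]
      by (intro sum.cong refl) (auto simp: A.component_homogeneous[OF yz(3)] A.component_homogeneous[OF yz(4)] pure_zero[OF V])
    also have "\<dots> = (if n = k then s else 0)" using yz(2) by auto
    finally show "Q s = (if n = k then s else 0)" .
  qed
  from x obtain S where S: "finite S" "\<And>k. k \<notin> S \<Longrightarrow> component G x k = 0" "x = sum (component G x) S"
    by (rule A.component_supportE) blast
  note xA = A.component_in_carrier[OF x]
  have "comul A x = (\<Sum>n\<in>S. comul A (component G x n))"
    by (subst S(3), rule lin_map_sum[OF A.vector_space_axioms A.subspace_carrier \<Delta>]) (rule xA)
  then have "Q (comul A x) = (\<Sum>n\<in>S. Q (comul A (component G x n)))"
    using lin_map_sum[OF vector_space_tscale subspace_tensor_power Qlin, of S "\<lambda>n. comul A (component G x n)"]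
      lin_mapD(1)[OF \<Delta> xA] by simp
  also have "\<dots> = (\<Sum>n\<in>S. if n = k then comul A (component G x k) else 0)"
    using Qhom[OF gD(5)[OF A.component_in[OF x]]] by (intro sum.cong) auto
  also have "\<dots> = comul A (component G x k)"
    using S lin_map_0[OF A.vector_space_axioms A.subspace_carrier \<Delta>] by auto
  finally show ?thesis by (simp add: Q_def)
qed

lemma component_prim:
  assumes gr: "graded_braided_bialgebra A G" and x: "x \<in> prim A"
  shows "component G x k \<in> prim A"
proof -
  note gD = graded_braided_bialgebraD[OF gr]
  interpret A: graded_space "smul A" "carr A" G by (rule gD(2))
  note V = braided_bialgebraD(4)[OF gD(1)] and uA = unital_algebraD(6)[OF braided_bialgebraD(1)[OF gD(1)]]
  have xA: "x \<in> carr A" and \<Delta>: "comul A x = pure A [x, unit_el A] + pure A [unit_el A, x]"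
    using x by (auto simp: prim_def)
  have P: "lin_map (smul A) (carr A) (smul A) (carr A) (\<lambda>y. component G y j)" for j
    using lin_map_mono[OF A.component_lin order_refl A.part_subset] .
  note stm = sub_tensor_map[OF V A.subspace_carrier A.subspace_carrier order_refl order_refl P P]
  have tp: "pure A [y, z] \<in> tensor_power A 2" if "y \<in> carr A" "z \<in> carr A" for y z
    using that by (intro pure_in_tensor_power) auto
  note xk = A.component_in_carrier[OF xA]
  \<comment> \<open>The unit has degree 0, so x \<otimes> 1 survives only for j = k and 1 \<otimes>
    x only for j = 0. The two conditionals are kept apart because both indices coincide when k =
    0.\<close>
  have "sub_tensor_map A (carr A) (carr A) (\<lambda>y. component G y j) (\<lambda>y. component G y (k - j)) (comul A x) =
      (if j = k then pure A [component G x k, unit_el A] else 0) +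
      (if j = 0 then pure A [unit_el A, component G x k] else 0)" if j: "j \<le> k" for j
  proof -
    have "sub_tensor_map A (carr A) (carr A) (\<lambda>y. component G y j) (\<lambda>y. component G y (k - j)) (comul A x) =
      pure A [component G x j, component G (unit_el A) (k - j)] + pure A [component G (unit_el A) j, component G x (k - j)]"
      unfolding \<Delta> using lin_mapD(2)[OF stm(1)[unfolded sub_tensor_carr]] stm(2) tp xA uA by simp
    then show ?thesis using j
      by (auto simp: A.component_homogeneous[OF gD(4)] pure_zero[OF V xk])
  qed
  then have "(\<Sum>j\<le>k. sub_tensor_map A (carr A) (carr A) (\<lambda>y. component G y j) (\<lambda>y. component G y (k - j)) (comul A x)) =
      (\<Sum>j\<le>k. (if j = k then pure A [component G x k, unit_el A] else 0) +
      (if j = 0 then pure A [unit_el A, component G x k] else 0))"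
    by (intro sum.cong) auto
  then show ?thesis
    using xk component_comul[OF gr xA, of k] by (simp add: prim_def sum.distrib)
qed

text \<open>The counit axioms identify the two extremal terms of the coproduct.\<close>

lemma comul_reduced:
  assumes gr: "graded_braided_bialgebra A G" and G0: "G 0 = range (\<lambda>a. smul A a (unit_el A))"
    and x: "x \<in> G n" and n: "n > 0"
  obtains r where "r \<in> tens.span {pure A [y, z] | y z j. 0 < j \<and> j < n \<and> y \<in> G j \<and> z \<in> G (n - j)}"
    "comul A x = pure A [x, unit_el A] + pure A [unit_el A, x] + r"
proof -
  note gD = graded_braided_bialgebraD[OF gr]
  interpret A: graded_space "smul A" "carr A" G by (rule gD(2))
  note V = braided_bialgebraD(4)[OF gD(1)] and C = braided_bialgebraD(2)[OF gD(1)]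
  note u = unital_algebraD(6)[OF braided_bialgebraD(1)[OF gD(1)]]
  have GA: "y \<in> carr A" if "y \<in> G k" for y k using that A.part_subset by blast
  let ?X = "{pure A [y, z] | y z j. 0 < j \<and> j < n \<and> y \<in> G j \<and> z \<in> G (n - j)}"
  have pl: "pure A [smul A c y + y', z] = tscale c (pure A [y, z]) + pure A [y', z]"
    if "y \<in> carr A" "y' \<in> carr A" "z \<in> carr A" for c y y' z
    using lin_mapD(2,3)[OF lin_map_pure_left[OF that(3)]] that vspaceD(5)[OF V] by simp
  have pr: "pure A [z, smul A c y + y'] = tscale c (pure A [z, y]) + pure A [z, y']"
    if "y \<in> carr A" "y' \<in> carr A" "z \<in> carr A" for c y y' z
    using lin_mapD(2,3)[OF lin_map_pure_right[OF that(3)]] that vspaceD(5)[OF V] by simp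
  \<comment> \<open>The extremal terms are first collected with unrelated elements \<open>a\<close>
    and \<open>a'\<close>: degree 0 consists of multiples of the unit, so the scalar moves across
    the tensor sign into the factor of degree n.\<close>
  have "\<exists>a a' r. a \<in> G n \<and> a' \<in> G n \<and> r \<in> tens.span ?X \<and>
      comul A x = pure A [a, unit_el A] + pure A [unit_el A, a'] + r"
    using gD(5)[OF x]
  proof (induction rule: tens.span_induct_alt)
    case base
    show ?case
      by (intro exI[of _ 0]) (simp add: A.subspace_0[OF A.subspace_part] tens.span_zero pure_zero[OF V u])
  next
    case (step c s t)
    then obtain a a' r where r: "a \<in> G n" "a' \<in> G n" "r \<in> tens.span ?X"
      "t = pure A [a, unit_el A] + pure A [unit_el A, a'] + r" by blast
    from step(1) obtain y z j where yz: "s = pure A [y, z]" "j \<le> n" "y \<in> G j" "z \<in> G (n - j)" by blast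
    consider "j = 0" | "j = n" | "0 < j" "j < n" using yz(2) by linarith
    then show ?case
    proof cases
      case 1
      then obtain e where "y = smul A e (unit_el A)" using yz(3) G0 by auto
      then have s: "s = pure A [unit_el A, smul A e z]"
        using lin_mapD(3)[OF lin_map_pure_left, of z A "unit_el A" e] lin_mapD(3)[OF lin_map_pure_right, of "unit_el A" A z e]
          GA[OF yz(4)] u yz(1) by simp
      have z: "smul A e z \<in> G n" using yz(4) 1 A.subspace_scale[OF A.subspace_part] by simp
      have "tscale c s + t = pure A [a, unit_el A] + pure A [unit_el A, smul A c (smul A e z) + a'] + r"
        using pr[OF GA[OF z] GA[OF r(2)] u, of c] by (simp add: s r(4) algebra_simps)
      moreover have "smul A c (smul A e z) + a' \<in> G n"
        by (rule A.subspace_add[OF A.subspace_part A.subspace_scale[OF A.subspace_part z] r(2)])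
      ultimately show ?thesis using r by blast
    next
      case 2
      then obtain e where "z = smul A e (unit_el A)" using yz(4) G0 by auto
      then have s: "s = pure A [smul A e y, unit_el A]"
        using lin_mapD(3)[OF lin_map_pure_right, of y A "unit_el A" e] lin_mapD(3)[OF lin_map_pure_left, of "unit_el A" A y e]
          GA[OF yz(3)] u yz(1) by simp
      have y: "smul A e y \<in> G n" using yz(3) 2 A.subspace_scale[OF A.subspace_part] by simp
      have "tscale c s + t = pure A [smul A c (smul A e y) + a, unit_el A] + pure A [unit_el A, a'] + r"
        using pl[OF GA[OF y] GA[OF r(1)] u, of c] by (simp add: s r(4) algebra_simps)
      moreover have "smul A c (smul A e y) + a \<in> G n"
        by (rule A.subspace_add[OF A.subspace_part A.subspace_scale[OF A.subspace_part y] r(1)])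
      ultimately show ?thesis using r by blast
    next
      case 3
      have "s \<in> ?X" using 3 yz by blast
      then have "tscale c s + r \<in> tens.span ?X"
        by (intro tens.span_add[OF _ r(3)] tens.span_scale tens.span_base)
      moreover have "tscale c s + t = pure A [a, unit_el A] + pure A [unit_el A, a'] + (tscale c s + r)"
        by (simp add: r(4) algebra_simps)
      ultimately show ?thesis using r by blast
    qed
  qed
  then obtain a a' r where r: "a \<in> G n" "a' \<in> G n" "r \<in> tens.span ?X"
    "comul A x = pure A [a, unit_el A] + pure A [unit_el A, a'] + r" by blast
  have \<epsilon>l: "tensor_map A 1 (counitT A) id (pure A [y, z]) = tscale (counit A y) (pure A [z])"
    if "y \<in> carr A" "z \<in> carr A" for y z
  proof -
    have "tensor_map A 1 (counitT A) id (pure A [y, z]) = tmult A (tscale (counit A y) (pure A [])) (pure A [z])"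
      using tensor_map_pure[OF V tlin_counitT[OF C] tlin_id, of "[y]" "[z]" 1] that by (simp add: counitT_pure[OF C])
    also have "\<dots> = tscale (counit A y) (tmult A (pure A []) (pure A [z]))"
      using lin_mapD(3)[OF tmult_left_linear] by blast
    finally show ?thesis using that by (simp add: tmult_pure[OF V])
  qed
  have \<epsilon>r: "tensor_map A 1 id (counitT A) (pure A [y, z]) = tscale (counit A z) (pure A [y])"
    if "y \<in> carr A" "z \<in> carr A" for y z
  proof -
    have "tensor_map A 1 id (counitT A) (pure A [y, z]) = tmult A (pure A [y]) (tscale (counit A z) (pure A []))"
      using tensor_map_pure[OF V tlin_id tlin_counitT[OF C], of "[y]" "[z]" 1] that by (simp add: counitT_pure[OF C])
    also have "\<dots> = tscale (counit A z) (tmult A (pure A [y]) (pure A []))"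
      using that by (intro lin_mapD(3)[OF tmult_right_linear[OF V]] pure_in_tensor_space) auto
    finally show ?thesis using that by (simp add: tmult_pure[OF V])
  qed
  \<comment> \<open>Both tensor factors of every term of \<open>r\<close> have positive degree,
    where the counit vanishes.\<close>
  have kill: "tensor_map A 1 (counitT A) id r \<in> {0}" "tensor_map A 1 id (counitT A) r \<in> {0}"
  proof -
    show "tensor_map A 1 (counitT A) id r \<in> {0}" unfolding tensor_map_def
    proof (rule lin_map_span_image[OF vector_space_tscale tens.subspace_UNIV lin_map_lin_ext
          vector_space_tscale tens.subspace_zero subset_UNIV _ r(3)], fold tensor_map_def)
      fix s assume "s \<in> ?X"
      then obtain y z j where "s = pure A [y, z]" "0 < j" "y \<in> G j" "z \<in> G (n - j)" by blast
      then show "tensor_map A 1 (counitT A) id s \<in> {0}" using \<epsilon>l[of y z] GA gD(6)[of j y] by simp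
    qed
    show "tensor_map A 1 id (counitT A) r \<in> {0}" unfolding tensor_map_def
    proof (rule lin_map_span_image[OF vector_space_tscale tens.subspace_UNIV lin_map_lin_ext
          vector_space_tscale tens.subspace_zero subset_UNIV _ r(3)], fold tensor_map_def)
      fix s assume "s \<in> ?X"
      then obtain y z j where "s = pure A [y, z]" "j < n" "y \<in> G j" "z \<in> G (n - j)" by blast
      then show "tensor_map A 1 id (counitT A) s \<in> {0}" using \<epsilon>r[of y z] GA gD(6)[of "n - j" z] by simp
    qed
  qed
  have tma: "tensor_map A 1 f g (s + t) = tensor_map A 1 f g s + tensor_map A 1 f g t" for f g s t
    by (simp add: tensor_map_def lin_ext_add)
  have xA: "x \<in> carr A" and aA: "a \<in> carr A" "a' \<in> carr A" using x r GA by blast+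
  have \<epsilon>: "counit A a = 0" "counit A a' = 0" "counit A (unit_el A) = 1"
    using gD(6)[OF n] r(1,2) braided_bialgebraD(7)[OF gD(1)] by auto
  have "pure A [x] = pure A [a']"
    using counital_coalgebraD(4)[OF C xA] kill(1)
    by (simp only: r(4) tma \<epsilon>l[OF aA(1) u] \<epsilon>l[OF u aA(2)] \<epsilon> singleton_iff tens.scale_zero_left tens.scale_one add_0_left add_0_right)
  moreover have "pure A [x] = pure A [a]"
    using counital_coalgebraD(5)[OF C xA] kill(2)
    by (simp only: r(4) tma \<epsilon>r[OF aA(1) u] \<epsilon>r[OF u aA(2)] \<epsilon> singleton_iff tens.scale_zero_left tens.scale_one add_0_left add_0_right)
  ultimately have "x = a" "x = a'" using pure_1_inject[OF V xA] aA by blast+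
  then show ?thesis using r(3,4) that by blast
qed

text \<open>On \<open>S\<close> the map \<open>f\<close> is g h, so f \<otimes> f is (g \<otimes>
  g)(h \<otimes> h) on S \<otimes> S. Used with \<open>S\<close> the whole carrier in
  \<open>prim_modulo_K\<close> and with a finite-dimensional \<open>S\<close> in
  \<open>killed_if_trivial\<close>.\<close>

lemma tensor_map_all_factor:
  assumes A: "vspace A" and C: "vspace C" and D: "vspace D"
    and S: "module.subspace (smul A) S" "S \<subseteq> carr A"
    and h: "lin_map (smul A) (carr A) (smul D) (carr D) h" and f: "lin_map (smul A) (carr A) (smul C) (carr C) f"
    and ker: "\<And>x. x \<in> S \<Longrightarrow> h x = 0 \<Longrightarrow> f x = 0"
    and t: "t \<in> sub_tensor A S S" and ht: "tensor_map_all D h t = 0"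
  shows "tensor_map_all C f t = 0"
proof -
  obtain g where g: "lin_map (smul D) UNIV (smul C) (carr C) g" "\<And>x. x \<in> S \<Longrightarrow> g (h x) = f x"
    by (rule lin_map_factor[OF vspaceD(1)[OF A] vspaceD(1)[OF D] vspaceD(1)[OF C] S(1) vspaceD(2)[OF C]
          lin_map_mono[OF h S(2) order_refl] lin_map_mono[OF f S(2) order_refl] ker]) blast+
  have g': "lin_map (smul D) (carr D) (smul C) (carr C) g" by (rule lin_map_mono[OF g(1)]) auto
  have "tensor_map_all C f t = (tensor_map_all C g \<circ> tensor_map_all D h) t"
  proof (rule lin_map_eq_on_span[OF vector_space_tscale _ _ _ t[unfolded sub_tensor_def]])
    show "lin_map tscale (tens.span {pure A [x, y] |x y. x \<in> S \<and> y \<in> S}) tscale UNIV (tensor_map_all C f)"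
      by (rule lin_map_mono[OF lin_map_tensor_map_all]) auto
    show "lin_map tscale (tens.span {pure A [x, y] |x y. x \<in> S \<and> y \<in> S}) tscale UNIV (tensor_map_all C g \<circ> tensor_map_all D h)"
      by (rule lin_map_mono[OF lin_map_comp[OF lin_map_tensor_map_all lin_map_tensor_map_all]]) auto
    fix s assume "s \<in> {pure A [x, y] |x y. x \<in> S \<and> y \<in> S}"
    then obtain x y where xy: "s = pure A [x, y]" "x \<in> S" "y \<in> S" by blast
    then have "x \<in> carr A" "y \<in> carr A" using S(2) by blast+
    then show "tensor_map_all C f s = (tensor_map_all C g \<circ> tensor_map_all D h) s"
      using xy g(2) lin_mapD(1)[OF h]
      by (simp add: tensor_map_all_pair[OF f] tensor_map_all_pair[OF h] tensor_map_all_pair[OF g'])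
  qed
  also have "\<dots> = 0" using lin_map_0[OF vector_space_tscale tens.subspace_UNIV lin_map_tensor_map_all] ht by simp
  finally show ?thesis .
qed

text \<open>Serves to show that a generated ideal is homogeneous: with \<open>I\<close> the
  generated ideal itself, it suffices that the generators lie in this set. Closure under products is
  checked on homogeneous factors and extended to each argument through its components.\<close>

lemma homogeneous_ideal:
  assumes gr: "graded_braided_bialgebra A G" and I: "two_sided_ideal A I"
  shows "two_sided_ideal A {y \<in> carr A. \<forall>k. component G y k \<in> I}" (is "two_sided_ideal A ?J")
proof -
  note gD = graded_braided_bialgebraD[OF gr]
  interpret A: graded_space "smul A" "carr A" G by (rule gD(2))
  note uA = braided_bialgebraD(1)[OF gD(1)]
  have sI: "A.subspace I" and IA: "I \<subseteq> carr A"
    and II: "\<And>x y. x \<in> carr A \<Longrightarrow> y \<in> I \<Longrightarrow> mul A x y \<in> I"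
      "\<And>x y. x \<in> carr A \<Longrightarrow> y \<in> I \<Longrightarrow> mul A y x \<in> I"
    using I by (auto simp: two_sided_ideal_def)
  have GA: "y \<in> carr A" if "y \<in> G k" for y k using that A.part_subset by blast
  have P: "lin_map (smul A) (carr A) (smul A) (carr A) (\<lambda>y. component G y k)" for k
    using lin_map_mono[OF A.component_lin order_refl A.part_subset] .
  note ks = lin_map_kernel_subspace[OF A.vector_space_axioms A.subspace_carrier _ A.vector_space_axioms sI]
  have sub: "A.subspace {y \<in> carr A. component G y k \<in> I}" for k by (rule ks[OF P])
  have "?J = (\<Inter>k. {y \<in> carr A. component G y k \<in> I})" by blast
  then have "A.subspace ?J" using A.subspace_Int[of UNIV "\<lambda>k. {y \<in> carr A. component G y k \<in> I}"] sub by simp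
  moreover have "component G (mul A x y) k \<in> I \<and> component G (mul A y x) k \<in> I" if x: "x \<in> carr A" and y: "y \<in> ?J" for x y k
  proof -
    have yA: "y \<in> carr A" using y by simp
    have hom: "component G (mul A u w) k \<in> I \<and> component G (mul A w u) k \<in> I"
      if u: "u \<in> G a" and w: "w \<in> G c" "w \<in> I" for u w a c
      using A.component_homogeneous[OF gD(3)[OF u w(1)]] A.component_homogeneous[OF gD(3)[OF w(1) u]]
        II[OF GA[OF u] w(2)] A.subspace_0[OF sI] by simp
    have 1: "y \<in> {y \<in> carr A. component G (mul A u y) k \<in> I}" "y \<in> {y \<in> carr A. component G (mul A y u) k \<in> I}"
      if u: "u \<in> G a" for u a
    proof -
      note uc = GA[OF u]
      have yk: "component G y c \<in> G c" "component G y c \<in> I" "component G y c \<in> carr A" for c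
        using y A.component_in[OF yA] A.component_in_carrier[OF yA] by auto
      show "y \<in> {y \<in> carr A. component G (mul A u y) k \<in> I}"
        by (rule A.component_induct[OF yA ks[OF lin_map_comp[OF unital_algebraD(2)[OF uA uc] P], unfolded o_apply]])
          (use hom[OF u yk(1,2)] yk(3) in simp)
      show "y \<in> {y \<in> carr A. component G (mul A y u) k \<in> I}"
        by (rule A.component_induct[OF yA ks[OF lin_map_comp[OF unital_algebraD(3)[OF uA uc] P], unfolded o_apply]])
          (use hom[OF u yk(1,2)] yk(3) in simp)
    qed
    have "x \<in> {x \<in> carr A. component G (mul A x y) k \<in> I}"
      by (rule A.component_induct[OF x ks[OF lin_map_comp[OF unital_algebraD(3)[OF uA yA] P], unfolded o_apply]])
        (use 1(1)[OF A.component_in[OF x]] A.component_in_carrier[OF x] in simp)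
    moreover have "x \<in> {x \<in> carr A. component G (mul A y x) k \<in> I}"
      by (rule A.component_induct[OF x ks[OF lin_map_comp[OF unital_algebraD(2)[OF uA yA] P], unfolded o_apply]])
        (use 1(2)[OF A.component_in[OF x]] A.component_in_carrier[OF x] in simp)
    ultimately show ?thesis by simp
  qed
  ultimately show ?thesis
    unfolding two_sided_ideal_def using unital_algebraD(4)[OF uA] by blast
qed

text \<open>Surjectivity lets an arbitrary multiplier in \<open>C\<close> be lifted to
  \<open>A\<close>. Applied to the image of the Nichols kernel in a stage.\<close>

lemma image_ideal:
  assumes A: "braided_bialgebra A" and C: "braided_bialgebra C" and f: "braided_bialgebra_hom A C f"
    and surj: "f ` carr A = carr C" and I: "two_sided_ideal A I"
  shows "two_sided_ideal C (f ` I)"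
proof -
  note fD = braided_bialgebra_homD[OF f] and vA = vspaceD(1,2)[OF braided_bialgebraD(4)[OF A]]
  have sI: "module.subspace (smul A) I" and IA: "I \<subseteq> carr A"
    and II: "\<And>x y. x \<in> carr A \<Longrightarrow> y \<in> I \<Longrightarrow> mul A x y \<in> I \<and> mul A y x \<in> I"
    using I by (auto simp: two_sided_ideal_def)
  have "module.subspace (smul C) (f ` I)"
    using lin_map_image_subspace[OF vA fD(1) vspaceD(1)[OF braided_bialgebraD(4)[OF C]] sI IA] .
  moreover have "mul C x y \<in> f ` I \<and> mul C y x \<in> f ` I" if xy: "x \<in> carr C" "y \<in> f ` I" for x y
  proof -
    obtain a c where ac: "a \<in> carr A" "c \<in> I" "x = f a" "y = f c" using xy surj by blast
    then have "mul C x y = f (mul A a c)" "mul C y x = f (mul A c a)" using fD(3) IA by auto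
    then show ?thesis using II[OF ac(1,2)] by simp
  qed
  moreover have "f ` I \<subseteq> carr C" using IA surj by blast
  ultimately show ?thesis unfolding two_sided_ideal_def by blast
qed

section \<open>The tower of a bracket\<close>

lemma transition_self: "transition \<pi> n n x = x"
  by (simp add: transition_def)

lemma transition_Suc: "m \<le> n \<Longrightarrow> transition \<pi> m (Suc n) x = \<pi> n (transition \<pi> m n x)"
  by (simp add: transition_def)

locale bracket_limit =
  fixes V :: "('k::field, 'v::ab_group_add, 'm) braided_space_scheme"
    and U :: "nat \<Rightarrow> ('k, 'u::ab_group_add, 'n) braided_bialg_scheme"
    and \<pi> i b
    and L :: "('k, 'l::ab_group_add, 'o) braided_bialg_scheme" and \<pi>inf
  assumes bracket: "bracket V U \<pi> i b" and limit: "is_direct_limit U \<pi> L \<pi>inf"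
begin

text \<open>\<open>q n\<close> projects the tensor algebra onto the n-th stage and
  \<open>part n\<close> is the candidate grading there. Facts about stages are pulled back to
  \<open>U 0\<close> along \<open>q\<close>, which avoids comparing arbitrary pairs of
  stages.\<close>

abbreviation "q \<equiv> transition \<pi> 0"
abbreviation "part n \<equiv> degree_part V (U n) (i n)"

lemma bV: "braided_vector_space V" and vV: "vspace V"
  using bracket by (auto simp: bracket_def braided_vector_space_def)

lemma tensor_algebra: "braided_tensor_algebra V (U 0) (i 0)"
  using bracket by (simp add: bracket_def)

lemma stage: "bracket_stage V (U n) (i n) (b n)"
  and hom_\<pi>: "braided_bialgebra_hom (U n) (U (Suc n)) (\<pi> n)"
  and surj_\<pi>: "\<pi> n ` carr (U n) = carr (U (Suc n))"
  and ker_\<pi>: "ker_on (U n) (\<pi> n) = two_sided_ideal (U n) hull ((\<lambda>x. x - i n (b n x)) ` prim (U n))"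
  and i_Suc: "v \<in> carr V \<Longrightarrow> i (Suc n) v = \<pi> n (i n v)"
proof -
  have "bracket_stage V (U n) (i n) (b n) \<and> braided_bialgebra_hom (U n) (U (Suc n)) (\<pi> n) \<and>
      \<pi> n ` carr (U n) = carr (U (Suc n)) \<and>
      ker_on (U n) (\<pi> n) = two_sided_ideal (U n) hull ((\<lambda>x. x - i n (b n x)) ` prim (U n)) \<and>
      (\<forall>v\<in>carr V. i (Suc n) v = \<pi> n (i n v))"
    using bracket unfolding bracket_def by (elim conjE) (rule spec)
  then show "bracket_stage V (U n) (i n) (b n)" "braided_bialgebra_hom (U n) (U (Suc n)) (\<pi> n)"
    "\<pi> n ` carr (U n) = carr (U (Suc n))"
    "ker_on (U n) (\<pi> n) = two_sided_ideal (U n) hull ((\<lambda>x. x - i n (b n x)) ` prim (U n))"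
    "v \<in> carr V \<Longrightarrow> i (Suc n) v = \<pi> n (i n v)" by simp_all
qed

lemma bialg: "braided_bialgebra (U n)" and i_lin: "lin_map (smul V) (carr V) (smul (U n)) (carr (U n)) (i n)"
  and b_carr: "x \<in> prim (U n) \<Longrightarrow> b n x \<in> carr V"
  using stage[of n] by (auto simp: bracket_stage_def braided_space_hom_def lin_map_def)

lemmas alg = braided_bialgebraD(1)[OF bialg] and vU = braided_bialgebraD(4)[OF bialg]

lemma i_carr: "v \<in> carr V \<Longrightarrow> i n v \<in> carr (U n)"
  using lin_mapD(1)[OF i_lin] .

lemma q_0: "q 0 = id" and q_Suc: "q (Suc n) = \<pi> n \<circ> q n"
  by (auto simp: fun_eq_iff transition_self transition_Suc)

lemma hom_q: "braided_bialgebra_hom (U 0) (U n) (q n)"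
proof (induction n)
  case 0
  show ?case unfolding q_0 by (rule braided_bialgebra_hom_id[OF bialg])
next
  case (Suc n)
  show ?case unfolding q_Suc by (rule braided_bialgebra_hom_comp[OF bialg Suc hom_\<pi>])
qed

lemma surj_q: "q n ` carr (U 0) = carr (U n)"
proof (induction n)
  case (Suc n)
  then show ?case unfolding q_Suc image_comp[symmetric] by (simp only: surj_\<pi>)
qed (simp add: q_0)

lemma i_q: "v \<in> carr V \<Longrightarrow> i n v = q n (i 0 v)"
  by (induction n) (simp_all add: q_0 q_Suc i_Suc)

lemmas q_lin = braided_bialgebra_homD(1)[OF hom_q] and q_carr = braided_bialgebra_homD(7)[OF hom_q]

lemma q_zero: "q n 0 = 0"
  by (rule lin_map_0[OF vspaceD(1,2)[OF vU] q_lin])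

lemma part_q: "part n k = q n ` part 0 k"
  by (rule degree_part_hom[OF alg alg i_carr hom_q i_q])

lemma part_Suc: "part (Suc n) k = \<pi> n ` part n k"
  by (rule degree_part_hom[OF alg alg i_carr hom_\<pi> i_Suc])

lemma graded_0: "graded_braided_bialgebra (U 0) (part 0)"
  by (rule tensor_algebra_graded[OF bV tensor_algebra])

lemma q_killed: "m \<le> n \<Longrightarrow> q m x = 0 \<Longrightarrow> q n x = 0"
proof (induction n rule: dec_induct)
  case (step n)
  then show ?case using lin_map_0[OF vspaceD(1,2)[OF vU] braided_bialgebra_homD(1)[OF hom_\<pi>]] by (simp add: q_Suc)
qed

lemma bialg_L: "braided_bialgebra L" and hom_\<pi>inf: "braided_bialgebra_hom (U n) L (\<pi>inf n)"
  using limit unfolding is_direct_limit_def by (elim conjE; simp)+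

lemma \<pi>inf_eq_iff:
  "x \<in> carr (U m) \<Longrightarrow> y \<in> carr (U n) \<Longrightarrow> \<pi>inf m x = \<pi>inf n y \<longleftrightarrow>
    (\<exists>l. m \<le> l \<and> n \<le> l \<and> transition \<pi> m l x = transition \<pi> n l y)"
  using limit unfolding is_direct_limit_def by (elim conjE) simp

lemma \<pi>inf_q: "x \<in> carr (U 0) \<Longrightarrow> \<pi>inf n (q n x) = \<pi>inf 0 x"
  by (subst \<pi>inf_eq_iff[OF q_carr]) (auto intro!: exI[of _ n] simp: transition_self)

lemma \<pi>inf_\<pi>: "x \<in> carr (U n) \<Longrightarrow> \<pi>inf (Suc n) (\<pi> n x) = \<pi>inf n x"
  by (subst \<pi>inf_eq_iff[OF braided_bialgebra_homD(7)[OF hom_\<pi>]])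
    (auto intro!: exI[of _ "Suc n"] simp: transition_self transition_Suc)

lemma \<pi>inf_zero_iff: "x \<in> carr (U 0) \<Longrightarrow> \<pi>inf 0 x = 0 \<longleftrightarrow> (\<exists>n. q n x = 0)"
  using \<pi>inf_eq_iff[of x 0 0 0] vspaceD(3)[OF vU, of 0] q_zero
    lin_map_0[OF vspaceD(1,2)[OF vU] braided_bialgebra_homD(1)[OF hom_\<pi>inf], of 0] by simp

lemma component_q:
  assumes "graded_braided_bialgebra (U n) (part n)" "x \<in> carr (U 0)"
  shows "component (part n) (q n x) k = q n (component (part 0) x k)"
  by (rule component_image[OF graded_braided_bialgebraD(2)[OF graded_0] graded_braided_bialgebraD(2)[OF assms(1)]
        q_lin _ assms(2)]) (simp add: part_q[symmetric])

end

section \<open>The tower of the bracket compared with the Nichols algebra\<close>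

locale bracket_nichols = bracket_limit V U \<pi> i b L \<pi>inf
  for V :: "('k::field, 'v::ab_group_add, 'm) braided_space_scheme"
    and U :: "nat \<Rightarrow> ('k, 'u::ab_group_add, 'n) braided_bialg_scheme"
    and \<pi> i b
    and L :: "('k, 'l::ab_group_add, 'o) braided_bialg_scheme" and \<pi>inf +
  fixes B :: "('k, 'b::ab_group_add, 'p) braided_bialg_scheme" and p
  assumes nichols: "nichols_algebra V (U 0) (i 0) B p"
begin

abbreviation "K \<equiv> ker_on (U 0) p"

lemma hom_p: "braided_bialgebra_hom (U 0) B p"
  and graded_B: "graded_braided_bialgebra B (\<lambda>k. p ` part 0 k)"
  and prim_B: "prim B = p ` part 0 1"
  using nichols by (auto simp: nichols_algebra_def)

lemmas bialg_B = graded_braided_bialgebraD(1)[OF graded_B]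

sublocale T: graded_space "smul (U 0)" "carr (U 0)" "part 0"
  by (rule graded_braided_bialgebraD(2)[OF graded_0])

lemma K_components:
  assumes "x \<in> K"
  shows "component (part 0) x k \<in> K" "component (part 0) x 0 = 0" "component (part 0) x 1 = 0"
proof -
  have "homog_decomp (part 0) x (component (part 0) x)" using assms T.component_decomp by (simp add: ker_on_def)
  then show "component (part 0) x k \<in> K" "component (part 0) x 0 = 0" "component (part 0) x 1 = 0"
    using assms nichols unfolding nichols_algebra_def homogeneous_in_degrees_ge_2_def by blast+
qed

lemma K_ideal: "two_sided_ideal (U 0) K"
  by (rule ker_two_sided_ideal[OF bialg bialg_B hom_p])

lemma K_subset: "K \<subseteq> carr (U 0)"
  by (auto simp: ker_on_def)

lemma K_subspace: "T.subspace K"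
  using K_ideal by (simp add: two_sided_ideal_def)

lemma part_0_1: "part 0 1 = i 0 ` carr V"
  by (rule degree_part_1[OF alg vV i_lin])

text \<open>Since \<open>q n\<close> kills only elements of \<open>K\<close>, \<open>p\<close>
  factors through it; so for a preimage \<open>t\<close> of \<open>x\<close> the element
  \<open>p t\<close> is primitive. Primitives of the Nichols algebra have degree one, which provides
  \<open>v\<close>.\<close>

lemma prim_modulo_K:
  assumes ker: "ker_on (U 0) (q n) \<subseteq> K" and x: "x \<in> prim (U n)"
  obtains t v where "t \<in> carr (U 0)" "x = q n t" "v \<in> carr V" "t - i 0 v \<in> K"
proof -
  have xU: "x \<in> carr (U n)" and \<Delta>x: "comul (U n) x = pure (U n) [x, unit_el (U n)] + pure (U n) [unit_el (U n), x]"
    using x by (auto simp: prim_def)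
  obtain t where t: "t \<in> carr (U 0)" "x = q n t" using xU surj_q by blast
  note qD = braided_bialgebra_homD[OF hom_q] and pD = braided_bialgebra_homD[OF hom_p]
  have u: "unit_el (U 0) \<in> carr (U 0)" by (rule unital_algebraD(6)[OF alg])
  let ?s = "pure (U 0) [t, unit_el (U 0)] + pure (U 0) [unit_el (U 0), t]"
  \<comment> \<open>The defect of \<open>t\<close> from being primitive. The tensor square of
    \<open>q n\<close> kills it because \<open>x\<close> is primitive, hence so does that of
    \<open>p\<close>.\<close>
  let ?r = "comul (U 0) t - ?s"
  have s2: "?s \<in> tensor_power (U 0) 2"
    using t u by (intro tens.subspace_add[OF subspace_tensor_power] pure_in_tensor_power) auto
  have r2: "?r \<in> sub_tensor (U 0) (carr (U 0)) (carr (U 0))"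
    unfolding sub_tensor_carr using s2 t lin_mapD(1)[OF counital_coalgebraD(2)[OF braided_bialgebraD(2)[OF bialg]]]
    by (intro tens.subspace_diff[OF subspace_tensor_power]) auto
  have tm_diff: "tensor_map_all W f (a - c) = tensor_map_all W f a - tensor_map_all W f c"
    for W :: "('k, 'd::ab_group_add, 'e) braided_space_scheme" and f :: "'u \<Rightarrow> 'd" and a c
    using lin_map_diff[OF vector_space_tscale tens.subspace_UNIV lin_map_tensor_map_all] by blast
  have "tensor_map_all (U n) (q n) ?r = 0"
    unfolding tm_diff tensor_map_all_add
    using qD(5)[OF t(1)] \<Delta>x qD(4) by (simp add: tensor_map_all_pair[OF qD(1)] t u)
  moreover have "p x = 0" if "x \<in> carr (U 0)" "q n x = 0" for x
    using ker that by (auto simp: ker_on_def)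
  ultimately have "tensor_map_all B p ?r = 0"
    using tensor_map_all_factor[OF vU braided_bialgebraD(4)[OF bialg_B] vU T.subspace_carrier order_refl q_lin pD(1) _ r2]
    by blast
  then have "comul B (p t) = pure B [p t, unit_el B] + pure B [unit_el B, p t]"
    unfolding tm_diff tensor_map_all_add
    using pD(5)[OF t(1)] pD(4) by (simp add: tensor_map_all_pair[OF pD(1)] t u)
  then have "p t \<in> prim B" using pD(7)[OF t(1)] by (simp add: prim_def)
  then obtain v where v: "v \<in> carr V" "p t = p (i 0 v)" using prim_B part_0_1 by auto
  then have "t - i 0 v \<in> K"
    using t i_carr[OF v(1)] lin_map_diff[OF vspaceD(1,2)[OF vU] pD(1)] vspaceD(6)[OF vU]
    by (simp add: ker_on_def)
  with t v that show ?thesis by blast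
qed

lemma trivial_if_killed:
  assumes inj: "inj_on (\<pi>inf 0 \<circ> i 0) (carr V)" and K: "\<And>x. x \<in> K \<Longrightarrow> \<pi>inf 0 x = 0"
  shows "trivial_bracket V U i b"
proof -
  note \<pi>infD = braided_bialgebra_homD[OF hom_\<pi>inf] and \<pi>D = braided_bialgebra_homD[OF hom_\<pi>]
  have bracket_value: "i n (b n x) = component (part n) x 1 \<and> x - i n (b n x) \<in> q n ` K"
    if gr: "graded_braided_bialgebra (U n) (part n)" and ker: "ker_on (U 0) (q n) \<subseteq> K"
      and x: "x \<in> prim (U n)" for n x
  proof -
    obtain t v where tv: "t \<in> carr (U 0)" "x = q n t" "v \<in> carr V" "t - i 0 v \<in> K"
      by (rule prim_modulo_K[OF ker x])
    have xU: "x \<in> carr (U n)" using x by (simp add: prim_def)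
    have iv: "i 0 v \<in> part 0 1" using part_0_1 tv(3) by blast
    \<comment> \<open>\<open>K\<close> has no components of degree one, so \<open>t\<close> and
      \<open>i 0 v\<close> agree there.\<close>
    have "component (part 0) t 1 = i 0 v"
      using K_components(3)[OF tv(4)] T.component_diff[OF tv(1) i_carr[OF tv(3)]]
        T.component_homogeneous[OF iv] by simp
    then have c1: "component (part n) x 1 = i n v"
      using component_q[OF gr tv(1), of 1] tv(2) i_q[OF tv(3), of n] by simp
    have "x - i n (b n x) \<in> ker_on (U n) (\<pi> n)"
      unfolding ker_\<pi> using x by (intro hull_inc) blast
    then have "\<pi> n x = \<pi> n (i n (b n x))"
      using lin_map_diff[OF vspaceD(1,2)[OF vU] \<pi>D(1) xU i_carr[OF b_carr[OF x]]] by (simp add: ker_on_def)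
    then have "\<pi>inf n x = \<pi>inf n (i n (b n x))"
      using \<pi>inf_\<pi>[OF xU] \<pi>inf_\<pi>[OF i_carr[OF b_carr[OF x]]] by simp
    also have "\<dots> = \<pi>inf 0 (i 0 (b n x))"
      using i_q[OF b_carr[OF x], of n] \<pi>inf_q[OF i_carr[OF b_carr[OF x]], of n] by simp
    finally have "\<pi>inf 0 t = \<pi>inf 0 (i 0 (b n x))" using \<pi>inf_q[OF tv(1)] tv(2) by simp
    moreover have "\<pi>inf 0 t = \<pi>inf 0 (i 0 v)"
      using K[OF tv(4)] lin_map_diff[OF vspaceD(1,2)[OF vU] \<pi>infD(1) tv(1) i_carr[OF tv(3)]] by simp
    ultimately have "b n x = v" by (intro inj_onD[OF inj _ b_carr[OF x] tv(3)]) simp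
    moreover have "x - i n v = q n (t - i 0 v)"
      using tv(2) i_q[OF tv(3), of n] lin_map_diff[OF vspaceD(1,2)[OF vU] q_lin tv(1) i_carr[OF tv(3)]] by simp
    then have "x - i n v \<in> q n ` K" using tv(4) by (rule image_eqI)
    ultimately show ?thesis using c1 by (simp only: simp_thms)
  qed
  \<comment> \<open>Gradedness and the kernel bound are proved together:
    \<open>bracket_value\<close> uses both, and its two conclusions yield both for the next
    stage.\<close>
  have main: "graded_braided_bialgebra (U n) (part n) \<and> ker_on (U 0) (q n) \<subseteq> K" for n
  proof (induction n)
    case 0
    have "0 \<in> K" using lin_map_0[OF vspaceD(1,2)[OF vU] braided_bialgebra_homD(1)[OF hom_p]] vspaceD(3)[OF vU]
      by (simp add: ker_on_def)
    then show ?case using graded_0 by (auto simp: q_0 ker_on_def)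
  next
    case (Suc n)
    then have gr: "graded_braided_bialgebra (U n) (part n)" and ker: "ker_on (U 0) (q n) \<subseteq> K" by auto
    interpret G: graded_space "smul (U n)" "carr (U n)" "part n" by (rule graded_braided_bialgebraD(2)[OF gr])
    let ?I = "ker_on (U n) (\<pi> n)" and ?X = "(\<lambda>x. x - i n (b n x)) ` prim (U n)"
    have I: "two_sided_ideal (U n) ?I" by (rule ker_two_sided_ideal[OF bialg bialg hom_\<pi>])
    have "?X \<subseteq> {y \<in> carr (U n). \<forall>k. component (part n) y k \<in> ?I}"
    proof clarify
      fix x assume x: "x \<in> prim (U n)"
      have xU: "x \<in> carr (U n)" using x by (simp add: prim_def)
      note ib = i_carr[OF b_carr[OF x], of n]
      have "component (part n) (x - i n (b n x)) k \<in> ?I" for k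
      \<comment> \<open>In degree one the bracket value is exactly the component of
        \<open>x\<close>, so the difference vanishes there.\<close>
      proof (cases "k = 1")
        case True
        then have "component (part n) (x - i n (b n x)) k = 0"
          using G.component_diff[OF xU ib] bracket_value[OF gr ker x] G.component_homogeneous[OF G.component_in[OF xU, of 1]]
          by simp
        then show ?thesis using G.subspace_0[of ?I] I by (simp add: two_sided_ideal_def)
      next
        case False
        let ?y = "component (part n) x k"
        have y: "?y \<in> prim (U n)" by (rule component_prim[OF gr x])
        have "component (part n) (x - i n (b n x)) k = ?y"
          using False G.component_diff[OF xU ib] bracket_value[OF gr ker x] G.component_homogeneous[OF G.component_in[OF xU, of 1]]
          by simp
        \<comment> \<open>\<open>?y\<close> is primitive and homogeneous of degree other than 1, so
          its bracket value maps to 0 in \<open>U n\<close> and \<open>?y\<close> is itself one of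
          the generators.\<close>
        also have "\<dots> = ?y - i n (b n ?y)"
          using False bracket_value[OF gr ker y] G.component_homogeneous[OF G.component_in[OF xU, of k]] by simp
        also have "\<dots> \<in> ?I" unfolding ker_\<pi> using y by (intro hull_inc) blast
        finally show ?thesis .
      qed
      then show "x - i n (b n x) \<in> carr (U n) \<and> (\<forall>k. component (part n) (x - i n (b n x)) k \<in> ?I)"
        using vspaceD(6)[OF vU xU ib] by blast
    qed
    then have "?I \<subseteq> {y \<in> carr (U n). \<forall>k. component (part n) y k \<in> ?I}"
      by (subst (1) ker_\<pi>) (rule ideal_hull_subset[OF homogeneous_ideal[OF gr I]])
    then have homog: "\<pi> n (component (part n) y k) = 0" if "y \<in> carr (U n)" "\<pi> n y = 0" for y k
      using that by (auto simp: ker_on_def)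
    have "graded_braided_bialgebra (U (Suc n)) (part (Suc n))"
    proof -
      have "part (Suc n) = (\<lambda>k. \<pi> n ` part n k)" by (rule ext) (rule part_Suc)
      then show ?thesis using graded_quotient(1)[OF gr bialg hom_\<pi> surj_\<pi> homog] by simp
    qed
    \<comment> \<open>The generators lie in the image of \<open>K\<close> by
      \<open>bracket_value\<close>, and that image is an ideal because \<open>q n\<close> is
      onto.\<close>
    moreover have "?I \<subseteq> q n ` K"
      unfolding ker_\<pi>
      by (rule ideal_hull_subset[OF image_ideal[OF bialg bialg hom_q surj_q K_ideal]])
        (use bracket_value[OF gr ker] in blast)
    then have "ker_on (U 0) (q (Suc n)) \<subseteq> K"
    proof (intro subsetI)
      fix t assume "t \<in> ker_on (U 0) (q (Suc n))"
      then have t: "t \<in> carr (U 0)" "q n t \<in> ?I" using q_carr by (auto simp: ker_on_def q_Suc)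
      with \<open>?I \<subseteq> q n ` K\<close> obtain k where k: "k \<in> K" "q n t = q n k" by blast
      \<comment> \<open>\<open>t\<close> is corrected by an element of \<open>K\<close> with the
        same image in \<open>U n\<close>; the error is in the kernel of \<open>q n\<close>, which
        the induction hypothesis places in \<open>K\<close>.\<close>
      then have "t - k \<in> ker_on (U 0) (q n)"
        using t(1) K_subset lin_map_diff[OF vspaceD(1,2)[OF vU] q_lin, of t k] vspaceD(6)[OF vU]
        by (auto simp: ker_on_def)
      then have "t - k + k \<in> K" using ker by (intro T.subspace_add[OF K_subspace _ k(1)]) blast
      then show "t \<in> K" by simp
    qed
    ultimately show ?case by blast
  qed
  have "inj_on (i n) (carr V)" for n
  proof (rule inj_onI)
    fix v w assume vw: "v \<in> carr V" "w \<in> carr V" "i n v = i n w"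
    then have "\<pi>inf 0 (i 0 v) = \<pi>inf 0 (i 0 w)"
      using i_q[of _ n] by (simp flip: \<pi>inf_q[OF i_carr, of _ n])
    then show "v = w" using inj_onD[OF inj] vw by simp
  qed
  moreover have "i n (b n x) = d 1" if "x \<in> prim (U n)" "homog_decomp (part n) x d" for n x d
  proof -
    have gr: "graded_braided_bialgebra (U n) (part n)" and ker: "ker_on (U 0) (q n) \<subseteq> K" using main by auto
    show ?thesis
      using bracket_value[OF gr ker that(1)]
        graded_space.component_unique[OF graded_braided_bialgebraD(2)[OF gr] that(2)] by simp
  qed
  ultimately show ?thesis using main by (simp add: trivial_bracket_def)
qed

lemma killed_if_trivial:
  assumes triv: "trivial_bracket V U i b" and x: "x \<in> K"
  shows "\<pi>inf 0 x = 0"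
proof -
  have gr: "graded_braided_bialgebra (U n) (part n)" for n using triv by (simp add: trivial_bracket_def)
  note pD = braided_bialgebra_homD[OF hom_p] and qD = braided_bialgebra_homD[OF hom_q]
  \<comment> \<open>Phrased with \<open>eventually\<close> rather than as existence of a stage, so
    that finitely many elements can be killed at a common stage.\<close>
  let ?killed = "\<lambda>x. \<forall>\<^sub>F l in sequentially. q l x = 0"
  have killedI: "?killed x" if "q l x = 0" for l x
    using q_killed[OF _ that] unfolding eventually_sequentially by blast
  have killed_sum: "?killed y" if y: "y \<in> carr (U 0)" and k: "\<And>k. ?killed (component (part 0) y k)" for y
  proof -
    from y obtain S where S: "finite S" "y = sum (component (part 0) y) S" by (rule T.component_supportE) blast
    have "\<forall>\<^sub>F l in sequentially. \<forall>k\<in>S. q l (component (part 0) y k) = 0"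
      using k by (intro eventually_ball_finite S(1)) blast
    then show ?thesis
    proof (rule eventually_mono)
      fix l assume "\<forall>k\<in>S. q l (component (part 0) y k) = 0"
      moreover have "q l (sum (component (part 0) y) S) = (\<Sum>k\<in>S. q l (component (part 0) y k))"
        by (rule lin_map_sum[OF vspaceD(1,2)[OF vU] q_lin T.component_in_carrier[OF y]])
      ultimately show "q l y = 0" using S(2) by simp
    qed
  qed
  \<comment> \<open>The induction has to be strong: the reduced coproduct of an element of degree n
    involves all degrees strictly between 0 and n.\<close>
  have hom: "?killed x" if "x \<in> K" "x \<in> part 0 n" for x n
    using that
  proof (induction n arbitrary: x rule: less_induct)
    case (less n)
    note xK = less.prems(1) and xn = less.prems(2)
    have xU: "x \<in> carr (U 0)" and px: "p x = 0" using xK by (auto simp: ker_on_def)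
    consider "n = 0 \<or> n = 1" | "n > 1" by linarith
    then show ?case
    proof cases
      case 1
      then have "x = 0" using K_components(2,3)[OF xK] T.component_homogeneous[OF xn] by auto
      then show ?thesis using q_zero killedI[of 0 0] by simp
    next
      case 2
      let ?u = "unit_el (U 0)"
      have u: "?u \<in> carr (U 0)" by (rule unital_algebraD(6)[OF alg])
      obtain r where r: "r \<in> tens.span {pure (U 0) [y, z] | y z j. 0 < j \<and> j < n \<and> y \<in> part 0 j \<and> z \<in> part 0 (n - j)}"
        and \<Delta>: "comul (U 0) x = pure (U 0) [x, ?u] + pure (U 0) [?u, x] + r"
        by (rule comul_reduced[OF gr degree_part_0[OF alg vV i_lin] xn]) (use 2 in auto)
      \<comment> \<open>\<open>E\<close> collects the tensor factors in one finite expression of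
        \<open>r\<close>. They have degrees j and n - j, both below n since 0 < j < n.\<close>
      have "\<exists>E. finite E \<and> E \<subseteq> (\<Union>j\<in>{..<n}. part 0 j) \<and> r \<in> sub_tensor (U 0) (T.span E) (T.span E)"
        using r
      proof (induction rule: tens.span_induct_alt)
        case base
        show ?case by (intro exI[of _ "{}"]) (simp add: sub_tensor_def tens.span_zero)
      next
        case (step c s t)
        then obtain E where E: "finite E" "E \<subseteq> (\<Union>j\<in>{..<n}. part 0 j)" "t \<in> sub_tensor (U 0) (T.span E) (T.span E)" by blast
        from step(1) obtain y z j where yz: "s = pure (U 0) [y, z]" "0 < j" "j < n" "y \<in> part 0 j" "z \<in> part 0 (n - j)" by blast
        let ?E = "insert y (insert z E)"
        have mono: "T.span E \<subseteq> T.span ?E" by (rule T.span_mono) blast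
        have "sub_tensor (U 0) (T.span E) (T.span E) \<subseteq> sub_tensor (U 0) (T.span ?E) (T.span ?E)"
          unfolding sub_tensor_def by (rule tens.span_mono) (use mono in blast)
        then have "t \<in> sub_tensor (U 0) (T.span ?E) (T.span ?E)" using E(3) by blast
        moreover have "y \<in> T.span ?E" "z \<in> T.span ?E" by (rule T.span_base; simp)+
        then have "s \<in> sub_tensor (U 0) (T.span ?E) (T.span ?E)"
          unfolding sub_tensor_def yz(1) by (intro tens.span_base) blast
        ultimately have "tscale c s + t \<in> sub_tensor (U 0) (T.span ?E) (T.span ?E)"
          unfolding sub_tensor_def using tens.span_add tens.span_scale by blast
        moreover have "?E \<subseteq> (\<Union>j\<in>{..<n}. part 0 j)"
        proof -
          have "j \<in> {..<n}" "n - j \<in> {..<n}" using yz by auto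
          then show ?thesis using E(2) yz(4,5) by blast
        qed
        ultimately show ?case using E(1) by (intro exI[of _ ?E]) simp
      qed
      then obtain E where E: "finite E" "E \<subseteq> (\<Union>j\<in>{..<n}. part 0 j)" "r \<in> sub_tensor (U 0) (T.span E) (T.span E)" by blast
      have EU: "T.span E \<subseteq> carr (U 0)"
        using E(2) T.part_subset by (intro T.span_minimal T.subspace_carrier) blast
      \<comment> \<open>Elements of the span of \<open>E\<close> need not be homogeneous, but their
        nonzero components stay below degree n, within reach of the induction hypothesis.\<close>
      have low: "component (part 0) y k = 0" if "y \<in> T.span E" "n \<le> k" for y k
      proof -
        have "component (part 0) y k \<in> {0}"
        proof (rule lin_map_span_image[OF T.vector_space_axioms T.subspace_carrier T.component_lin
              T.vector_space_axioms T.subspace_zero _ _ that(1)])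
          show "E \<subseteq> carr (U 0)" using EU T.span_superset by blast
          fix e assume "e \<in> E"
          then obtain j where "j < n" "e \<in> part 0 j" using E(2) by blast
          then show "component (part 0) e k \<in> {0}" using that(2) T.component_homogeneous by simp
        qed
        then show ?thesis by simp
      qed
      have killed: "?killed y" if "y \<in> K" "y \<in> T.span E" for y
      proof (rule killed_sum)
        show yU: "y \<in> carr (U 0)" using that EU by blast
        fix k
        show "?killed (component (part 0) y k)"
        proof (cases "k < n")
          case True
          then show ?thesis by (rule less.IH[OF _ K_components(1)[OF that(1)] T.component_in[OF yU]])
        next
          case False
          then have "component (part 0) y k = 0" using low[OF that(2)] by simp
          then show ?thesis using q_zero killedI[of 0 0] by simp
        qed
      qed
      \<comment> \<open>A basis of \<open>K \<inter> T.span E\<close>, finite because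
        \<open>E\<close> is. Killing it at one stage kills the whole intersection, although
        \<open>K\<close> may be infinite-dimensional in degrees below n.\<close>
      obtain Y where Y: "Y \<subseteq> K \<inter> T.span E" "T.independent Y" "K \<inter> T.span E \<subseteq> T.span Y"
        by (rule T.maximal_independent_subset)
      have "finite Y" using T.independent_span_bound[OF E(1) Y(2)] Y(1) by blast
      then have "\<forall>\<^sub>F l in sequentially. \<forall>y\<in>Y. q l y = 0"
        using killed Y(1) by (intro eventually_ball_finite) auto
      then obtain l where l: "\<forall>y\<in>Y. q l y = 0" using eventually_happens' sequentially_bot by blast
      \<comment> \<open>This is the kernel hypothesis of \<open>tensor_map_all_factor\<close>, with
        \<open>p\<close> in the role of \<open>h\<close> and \<open>q l\<close> in that of
        \<open>f\<close>.\<close>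
      have ql: "q l y = 0" if "y \<in> T.span E" "p y = 0" for y
      proof -
        have "y \<in> T.span Y" using that Y(3) EU by (auto simp: ker_on_def)
        then have "q l y \<in> {0}"
          by (rule lin_map_span_image[OF T.vector_space_axioms T.subspace_carrier q_lin
              vspaceD(1)[OF vU] vector_space.subspace_zero[OF vspaceD(1)[OF vU]], rotated 2])
            (use l Y(1) K_subset in auto)
        then show ?thesis by simp
      qed
      have zero: "pure B [0, unit_el B] = 0" "pure B [unit_el B, 0] = 0"
        using pure_zero[OF braided_bialgebraD(4)[OF bialg_B]] unital_algebraD(6)[OF braided_bialgebraD(1)[OF bialg_B]] by auto
      have "comul B (p x) = 0"
        using px lin_map_0[OF vspaceD(1,2)[OF braided_bialgebraD(4)[OF bialg_B]]
            counital_coalgebraD(2)[OF braided_bialgebraD(2)[OF bialg_B]]] by simp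
      \<comment> \<open>The coproduct of p x is 0 and both extremal terms contain p x = 0, so the
        image of \<open>r\<close> is all that remains of it.\<close>
      then have "tensor_map_all B p r = 0"
        using pD(5)[OF xU] by (simp add: \<Delta> tensor_map_all_add tensor_map_all_pair[OF pD(1)] xU u px pD(4) zero)
      then have "tensor_map_all (U l) (q l) r = 0"
        using tensor_map_all_factor[OF vU vU braided_bialgebraD(4)[OF bialg_B] T.subspace_span EU pD(1) q_lin ql E(3)] by blast
      then have prim: "q l x \<in> prim (U l)"
        using qD(5)[OF xU] qD(7)[OF xU]
        by (simp add: prim_def \<Delta> tensor_map_all_add tensor_map_all_pair[OF qD(1)] xU u qD(4))
      interpret G: graded_space "smul (U l)" "carr (U l)" "part l" by (rule graded_braided_bialgebraD(2)[OF gr])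
      have "q l x \<in> part l n" using part_q xn by blast
      then have "component (part l) (q l x) 1 = 0" using 2 G.component_homogeneous by simp
      moreover have "i l (b l (q l x)) = component (part l) (q l x) 1"
        using triv prim G.component_decomp[OF qD(7)[OF xU]] unfolding trivial_bracket_def by blast
      moreover have "q l x - i l (b l (q l x)) \<in> ker_on (U l) (\<pi> l)"
        unfolding ker_\<pi> using prim by (intro hull_inc) blast
      ultimately have "q (Suc l) x = 0" by (simp add: ker_on_def q_Suc)
      then show ?thesis by (rule killedI)
    qed
  qed
  have xU: "x \<in> carr (U 0)" using x K_subset by blast
  have "?killed x"
    by (rule killed_sum[OF xU hom[OF K_components(1)[OF x] T.component_in[OF xU]]])
  then have "\<exists>l. q l x = 0" using eventually_happens' sequentially_bot by blast
  then show ?thesis using \<pi>inf_zero_iff[OF xU] by simp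
qed

end

theorem proposition7p2:
  fixes V :: "('k::field, 'v::ab_group_add) braided_space"
    and U :: "nat \<Rightarrow> ('k, 'u::ab_group_add) braided_bialg"
    and \<pi> :: "nat \<Rightarrow> 'u \<Rightarrow> 'u"
    and i :: "nat \<Rightarrow> 'v \<Rightarrow> 'u"
    and b :: "nat \<Rightarrow> 'u \<Rightarrow> 'v"
    and L :: "('k, 'l::ab_group_add) braided_bialg"
    and \<pi>inf :: "nat \<Rightarrow> 'u \<Rightarrow> 'l"
    and B :: "('k, 'b::ab_group_add) braided_bialg"
    and p :: "'u \<Rightarrow> 'b"
    and W :: "'u set"
  assumes "braided_lie_algebra V U \<pi> i b L \<pi>inf"
    and "nichols_algebra V (U 0) (i 0) B p"
    and "W \<subseteq> carr (U 0)"
    and "ker_on (U 0) p = two_sided_ideal (U 0) hull W"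
  shows "(\<forall>w\<in>W. \<pi>inf 0 w = 0) \<longleftrightarrow> trivial_bracket V U i b"
proof -
  interpret bracket_nichols V U \<pi> i b L \<pi>inf B p
    using assms(1,2) by unfold_locales (auto simp: braided_lie_algebra_def)
  have inj: "inj_on (\<pi>inf 0 \<circ> i 0) (carr V)" using assms(1) by (simp add: braided_lie_algebra_def)
  show ?thesis
  proof
    assume W: "\<forall>w\<in>W. \<pi>inf 0 w = 0"
    \<comment> \<open>Vanishing on \<open>W\<close> extends to all of \<open>K\<close> because the
      kernel of the map to the limit is an ideal.\<close>
    have "two_sided_ideal (U 0) hull W \<subseteq> ker_on (U 0) (\<pi>inf 0)"
      by (rule ideal_hull_subset[OF ker_two_sided_ideal[OF bialg bialg_L hom_\<pi>inf]])
        (use W assms(3) in \<open>auto simp: ker_on_def\<close>)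
    then have "\<pi>inf 0 x = 0" if "x \<in> K" for x using that assms(4) by (auto simp: ker_on_def)
    then show "trivial_bracket V U i b" by (rule trivial_if_killed[OF inj])
  next
    assume "trivial_bracket V U i b"
    moreover have "W \<subseteq> K" unfolding assms(4) by (rule hull_subset)
    ultimately show "\<forall>w\<in>W. \<pi>inf 0 w = 0" using killed_if_trivial by blast
  qed
qed

end
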